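(* Let $\mathcal{T}$ be the family of pairwise non-isomorphic tree-like Hoffman graphs $\mathfrak{t}$ satisfying: (i) $\mathfrak{t}$ is integrally representable of norm $3$; (ii) every Hoffman graph $\mathfrak{h}$ which is integrally representable of norm $3$ and contains $\mathfrak{t}$ as an induced Hoffman subgraph with $V_s(\mathfrak{h})=V_s(\mathfrak{t})$ is indecomposable. Then every maximal member of $\mathcal{T}$ (with respect to being an induced Hoffman subgraph) is isomorphic to one of the Hoffman graphs in $\mathfrak{F}$.
   Context: A Hoffman graph $\mathfrak{h}$ is a finite simple graph $H$ whose vertices are labelled slim or fat, such that every fat vertex is adjacent to at least one slim vertex and fat vertices are pairwise nonadjacent; $V_s(\mathfrak{h})$, $V_f(\mathfrak{h})$ are the slim/fat vertex sets. An induced Hoffman subgraph is an induced subgraph of $H$ with inherited labels; isomorphisms are label-preserving. $\mathfrak{h}$ is tree-like if $H$ is a tree. The special matrix is $Sp(\mathfrak{h})=A_s-CC^T$, where $\begin{pmatrix}A_s&C\\C^T&0\end{pmatrix}$ is the adjacency matrix of $H$ with fat vertices last. $\mathfrak{h}$ is integrally representable of norm $3$ if there is $\phi:V(\mathfrak{h})\to\mathbb{Z}^n$ with $(\phi(x),\phi(x))=3$ for slim $x$, $=1$ for fat $x$, and for distinct $x,y$: $(\phi(x),\phi(y))=1$ if adjacent, $0$ otherwise. $\mathfrak{h}$ is the direct sum $\mathfrak{h}^1\oplus\mathfrak{h}^2$ if there is a partition $\{V^1,V^2\}$ of $V_s(\mathfrak{h})$ such that the induced Hoffman subgraph on $V^i$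 together with all fat vertices adjacent to $V^i$ is $\mathfrak{h}^i$ ($i=1,2$) and $Sp(\mathfrak{h})$ is block diagonal with respect to this partition. $\mathfrak{h}$ is decomposable if it is such a direct sum with $V^1,V^2$ both nonempty, and indecomposable otherwise. The family $\mathfrak{F}$ consists of: (1) one slim vertex with three fat neighbours; (2) one fat vertex $f$ with three slim vertices each adjacent only to $f$; (3) slim $x,y,z$, fat $f,g$, edges exactly $xf,fy,yg,gz$; (4) for $m\ge2$, $\mathfrak{c}_m$: slim $y_1,\ldots,y_m$, fat $f_1,f_{1,2},f_m$, edges exactly $y_iy_{i+2}$ ($1\le i\le m-2$), $f_1y_1,f_{1,2}y_1,f_{1,2}y_2,f_my_m$. *)

theory Defs
  imports
    "Graph_Theory.Digraph_Component"
    "HOL-Library.Infinite_Typeclass"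
begin

text \<open>
  A finite simple graph is a \<^locale>\<open>pair_graph\<close>: a finite, loopfree, symmetric digraph without
  parallel arcs, so that an edge \<open>xy\<close> is the pair of arcs \<open>(x, y)\<close>, \<open>(y, x)\<close>.
  The labelling is recorded by the set of fat vertices; all other vertices are slim.
\<close>

record 'a hoffman =
  hgraph :: "'a pair_pre_digraph"
  fat :: "'a set"

definition hverts :: "'a hoffman \<Rightarrow> 'a set" where
  "hverts h = pverts (hgraph h)"

definition slim :: "'a hoffman \<Rightarrow> 'a set" where
  "slim h = hverts h - fat h"

definition adj :: "'a hoffman \<Rightarrow> 'a \<Rightarrow> 'a \<Rightarrow> bool" where
  "adj h x y \<longleftrightarrow> (x, y) \<in> parcs (hgraph h)"

definition hoffman_graph :: "'a hoffman \<Rightarrow> bool" where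
  "hoffman_graph h \<longleftrightarrow>
     pair_graph (hgraph h) \<and> fat h \<subseteq> hverts h \<and>
     (\<forall>f\<in>fat h. \<exists>x\<in>slim h. adj h f x) \<and>
     (\<forall>f\<in>fat h. \<forall>g\<in>fat h. \<not> adj h f g)"

definition induced_hoffman_subgraph :: "'a hoffman \<Rightarrow> 'a hoffman \<Rightarrow> bool" where
  "induced_hoffman_subgraph k h \<longleftrightarrow>
     induced_subgraph (with_proj (hgraph k)) (with_proj (hgraph h)) \<and>
     fat k = fat h \<inter> hverts k"

definition hoffman_iso :: "'a hoffman \<Rightarrow> 'b hoffman \<Rightarrow> bool" where
  "hoffman_iso h k \<longleftrightarrow>
     (\<exists>\<pi>. bij_betw \<pi> (hverts h) (hverts k) \<and>
       (\<forall>x\<in>hverts h. \<forall>y\<in>hverts h. adj h x y \<longleftrightarrow> adj k (\<pi> x) (\<pi> y)) \<and>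
       (\<forall>x\<in>hverts h. x \<in> fat h \<longleftrightarrow> \<pi> x \<in> fat k))"

definition embeds_as_induced :: "'a hoffman \<Rightarrow> 'b hoffman \<Rightarrow> bool" where
  "embeds_as_induced t h \<longleftrightarrow> (\<exists>k. induced_hoffman_subgraph k h \<and> hoffman_iso t k)"

text \<open>
  The predicates \<open>tree\<close> and \<open>forest\<close> of \<open>Graph_Theory\<close> cannot be used for an undirected graph
  given by a symmetric arc set: there the two arcs of a single edge form a cycle of length 2.
  The cycles of the undirected graph are the cycles with at least three arcs.
\<close>

definition tree_like :: "'a hoffman \<Rightarrow> bool" where
  "tree_like h \<longleftrightarrow>
     connected (with_proj (hgraph h)) \<and>
     \<not> (\<exists>p. pre_digraph.cycle (with_proj (hgraph h)) p \<and> 3 \<le> length p)"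

text \<open>
  Matrices are indexed by the vertices themselves. The entries of the special matrix are
  meaningful for slim \<open>x\<close> and \<open>y\<close>; the sum is the \<open>(x, y)\<close> entry of \<open>C C\<^sup>T\<close>.
\<close>

definition adj_mat :: "'a hoffman \<Rightarrow> 'a \<Rightarrow> 'a \<Rightarrow> int" where
  "adj_mat h x y = of_bool (adj h x y)"

definition special_matrix :: "'a hoffman \<Rightarrow> 'a \<Rightarrow> 'a \<Rightarrow> int" where
  "special_matrix h x y = adj_mat h x y - (\<Sum>f\<in>fat h. adj_mat h x f * adj_mat h y f)"

text \<open>A vector of \<open>\<int>\<^sup>n\<close> is a function on \<open>nat\<close> of which only the values below \<open>n\<close> matter.\<close>

definition inner_int :: "nat \<Rightarrow> (nat \<Rightarrow> int) \<Rightarrow> (nat \<Rightarrow> int) \<Rightarrow> int" where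
  "inner_int n u v = (\<Sum>i<n. u i * v i)"

definition integrally_representable :: "int \<Rightarrow> 'a hoffman \<Rightarrow> bool" where
  "integrally_representable m h \<longleftrightarrow>
     (\<exists>n (\<phi> :: 'a \<Rightarrow> nat \<Rightarrow> int).
       (\<forall>x\<in>slim h. inner_int n (\<phi> x) (\<phi> x) = m) \<and>
       (\<forall>x\<in>fat h. inner_int n (\<phi> x) (\<phi> x) = 1) \<and>
       (\<forall>x\<in>hverts h. \<forall>y\<in>hverts h. x \<noteq> y \<longrightarrow>
          inner_int n (\<phi> x) (\<phi> y) = (if adj h x y then 1 else 0)))"

definition fat_nbrs :: "'a hoffman \<Rightarrow> 'a set \<Rightarrow> 'a set" where
  "fat_nbrs h V = {f \<in> fat h. \<exists>x\<in>V. adj h x f}"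

text \<open>
  \<open>direct_sum_wrt h V1 V2 h1 h2\<close>: \<open>h\<close> is the direct sum of \<open>h1\<close> and \<open>h2\<close>, witnessed by the
  partition of the slim vertices into \<open>V1\<close> and \<open>V2\<close> (either of which may be empty here).
\<close>

definition direct_sum_wrt ::
  "'a hoffman \<Rightarrow> 'a set \<Rightarrow> 'a set \<Rightarrow> 'a hoffman \<Rightarrow> 'a hoffman \<Rightarrow> bool" where
  "direct_sum_wrt h V1 V2 h1 h2 \<longleftrightarrow>
     V1 \<union> V2 = slim h \<and> V1 \<inter> V2 = {} \<and>
     induced_hoffman_subgraph h1 h \<and> hverts h1 = V1 \<union> fat_nbrs h V1 \<and>
     induced_hoffman_subgraph h2 h \<and> hverts h2 = V2 \<union> fat_nbrs h V2 \<and>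
     (\<forall>x\<in>V1. \<forall>y\<in>V2. special_matrix h x y = 0 \<and> special_matrix h y x = 0)"

definition decomposable :: "'a hoffman \<Rightarrow> bool" where
  "decomposable h \<longleftrightarrow>
     (\<exists>V1 V2 h1 h2. V1 \<noteq> {} \<and> V2 \<noteq> {} \<and> direct_sum_wrt h V1 V2 h1 h2)"

abbreviation indecomposable :: "'a hoffman \<Rightarrow> bool" where
  "indecomposable h \<equiv> \<not> decomposable h"

text \<open>
  Condition (ii) quantifies over the Hoffman graphs \<open>h\<close> on the same vertex type as \<open>t\<close>. It is
  meant for infinite vertex types, where every finite extension of \<open>t\<close> has an isomorphic copy
  containing \<open>t\<close> itself.
\<close>

definition in_class_T :: "'a::infinite hoffman \<Rightarrow> bool" where
  "in_class_T t \<longleftrightarrow>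
     hoffman_graph t \<and> tree_like t \<and>
     integrally_representable 3 t \<and>
     (\<forall>h :: 'a hoffman.
        hoffman_graph h \<and> integrally_representable 3 h \<and>
        induced_hoffman_subgraph t h \<and> slim h = slim t \<longrightarrow> indecomposable h)"

text \<open>
  A family of pairwise non-isomorphic Hoffman graphs that contains every graph with
  property \<open>P\<close> up to isomorphism.
\<close>

definition iso_representatives :: "('a hoffman \<Rightarrow> bool) \<Rightarrow> 'a hoffman set \<Rightarrow> bool" where
  "iso_representatives P T \<longleftrightarrow>
     (\<forall>t\<in>T. P t) \<and>
     (\<forall>t\<in>T. \<forall>t'\<in>T. hoffman_iso t t' \<longrightarrow> t = t') \<and>
     (\<forall>t. P t \<longrightarrow> (\<exists>t'\<in>T. hoffman_iso t t'))"

definition maximal_member :: "'a hoffman set \<Rightarrow> 'a hoffman \<Rightarrow> bool" where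
  "maximal_member T t \<longleftrightarrow>
     t \<in> T \<and> (\<forall>t'\<in>T. embeds_as_induced t t' \<longrightarrow> t' = t)"

datatype label = S nat | F nat

definition mk_hoffman :: "'a set \<Rightarrow> 'a set \<Rightarrow> ('a \<times> 'a) set \<Rightarrow> 'a hoffman" where
  "mk_hoffman Vs Vf E =
     \<lparr> hgraph = \<lparr> pverts = Vs \<union> Vf, parcs = E \<union> E\<inverse> \<rparr>, fat = Vf \<rparr>"

definition three_fat :: "label hoffman" where
  "three_fat = mk_hoffman {S 1} {F 1, F 2, F 3} {(S 1, F 1), (S 1, F 2), (S 1, F 3)}"

definition three_slim :: "label hoffman" where
  "three_slim = mk_hoffman {S 1, S 2, S 3} {F 1} {(S 1, F 1), (S 2, F 1), (S 3, F 1)}"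

definition slim_ended_path :: "label hoffman" where
  "slim_ended_path = mk_hoffman {S 1, S 2, S 3} {F 1, F 2}
     {(S 1, F 1), (F 1, S 2), (S 2, F 2), (F 2, S 3)}"

text \<open>
  In \<open>\<cc>\<^sub>m\<close>, the vertex \<open>y\<^sub>i\<close> is \<open>S i\<close>, and \<open>f\<^sub>1\<close>, \<open>f\<^sub>1\<^sub>,\<^sub>2\<close>, \<open>f\<^sub>m\<close> are
  \<open>F 1\<close>, \<open>F 2\<close>, \<open>F 3\<close>.
\<close>

definition c_graph :: "nat \<Rightarrow> label hoffman" where
  "c_graph m = mk_hoffman (S ` {1..m}) {F 1, F 2, F 3}
     ({(S i, S (i + 2)) | i. 1 \<le> i \<and> i + 2 \<le> m} \<union>
      {(F 1, S 1), (F 2, S 1), (F 2, S 2), (F 3, S m)})"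

definition family_F :: "label hoffman set" where
  "family_F = {three_fat, three_slim, slim_ended_path} \<union> {c_graph m | m. 2 \<le> m}"

end

theory Submission
  imports Defs
begin

text \<open>
  Fix a maximal member \<open>t\<close> and a representation \<open>\<phi>\<close> of norm 3; slim vertices have three coordinates
  \<open>\<plusminus>1\<close>, fat ones have one. Two principles drive the argument. If \<open>K\<close> is a set of coordinates on
  which all slim vertices agree in sign, attaching a fat vertex at each coordinate of \<open>K\<close> yields an
  extension of \<open>t\<close> with the same slim vertices, so by (ii) the slim vertices cannot be split into two
  parts that are orthogonal outside \<open>K\<close> and the fat coordinates. And a coordinate used by a single slim
  vertex would allow a pendant fat vertex to be added, against maximality.

  A hub is a vertex \<open>f\<close> with a coordinate \<open>g\<close> such that all other vertices using \<open>g\<close> are neighbours of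
  \<open>f\<close> meeting it in \<open>g\<close> only. Three such members force the fat vertex with three slim neighbours. For
  two members \<open>\<plusminus>g + a + b\<close> and \<open>\<plusminus>g - a + c\<close>, acyclicity leaves few possible types for the other vertices
  on \<open>a, b, c\<close>; they lead to the path with slim ends, or to a sequence \<open>y\<^sub>1, y\<^sub>2, \<dots>\<close> of slim vertices
  supported on consecutive triples of a list of coordinates, which closes up to a \<open>\<cc>\<^sub>m\<close>. A vertex of
  degree at least four (or a fat one of degree at least two) produces a hub. In the remaining trees
  the representation with one coordinate per edge is nonnegative, so there is only one slim vertex.
\<close>

section \<open>Hoffman graphs through their adjacency relation\<close>

text \<open>Off the diagonal, the special matrix is the Gram matrix of the slim vectors with the fat
  coordinates deleted. Attaching a fat vertex at a coordinate therefore deletes it, and the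
  obstruction is a coordinate that carries both signs. At a hub coordinate every vertex using it has
  the sign of \<open>f\<close>, since the only common coordinate with \<open>f\<close> must supply
  the inner product 1. Two members have the common neighbour \<open>f\<close>, hence are
  nonadjacent, and their product 1 at \<open>g\<close> must be cancelled at a second coordinate
  \<open>a\<close>; all later case distinctions grow out of this cancellation. At a slim vertex
  \<open>y\<close> of degree four, pigeonhole puts two neighbours at the same one of its three
  coordinates. What can spoil a hub there is a non-neighbour of \<open>y\<close> that meets it in
  two coordinates with opposite products. The predicate \<open>blocked\<close> records this
  situation, which turns out to be too restrictive for four neighbours. A representation is far from
  unique. Both principles hold for each of them, and exchanging \<open>\<phi>\<close> for another
  one is decisive twice: for a path on five vertices and for the trees of small degree.\<close>

lemma hoffman_graph_iff:
  "hoffman_graph h \<longleftrightarrow>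
     finite (hverts h) \<and>
     (\<forall>x y. adj h x y \<longrightarrow> x \<in> hverts h \<and> y \<in> hverts h \<and> x \<noteq> y \<and> adj h y x) \<and>
     fat h \<subseteq> hverts h \<and>
     (\<forall>f\<in>fat h. \<exists>x\<in>slim h. adj h f x) \<and>
     (\<forall>f\<in>fat h. \<forall>g\<in>fat h. \<not> adj h f g)"
proof -
  have "pair_graph (hgraph h) \<longleftrightarrow> finite (hverts h) \<and>
     (\<forall>x y. adj h x y \<longrightarrow> x \<in> hverts h \<and> y \<in> hverts h \<and> x \<noteq> y \<and> adj h y x)"
    (is "?L \<longleftrightarrow> ?R")
  proof
    assume ?L
    then interpret pair_graph "hgraph h" .
    show ?R
      using pair_finite_verts in_arcsD1 in_arcsD2 pair_no_loops[of "(x, y)" for x y] pair_sym_arcs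
      by (auto simp: hverts_def adj_def symmetric_def sym_def)
  next
    assume R: ?R
    then have "parcs (hgraph h) \<subseteq> hverts h \<times> hverts h"
      by (auto simp: adj_def)
    then have "finite (parcs (hgraph h))"
      using R finite_subset by blast
    with R show ?L
      by unfold_locales (auto simp: hverts_def adj_def symmetric_def intro!: symI)
  qed
  then show ?thesis
    by (auto simp: hoffman_graph_def)
qed

text \<open>The second assumption is the well-formedness of \<open>k\<close> as a digraph, which
  \<open>subgraph\<close> demands beyond the containment of vertices and arcs.\<close>

lemma induced_hoffman_subgraph_iff:
  assumes "hoffman_graph h"
    and "\<And>x y. adj k x y \<Longrightarrow> x \<in> hverts k \<and> y \<in> hverts k"
  shows "induced_hoffman_subgraph k h \<longleftrightarrow>
     hverts k \<subseteq> hverts h \<and>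
     (\<forall>x\<in>hverts k. \<forall>y\<in>hverts k. adj k x y \<longleftrightarrow> adj h x y) \<and>
     fat k = fat h \<inter> hverts k"
proof -
  have wf: "wf_digraph (with_proj (hgraph h))" "wf_digraph (with_proj (hgraph k))"
    using assms unfolding hoffman_graph_iff
    by (auto simp: wf_digraph_def adj_def hverts_def)
  have "adj k x y \<longleftrightarrow> adj k x y \<and> x \<in> hverts k \<and> y \<in> hverts k" for x y
    using assms(2) by blast
  then have "(\<forall>x y. adj k x y \<longleftrightarrow> adj h x y \<and> x \<in> hverts k \<and> y \<in> hverts k) \<longleftrightarrow>
    (\<forall>x\<in>hverts k. \<forall>y\<in>hverts k. adj k x y \<longleftrightarrow> adj h x y)"
    by blast
  moreover have "induced_hoffman_subgraph k h \<longleftrightarrow> hverts k \<subseteq> hverts h \<and>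
     (\<forall>x y. adj k x y \<longleftrightarrow> adj h x y \<and> x \<in> hverts k \<and> y \<in> hverts k) \<and>
     fat k = fat h \<inter> hverts k"
  proof -
    define E where "E \<longleftrightarrow> parcs (hgraph k) =
      {e \<in> parcs (hgraph h). fst e \<in> pverts (hgraph k) \<and> snd e \<in> pverts (hgraph k)}"
    have E: "E \<longleftrightarrow> (\<forall>x y. adj k x y \<longleftrightarrow> adj h x y \<and> x \<in> hverts k \<and> y \<in> hverts k)"
      unfolding E_def adj_def hverts_def set_eq_iff by simp
    have "parcs (hgraph k) \<subseteq> parcs (hgraph h)" if E using that unfolding E_def by blast
    moreover have "induced_hoffman_subgraph k h \<longleftrightarrow>
      (hverts k \<subseteq> hverts h \<and> parcs (hgraph k) \<subseteq> parcs (hgraph h)) \<and> E \<and> fat k = fat h \<inter> hverts k"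
      unfolding induced_hoffman_subgraph_def induced_subgraph_def subgraph_def compatible_def
        E_def hverts_def
      using wf by simp
    ultimately show ?thesis unfolding E[symmetric] by blast
  qed
  ultimately show ?thesis by simp
qed

lemma induced_hoffman_subgraphD:
  assumes "induced_hoffman_subgraph k h"
  shows "hverts k \<subseteq> hverts h"
    and "\<And>x y. adj k x y \<longleftrightarrow> adj h x y \<and> x \<in> hverts k \<and> y \<in> hverts k"
    and "fat k = fat h \<inter> hverts k"
proof -
  have ind: "pverts (hgraph k) \<subseteq> pverts (hgraph h)"
    "parcs (hgraph k) = {e \<in> parcs (hgraph h). fst e \<in> pverts (hgraph k) \<and> snd e \<in> pverts (hgraph k)}"
    and f: "fat k = fat h \<inter> hverts k"
    using assms
    unfolding induced_hoffman_subgraph_def induced_subgraph_def subgraph_def with_proj_simps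
    by blast+
  show "hverts k \<subseteq> hverts h" using ind(1) by (simp add: hverts_def)
  show "adj k x y \<longleftrightarrow> adj h x y \<and> x \<in> hverts k \<and> y \<in> hverts k" for x y
    unfolding adj_def hverts_def by (subst ind(2)) simp
  show "fat k = fat h \<inter> hverts k" by (rule f)
qed

lemma induced_hoffman_subgraph_trans:
  assumes "hoffman_graph h" "induced_hoffman_subgraph t k" "induced_hoffman_subgraph k h"
  shows "induced_hoffman_subgraph t h"
  using induced_hoffman_subgraphD[OF assms(2)] induced_hoffman_subgraphD[OF assms(3)]
  by (subst induced_hoffman_subgraph_iff[OF assms(1)]) blast+

lemma rtrancl_on_conv_rtrancl:
  assumes "r \<subseteq> V \<times> V"
  shows "(u, v) \<in> rtrancl_on V r \<longleftrightarrow> (u, v) \<in> r\<^sup>* \<and> u \<in> V"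
proof
  assume "(u, v) \<in> rtrancl_on V r"
  then show "(u, v) \<in> r\<^sup>* \<and> u \<in> V"
    by (induction rule: rtrancl_on.induct) auto
next
  assume "(u, v) \<in> r\<^sup>* \<and> u \<in> V"
  then have "(u, v) \<in> r\<^sup>*" "u \<in> V" by auto
  then show "(u, v) \<in> rtrancl_on V r"
  proof (induction rule: rtrancl_induct)
    case (step y z)
    then show ?case using assms by (auto intro: rtrancl_on_into_rtrancl_on)
  qed auto
qed

lemma connected_iff:
  assumes "hoffman_graph h"
  shows "connected (with_proj (hgraph h)) \<longleftrightarrow>
    hverts h \<noteq> {} \<and> (\<forall>u\<in>hverts h. \<forall>v\<in>hverts h. (adj h)\<^sup>*\<^sup>* u v)"
proof -
  have eq: "parcs (mk_symmetric (with_proj (hgraph h))) = {(x, y). adj h x y}"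
    using assms by (auto simp: parcs_mk_symmetric hoffman_graph_iff adj_def)
  have sub: "{(x, y). adj h x y} \<subseteq> hverts h \<times> hverts h"
    using assms unfolding hoffman_graph_iff by blast
  have "(adj h)\<^sup>*\<^sup>* u v \<longleftrightarrow> (u, v) \<in> {(x, y). adj h x y}\<^sup>*" for u v
    by (simp add: rtranclp_rtrancl_eq)
  then show ?thesis
    unfolding connected_def strongly_connected_def reachable_def
    by (auto simp: eq rtrancl_on_conv_rtrancl[OF sub] hverts_def[symmetric])
qed

text \<open>The starting point is listed once only, so that plain distinctness of the list expresses
  that the cycle repeats no vertex.\<close>

definition vertex_cycle :: "('a \<Rightarrow> 'a \<Rightarrow> bool) \<Rightarrow> 'a list \<Rightarrow> bool" where
  "vertex_cycle R vs \<longleftrightarrow>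
     distinct vs \<and> 3 \<le> length vs \<and> successively R vs \<and> R (last vs) (hd vs)"

lemma pcas_vertices:
  assumes "pcas u p v" "p \<noteq> []"
  shows "successively (\<lambda>x y. (x, y) \<in> set p) (map fst p)"
    and "(last (map fst p), v) \<in> set p" and "hd (map fst p) = u"
    and "pawalk_verts u p = map fst p @ [v]"
proof -
  have "successively (\<lambda>x y. (x, y) \<in> set p) (map fst p) \<and>
    (last (map fst p), v) \<in> set p \<and> hd (map fst p) = u \<and> pawalk_verts u p = map fst p @ [v]"
    using assms
  proof (induction p arbitrary: u)
    case (Cons e p)
    show ?case
    proof (cases "p = []")
      case True
      then show ?thesis using Cons by auto
    next
      case False
      have "successively (\<lambda>x y. (x, y) \<in> set (e # p)) (map fst p)"
        by (rule successively_mono[where P = "\<lambda>x y. (x, y) \<in> set p"])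
           (use Cons False in auto)
      moreover have "hd (map fst p) = snd e"
        using Cons.IH[of "snd e"] Cons.prems False by auto
      ultimately show ?thesis
        using Cons.IH[of "snd e"] Cons.prems False by (auto simp: successively_Cons)
    qed
  qed auto
  then show "successively (\<lambda>x y. (x, y) \<in> set p) (map fst p)"
    "(last (map fst p), v) \<in> set p" "hd (map fst p) = u"
    "pawalk_verts u p = map fst p @ [v]" by auto
qed

lemma vertex_cycle_pcas:
  assumes "vs \<noteq> []" "successively R vs" "R (last vs) w"
  shows "\<exists>p. pcas (hd vs) p w \<and> map fst p = vs \<and> set p \<subseteq> {(x, y). R x y}"
  using assms
proof (induction vs)
  case (Cons x vs)
  show ?case
  proof (cases "vs = []")
    case True
    then show ?thesis using Cons by (intro exI[of _ "[(x, w)]"]) auto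
  next
    case False
    then obtain p where "pcas (hd vs) p w" "map fst p = vs" "set p \<subseteq> {(x, y). R x y}"
      using Cons by (auto simp: successively_Cons)
    then show ?thesis
      using Cons.prems False
      by (intro exI[of _ "(x, hd vs) # p"]) (auto simp: successively_Cons)
  qed
qed auto

lemma long_cycle_iff:
  assumes "hoffman_graph h"
  shows "(\<exists>p. pre_digraph.cycle (with_proj (hgraph h)) p \<and> 3 \<le> length p) \<longleftrightarrow>
    (\<exists>vs. vertex_cycle (adj h) vs)"
proof
  assume "\<exists>p. pre_digraph.cycle (with_proj (hgraph h)) p \<and> 3 \<le> length p"
  then obtain p u where p: "set p \<subseteq> parcs (hgraph h)" "pcas u p u"
    "distinct (tl (pawalk_verts u p))" "p \<noteq> []" "3 \<le> length p"
    by (auto simp: pre_digraph.cycle_def pre_digraph.awalk_def cas_with_proj_eq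
        awalk_verts_with_proj_eq)
  note pc = pcas_vertices[OF p(2) p(4)]
  have "successively (adj h) (map fst p)"
    using pc(1) by (rule successively_mono) (use p in \<open>auto simp: adj_def\<close>)
  moreover have "distinct (map fst p)"
    using p(3,4) pc(3,4) by (cases p) auto
  ultimately have "vertex_cycle (adj h) (map fst p)"
    using p pc unfolding vertex_cycle_def by (auto simp: adj_def)
  then show "\<exists>vs. vertex_cycle (adj h) vs" by blast
next
  assume "\<exists>vs. vertex_cycle (adj h) vs"
  then obtain vs where vs: "vertex_cycle (adj h) vs" by blast
  then have ne: "vs \<noteq> []" by (auto simp: vertex_cycle_def)
  obtain p where p: "pcas (hd vs) p (hd vs)" "map fst p = vs" "set p \<subseteq> {(x, y). adj h x y}"
    using vertex_cycle_pcas[of vs "adj h" "hd vs"] vs ne by (auto simp: vertex_cycle_def)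
  have pne: "p \<noteq> []" using p ne by auto
  have "distinct (tl (pawalk_verts (hd vs) p))"
    using pcas_vertices[OF p(1) pne] p vs ne
    by (cases vs) (auto simp: vertex_cycle_def)
  moreover have "hd vs \<in> pverts (hgraph h)"
    using vs assms by (auto simp: vertex_cycle_def hoffman_graph_iff hverts_def)
  moreover have "length p = length vs" using p by auto
  ultimately show "\<exists>p. pre_digraph.cycle (with_proj (hgraph h)) p \<and> 3 \<le> length p"
    using p vs pne
    by (intro exI[of _ p])
      (auto simp: pre_digraph.cycle_def pre_digraph.awalk_def cas_with_proj_eq
        awalk_verts_with_proj_eq vertex_cycle_def adj_def)
qed

lemma tree_like_iff:
  assumes "hoffman_graph h"
  shows "tree_like h \<longleftrightarrow>
    hverts h \<noteq> {} \<and> (\<forall>u\<in>hverts h. \<forall>v\<in>hverts h. (adj h)\<^sup>*\<^sup>* u v) \<and>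
    (\<nexists>vs. vertex_cycle (adj h) vs)"
  unfolding tree_like_def connected_iff[OF assms] long_cycle_iff[OF assms] by blast

section \<open>Acyclicity\<close>

text \<open>A connected vertex set given by a construction: explicit sets such as a hub with its
  members are certified by applying the two rules, and paths inside them come from
  induction.\<close>

inductive grown :: "('a \<Rightarrow> 'a \<Rightarrow> bool) \<Rightarrow> 'a set \<Rightarrow> bool" for R where
  "grown R {v}"
| "grown R D \<Longrightarrow> u \<in> D \<Longrightarrow> R u v \<Longrightarrow> grown R (insert v D)"

lemma grown_path:
  assumes "grown R D" "symp R" "u \<in> D" "v \<in> D"
  shows "\<exists>vs. vs \<noteq> [] \<and> hd vs = u \<and> last vs = v \<and> set vs \<subseteq> D \<and> distinct vs \<and> successively R vs"
  using assms
proof (induction arbitrary: u v rule: grown.induct)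
  case (1 w)
  then show ?case by (intro exI[of _ "[w]"]) auto
next
  case (2 D w z)
  note IH = 2(4)[OF \<open>symp R\<close>]
  have wD: "w \<in> D" and wz: "R w z" and uv: "u \<in> insert z D" "v \<in> insert z D"
    using 2 by blast+
  have base: "\<exists>vs. vs \<noteq> [] \<and> hd vs = a \<and> last vs = z \<and> set vs \<subseteq> insert z D \<and>
      distinct vs \<and> successively R vs" if a: "a \<in> D" and z: "z \<notin> D" for a
  proof -
    obtain vs where vs: "vs \<noteq> []" "hd vs = a" "last vs = w" "set vs \<subseteq> D" "distinct vs"
      "successively R vs"
      using IH[OF a wD] by blast
    then show ?thesis
      using wz z by (intro exI[of _ "vs @ [z]"]) (auto simp: successively_append_iff)
  qed
  consider "u \<in> D" "v \<in> D" | "u = z" "v = z" | "u \<in> D" "v = z" "z \<notin> D" | "v \<in> D" "u = z" "z \<notin> D"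
    using uv by blast
  then show ?case
  proof cases
    case 1
    then show ?thesis using IH[of u v] by (meson subset_insertI2)
  next
    case 2
    then show ?thesis by (intro exI[of _ "[z]"]) auto
  next
    case 3
    then show ?thesis using base[of u] by blast
  next
    case 4
    then obtain vs where vs: "vs \<noteq> []" "hd vs = v" "last vs = u" "set vs \<subseteq> insert z D"
      "distinct vs" "successively R vs"
      using base[of v] by blast
    \<comment> \<open>The path was built with the new vertex at its end; the case where this vertex
      is the start is its reversal.\<close>
    have "successively R (rev vs)"
      unfolding successively_rev
      by (rule successively_mono[OF vs(6)]) (use sympD[OF \<open>symp R\<close>] in blast)
    then show ?thesis
      using vs by (intro exI[of _ "rev vs"]) (auto simp: hd_rev last_rev)
  qed
qed

text \<open>Two different neighbours of \<open>z\<close> in \<open>D\<close>, joined by a path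
  inside \<open>D\<close>, would close a cycle through \<open>z\<close>. Apart from a few short
  explicit cycles, this is how acyclicity enters the later arguments.\<close>

lemma grown_nbr_unique:
  assumes "grown R D" "symp R" "\<nexists>vs. vertex_cycle R vs"
    and "z \<notin> D" "u \<in> D" "v \<in> D" "R z u" "R z v"
  shows "u = v"
proof (rule ccontr)
  assume "u \<noteq> v"
  obtain vs where vs: "vs \<noteq> []" "hd vs = u" "last vs = v" "set vs \<subseteq> D" "distinct vs"
    "successively R vs"
    using grown_path[OF assms(1,2,5,6)] by blast
  have "length vs \<noteq> 1"
    using vs \<open>u \<noteq> v\<close> by (cases vs) auto
  moreover have "length vs \<noteq> 0" using vs by auto
  ultimately have "2 \<le> length vs" by linarith
  moreover have "R v z" using sympD[OF assms(2) assms(8)] .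
  ultimately have "vertex_cycle R (z # vs)"
    using vs assms by (auto simp: vertex_cycle_def successively_Cons)
  then show False using assms by blast
qed

lemma vertex_cycle_rotate:
  assumes "vertex_cycle R vs"
  shows "vertex_cycle R (rotate k vs)"
proof (induction k)
  case (Suc k)
  define ws where "ws = rotate k vs"
  have ws: "vertex_cycle R ws" using Suc unfolding ws_def .
  then obtain x xs where x: "ws = x # xs" "xs \<noteq> []"
    unfolding vertex_cycle_def by (cases ws; cases "tl ws") auto
  have "vertex_cycle R (xs @ [x])"
    using ws x by (auto simp: vertex_cycle_def successively_append_iff successively_Cons)
  then show ?case using x by (simp add: ws_def[symmetric])
qed (use assms in simp)

text \<open>Once the cycle is rotated so that \<open>z\<close> comes first, the second and the last
  vertex are the two neighbours. This keeps a newly attached leaf off every cycle.\<close>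

lemma vertex_cycle_two_nbrs:
  assumes "vertex_cycle R vs" "z \<in> set vs" "symp R"
  shows "\<exists>u\<in>set vs. \<exists>v\<in>set vs. u \<noteq> v \<and> R z u \<and> R z v"
proof -
  obtain k where k: "k < length vs" "vs ! k = z" using assms by (auto simp: in_set_conv_nth)
  define ws where "ws = rotate k vs"
  have ws: "vertex_cycle R ws" "set ws = set vs"
    using vertex_cycle_rotate[OF assms(1)] by (auto simp: ws_def)
  have "hd ws = z" using k by (cases "vs = []") (auto simp: ws_def hd_rotate_conv_nth)
  then obtain x y xs where x: "ws = z # x # xs" "xs \<noteq> []"
    using ws unfolding vertex_cycle_def
    by (cases ws; cases "tl ws"; cases "tl (tl ws)") auto
  have "R z x" "R (last xs) z" "x \<noteq> last xs"
    using x ws(1) by (auto simp: vertex_cycle_def)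
  moreover from this have "R z (last xs)" using sympD[OF assms(3)] by blast
  moreover have "x \<in> set vs" "last xs \<in> set vs" using x by (auto simp: ws(2)[symmetric])
  ultimately show ?thesis by blast
qed

section \<open>Representations and their fat extensions\<close>

text \<open>A normalised representation: the values from \<open>n\<close> on, which the inner
  product ignores, are set to 0, so that supports are finite sets with the right
  cardinality.\<close>

definition rep3 :: "'a hoffman \<Rightarrow> nat \<Rightarrow> ('a \<Rightarrow> nat \<Rightarrow> int) \<Rightarrow> bool" where
  "rep3 h n \<phi> \<longleftrightarrow>
     (\<forall>x\<in>slim h. inner_int n (\<phi> x) (\<phi> x) = 3) \<and>
     (\<forall>x\<in>fat h. inner_int n (\<phi> x) (\<phi> x) = 1) \<and>
     (\<forall>x\<in>hverts h. \<forall>y\<in>hverts h. x \<noteq> y \<longrightarrow>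
        inner_int n (\<phi> x) (\<phi> y) = (if adj h x y then 1 else 0)) \<and>
     (\<forall>x i. n \<le> i \<longrightarrow> \<phi> x i = 0)"

lemma integrally_representable_iff_rep3:
  "integrally_representable 3 h \<longleftrightarrow> (\<exists>n \<phi>. rep3 h n \<phi>)"
proof
  assume "integrally_representable 3 h"
  then obtain n \<phi> where
    "(\<forall>x\<in>slim h. inner_int n (\<phi> x) (\<phi> x) = 3) \<and>
     (\<forall>x\<in>fat h. inner_int n (\<phi> x) (\<phi> x) = 1) \<and>
     (\<forall>x\<in>hverts h. \<forall>y\<in>hverts h. x \<noteq> y \<longrightarrow>
        inner_int n (\<phi> x) (\<phi> y) = (if adj h x y then 1 else 0))"
    unfolding integrally_representable_def by blast
  moreover have "inner_int n (\<lambda>i. if i < n then u i else 0) (\<lambda>i. if i < n then v i else 0) =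
      inner_int n u v" for u v
    unfolding inner_int_def by (rule sum.cong) auto
  ultimately have "rep3 h n (\<lambda>x i. if i < n then \<phi> x i else 0)"
    unfolding rep3_def by simp
  then show "\<exists>n \<phi>. rep3 h n \<phi>" by blast
next
  assume "\<exists>n \<phi>. rep3 h n \<phi>"
  then show "integrally_representable 3 h"
    unfolding integrally_representable_def rep3_def by blast
qed

definition supp :: "('a \<Rightarrow> nat \<Rightarrow> int) \<Rightarrow> 'a \<Rightarrow> nat set" where
  "supp \<phi> x = {i. \<phi> x i \<noteq> 0}"

definition fat_coords :: "'a hoffman \<Rightarrow> ('a \<Rightarrow> nat \<Rightarrow> int) \<Rightarrow> nat set" where
  "fat_coords h \<phi> = (\<Union>f\<in>fat h. supp \<phi> f)"

lemma hverts_slim_fat: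
  assumes "hoffman_graph h"
  shows "hverts h = slim h \<union> fat h" "slim h \<inter> fat h = {}"
    "x \<in> slim h \<Longrightarrow> x \<in> hverts h" "x \<in> fat h \<Longrightarrow> x \<in> hverts h"
  using assms unfolding slim_def hoffman_graph_iff by blast+

text \<open>Squares adding up to less than 4 leave no room for an entry of modulus 2, so the norm
  simply counts the nonzero entries.\<close>

lemma inner_int_self_supp:
  assumes "\<And>i. u i \<noteq> 0 \<Longrightarrow> i < n" "inner_int n u u < 4"
  shows "u i \<in> {-1, 0, 1}" and "int (card {i. u i \<noteq> 0}) = inner_int n u u"
proof -
  have le: "u i * u i \<le> inner_int n u u" if "i < n" for i
    unfolding inner_int_def by (rule member_le_sum) (use that in auto)
  have *: "u i \<in> {-1, 0, 1}" for i
  proof (rule ccontr)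
    assume "u i \<notin> {-1, 0, 1}"
    then have "2 \<le> \<bar>u i\<bar>" by auto
    then have "2 * 2 \<le> \<bar>u i\<bar> * \<bar>u i\<bar>" by (intro mult_mono) auto
    moreover have "i < n" using assms(1) \<open>u i \<notin> _\<close> by auto
    ultimately show False using le[of i] assms(2) by auto
  qed
  then show "u i \<in> {-1, 0, 1}" .
  have "inner_int n u u = (\<Sum>i<n. of_bool (u i \<noteq> 0))"
    unfolding inner_int_def
  proof (rule sum.cong)
    fix i
    show "u i * u i = of_bool (u i \<noteq> 0)" using *[of i] by auto
  qed simp
  also have "\<dots> = int (card ({..<n} \<inter> {i. u i \<noteq> 0}))"
    by (simp add: of_bool_def sum.If_cases)
  also have "{..<n} \<inter> {i. u i \<noteq> 0} = {i. u i \<noteq> 0}" using assms(1) by auto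
  finally show "int (card {i. u i \<noteq> 0}) = inner_int n u u" by simp
qed

locale hrep =
  fixes t :: "'a hoffman" and n :: nat and \<phi> :: "'a \<Rightarrow> nat \<Rightarrow> int"
  assumes hoffman: "hoffman_graph t"
    and rep: "rep3 t n \<phi>"
begin

lemma supp_less: "\<phi> x i \<noteq> 0 \<Longrightarrow> i < n"
  using rep unfolding rep3_def by (meson not_le)

lemma supp_bound: "supp \<phi> x \<subseteq> {..<n}"
  using supp_less by (auto simp: supp_def)

lemma finite_supp [simp]: "finite (supp \<phi> x)"
  using supp_bound finite_subset by blast

lemma finite_hverts [simp]: "finite (hverts t)"
  using hoffman unfolding hoffman_graph_iff by blast

lemma adj_sym: "adj t x y \<longleftrightarrow> adj t y x"
  using hoffman unfolding hoffman_graph_iff by blast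

lemma adj_verts: "adj t x y \<Longrightarrow> x \<in> hverts t \<and> y \<in> hverts t \<and> x \<noteq> y"
  using hoffman unfolding hoffman_graph_iff by blast

lemmas verts_simps = hverts_slim_fat[OF hoffman]

lemma val: "x \<in> hverts t \<Longrightarrow> \<phi> x i \<in> {-1, 0, 1}"
  and card_supp: "x \<in> slim t \<Longrightarrow> card (supp \<phi> x) = 3"
  and card_supp_fat: "x \<in> fat t \<Longrightarrow> card (supp \<phi> x) = 1"
proof -
  have sf: "inner_int n (\<phi> x) (\<phi> x) = 3" if "x \<in> slim t" for x
    using rep that by (simp add: rep3_def)
  have ff: "inner_int n (\<phi> x) (\<phi> x) = 1" if "x \<in> fat t" for x
    using rep that by (simp add: rep3_def)
  have lt: "inner_int n (\<phi> x) (\<phi> x) < 4" if "x \<in> hverts t" for x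
    using that sf[of x] ff[of x] unfolding verts_simps(1) by auto
  show "x \<in> hverts t \<Longrightarrow> \<phi> x i \<in> {-1, 0, 1}"
    using inner_int_self_supp(1)[of "\<phi> x" n i, OF supp_less lt] .
  show "card (supp \<phi> x) = 3" if "x \<in> slim t"
    using inner_int_self_supp(2)[of "\<phi> x" n, OF supp_less lt] sf[OF that] that verts_simps(3)
    by (simp add: supp_def)
  show "card (supp \<phi> x) = 1" if "x \<in> fat t"
    using inner_int_self_supp(2)[of "\<phi> x" n, OF supp_less lt] ff[OF that] that verts_simps(4)
    by (simp add: supp_def)
qed

lemma ip_supp:
  assumes "x \<in> hverts t" "y \<in> hverts t" "x \<noteq> y"
  shows "(\<Sum>i\<in>supp \<phi> y. \<phi> x i * \<phi> y i) = of_bool (adj t x y)"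
proof -
  have "(\<Sum>i\<in>supp \<phi> y. \<phi> x i * \<phi> y i) = (\<Sum>i<n. \<phi> x i * \<phi> y i)"
    by (rule sum.mono_neutral_left) (use supp_bound in \<open>auto simp: supp_def\<close>)
  then show ?thesis
    using rep assms unfolding rep3_def inner_int_def by auto
qed

lemma fat_supp:
  assumes "f \<in> fat t"
  obtains k where "supp \<phi> f = {k}"
  using card_supp_fat[OF assms] card_1_singletonE by blast

lemma fat_adj_iff:
  assumes "f \<in> fat t" "supp \<phi> f = {k}" "x \<in> hverts t" "x \<noteq> f"
  shows "\<phi> x k * \<phi> f k = of_bool (adj t x f)"
  using ip_supp[of x f] assms verts_simps(4)[of f] by simp

text \<open>Every fat vertex is a signed unit vector, and different fat vertices occupy different
  coordinates. The entry of the product of \<open>C\<close> with its transpose is thus the share of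
  the inner product that lies on the fat coordinates, and subtracting it from the adjacency leaves
  the remaining coordinates.\<close>

lemma special_matrix_eq:
  assumes "x \<in> slim t" "y \<in> slim t" "x \<noteq> y"
  shows "special_matrix t x y = (\<Sum>i\<in>{..<n} - fat_coords t \<phi>. \<phi> x i * \<phi> y i)"
proof -
  have "\<forall>f\<in>fat t. \<exists>k. supp \<phi> f = {k}" using fat_supp by metis
  then obtain c where c: "\<And>f. f \<in> fat t \<Longrightarrow> supp \<phi> f = {c f}" by metis
  have nz: "\<phi> f (c f) * \<phi> f (c f) = 1" if "f \<in> fat t" for f
    using c[OF that] val[of f "c f"] that verts_simps by (auto simp: supp_def)
  \<comment> \<open>Two fat vertices at one coordinate would have a nonzero inner product and hence
    be adjacent.\<close>
  have inj: "inj_on c (fat t)"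
  proof (rule inj_onI, rule ccontr)
    fix f g assume fg: "f \<in> fat t" "g \<in> fat t" "c f = c g" "f \<noteq> g"
    have "\<phi> g (c f) * \<phi> f (c f) = of_bool (adj t g f)"
      using fat_adj_iff[of f "c f" g] fg c verts_simps by auto
    moreover have "\<not> adj t g f" using fg hoffman unfolding hoffman_graph_iff by blast
    moreover have "\<phi> g (c f) \<noteq> 0" "\<phi> f (c f) \<noteq> 0"
      using c[OF fg(1)] c[OF fg(2)] fg(3) by (auto simp: supp_def set_eq_iff)
    ultimately show False by auto
  qed
  have cf: "c ` fat t = fat_coords t \<phi>" using c by (auto simp: fat_coords_def)
  have "(\<Sum>f\<in>fat t. adj_mat t x f * adj_mat t y f) = (\<Sum>f\<in>fat t. \<phi> x (c f) * \<phi> y (c f))"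
  proof (rule sum.cong)
    fix f assume f: "f \<in> fat t"
    have "adj_mat t x f * adj_mat t y f =
       (\<phi> x (c f) * \<phi> f (c f)) * (\<phi> y (c f) * \<phi> f (c f))"
      using fat_adj_iff[OF f c[OF f]] assms f verts_simps unfolding adj_mat_def
      by (metis disjoint_iff)
    also have "\<dots> = \<phi> x (c f) * \<phi> y (c f) * (\<phi> f (c f) * \<phi> f (c f))"
      by (simp add: algebra_simps)
    finally show "adj_mat t x f * adj_mat t y f = \<phi> x (c f) * \<phi> y (c f)"
      using nz[OF f] by simp
  qed simp
  also have "\<dots> = (\<Sum>i\<in>fat_coords t \<phi>. \<phi> x i * \<phi> y i)"
    unfolding cf[symmetric] by (simp add: sum.reindex[OF inj])
  finally have 1: "(\<Sum>f\<in>fat t. adj_mat t x f * adj_mat t y f) =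
    (\<Sum>i\<in>fat_coords t \<phi>. \<phi> x i * \<phi> y i)" .
  have "fat_coords t \<phi> \<subseteq> {..<n}" using supp_bound by (auto simp: fat_coords_def)
  then have "(\<Sum>i\<in>{..<n} - fat_coords t \<phi>. \<phi> x i * \<phi> y i) =
     (\<Sum>i<n. \<phi> x i * \<phi> y i) - (\<Sum>i\<in>fat_coords t \<phi>. \<phi> x i * \<phi> y i)"
    by (simp add: sum_diff)
  moreover have "(\<Sum>i<n. \<phi> x i * \<phi> y i) = adj_mat t x y"
    using rep assms verts_simps unfolding rep3_def inner_int_def adj_mat_def by auto
  ultimately show ?thesis unfolding special_matrix_def 1 by simp
qed

end

section \<open>Direct sums and the attachment of fat vertices\<close>

lemma special_matrix_sym:
  assumes "hoffman_graph h"
  shows "special_matrix h x y = special_matrix h y x"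
proof -
  have "adj h x y = adj h y x" using assms unfolding hoffman_graph_iff by blast
  then show ?thesis by (simp add: special_matrix_def adj_mat_def mult.commute)
qed

lemma decomposableI:
  assumes "hoffman_graph h" "V1 \<subset> slim h" "V1 \<noteq> {}"
    and "\<And>x y. x \<in> V1 \<Longrightarrow> y \<in> slim h - V1 \<Longrightarrow> special_matrix h x y = 0"
  shows "decomposable h"
proof -
  define R where "R V = \<lparr>hgraph = \<lparr>pverts = V \<union> fat_nbrs h V,
      parcs = parcs (hgraph h) \<inter> (V \<union> fat_nbrs h V) \<times> (V \<union> fat_nbrs h V)\<rparr>,
      fat = fat h \<inter> (V \<union> fat_nbrs h V)\<rparr>" for V
  have R: "hverts (R V) = V \<union> fat_nbrs h V" "fat (R V) = fat h \<inter> (V \<union> fat_nbrs h V)"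
    "adj (R V) x y \<longleftrightarrow> adj h x y \<and> x \<in> V \<union> fat_nbrs h V \<and> y \<in> V \<union> fat_nbrs h V" for V x y
    by (auto simp: R_def hverts_def adj_def)
  have "induced_hoffman_subgraph (R V) h" if "V \<subseteq> slim h" for V
    using that assms(1) hverts_slim_fat[OF assms(1)]
    by (subst induced_hoffman_subgraph_iff) (auto simp: R fat_nbrs_def)
  then have "direct_sum_wrt h V1 (slim h - V1) (R V1) (R (slim h - V1))"
    using assms(2,4) special_matrix_sym[OF assms(1)]
    unfolding direct_sum_wrt_def R by auto
  moreover have "slim h - V1 \<noteq> {}" using assms(2) by blast
  ultimately show ?thesis
    unfolding decomposable_def using assms(3) by metis
qed

text \<open>One fat vertex \<open>\<nu> k\<close> is to be attached at each coordinate
  \<open>k\<close> in \<open>K\<close>. Here \<open>hit\<close> provides its slim neighbour,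
  \<open>nonneg\<close> lets one sign serve all its neighbours, and \<open>not_fat\<close> makes it
  orthogonal to the old fat vertices.\<close>

locale fattening = hrep t n \<phi> for t :: "'a hoffman" and n \<phi> +
  fixes K :: "nat set" and \<nu> :: "nat \<Rightarrow> 'a"
  assumes inj: "inj_on \<nu> K"
    and fresh: "\<nu> ` K \<inter> hverts t = {}"
    and hit: "\<And>k. k \<in> K \<Longrightarrow> \<exists>x\<in>slim t. \<phi> x k \<noteq> 0"
    and nonneg: "\<And>k x y. k \<in> K \<Longrightarrow> x \<in> slim t \<Longrightarrow> y \<in> slim t \<Longrightarrow> 0 \<le> \<phi> x k * \<phi> y k"
    and not_fat: "K \<inter> fat_coords t \<phi> = {}"
begin

definition ext :: "'a hoffman" where
  "ext = \<lparr>hgraph = \<lparr>pverts = hverts t \<union> \<nu> ` K,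
      parcs = parcs (hgraph t) \<union> {(x, \<nu> k) | x k. x \<in> slim t \<and> k \<in> K \<and> \<phi> x k \<noteq> 0} \<union>
        {(\<nu> k, x) | x k. x \<in> slim t \<and> k \<in> K \<and> \<phi> x k \<noteq> 0}\<rparr>,
     fat = fat t \<union> \<nu> ` K\<rparr>"

lemma K_less: "k \<in> K \<Longrightarrow> k < n"
  using hit supp_less by blast

lemma finite_K [simp]: "finite K"
  by (rule finite_subset[of _ "{..<n}"]) (use K_less in auto)

lemma ext_simps:
  "hverts ext = hverts t \<union> \<nu> ` K" "fat ext = fat t \<union> \<nu> ` K" "slim ext = slim t"
  "adj ext x y \<longleftrightarrow> adj t x y \<or> (x \<in> slim t \<and> (\<exists>k\<in>K. y = \<nu> k \<and> \<phi> x k \<noteq> 0)) \<or>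
     (y \<in> slim t \<and> (\<exists>k\<in>K. x = \<nu> k \<and> \<phi> y k \<noteq> 0))"
  using fresh by (auto simp: ext_def hverts_def adj_def slim_def)

lemma fresh': "k \<in> K \<Longrightarrow> \<nu> k \<notin> hverts t"
  using fresh by auto

lemma hoffman_ext: "hoffman_graph ext"
  unfolding hoffman_graph_iff
proof (intro conjI allI ballI impI)
  show "finite (hverts ext)" by (simp add: ext_simps)
  show "fat ext \<subseteq> hverts ext" using verts_simps(4) by (auto simp: ext_simps)
next
  fix f assume "f \<in> fat ext"
  then consider "f \<in> fat t" | k where "k \<in> K" "f = \<nu> k" by (auto simp: ext_simps)
  then show "\<exists>x\<in>slim ext. adj ext f x"
  proof cases
    case 1
    then show ?thesis using hoffman unfolding hoffman_graph_iff ext_simps by blast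
  next
    case 2
    then show ?thesis using hit[of k] unfolding ext_simps by blast
  qed
next
  have nadj: "\<not> adj t f g" "f \<notin> slim t" if "f \<in> fat ext" "g \<in> fat ext" for f g
  proof -
    have "f \<in> fat t \<or> f \<notin> hverts t" "g \<in> fat t \<or> g \<notin> hverts t"
      using that fresh' by (auto simp: ext_simps)
    then show "\<not> adj t f g" "f \<notin> slim t"
      using hoffman verts_simps(2) verts_simps(3)[of f] adj_verts[of f g]
      unfolding hoffman_graph_iff by blast+
  qed
  fix f g assume "f \<in> fat ext" "g \<in> fat ext"
  then show "\<not> adj ext f g" using nadj[of f g] nadj[of g f] by (simp add: ext_simps)
next
  fix x y assume xy: "adj ext x y"
  then consider "adj t x y" | k where "x \<in> slim t" "k \<in> K" "y = \<nu> k" "\<phi> x k \<noteq> 0"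
    | k where "y \<in> slim t" "k \<in> K" "x = \<nu> k" "\<phi> y k \<noteq> 0"
    unfolding ext_simps by blast
  then have "x \<in> hverts ext \<and> y \<in> hverts ext \<and> x \<noteq> y"
  proof cases
    case 1
    then show ?thesis using adj_verts[of x y] by (simp add: ext_simps)
  next
    case 2
    then show ?thesis using fresh'[of k] verts_simps(3)[of x] by (auto simp: ext_simps)
  next
    case 3
    then show ?thesis using fresh'[of k] verts_simps(3)[of y] by (auto simp: ext_simps)
  qed
  then show "x \<in> hverts ext" "y \<in> hverts ext" "x \<noteq> y" by blast+
  show "adj ext y x" using xy adj_sym[of x y] unfolding ext_simps by blast
qed

lemma induced_ext: "induced_hoffman_subgraph t ext"
proof (subst induced_hoffman_subgraph_iff[OF hoffman_ext])
  show "x \<in> hverts t \<and> y \<in> hverts t" if "adj t x y" for x y using adj_verts[OF that] by blast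
  have "fat ext \<inter> hverts t = fat t" using fresh' verts_simps(4) unfolding ext_simps by blast
  then show "hverts t \<subseteq> hverts ext \<and> (\<forall>x\<in>hverts t. \<forall>y\<in>hverts t. adj t x y = adj ext x y) \<and>
    fat t = fat ext \<inter> hverts t"
    using fresh' by (auto simp: ext_simps)
qed

text \<open>By \<open>nonneg\<close>, the common sign at \<open>k\<close> of all slim vertices that use this coordinate.\<close>

definition sgn_at :: "nat \<Rightarrow> int" where
  "sgn_at k = (if \<exists>x\<in>slim t. \<phi> x k < 0 then -1 else 1)"

definition \<psi> :: "'a \<Rightarrow> nat \<Rightarrow> int" where
  "\<psi> x = (if x \<in> \<nu> ` K then (\<lambda>i. if i = the_inv_into K \<nu> x then sgn_at i else 0) else \<phi> x)"

lemma \<psi>_new: "k \<in> K \<Longrightarrow> \<psi> (\<nu> k) = (\<lambda>i. if i = k then sgn_at k else 0)"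
  using inj by (auto simp: \<psi>_def the_inv_into_f_f)

lemma \<psi>_old: "x \<in> hverts t \<Longrightarrow> \<psi> x = \<phi> x"
  using fresh by (auto simp: \<psi>_def)

lemma sgn_at_prod: "k \<in> K \<Longrightarrow> x \<in> slim t \<Longrightarrow> \<phi> x k * sgn_at k = of_bool (\<phi> x k \<noteq> 0)"
proof -
  assume k: "k \<in> K" and x: "x \<in> slim t"
  have "\<phi> x k \<in> {-1, 0, 1}" using val x verts_simps by blast
  moreover have "\<phi> x k = 1 \<Longrightarrow> \<not> (\<exists>y\<in>slim t. \<phi> y k < 0)"
    using nonneg[OF k x] by fastforce
  moreover have "\<phi> x k = -1 \<Longrightarrow> \<exists>y\<in>slim t. \<phi> y k < 0" using x by force
  ultimately show ?thesis by (auto simp: sgn_at_def)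
qed

text \<open>The vertex attached at \<open>k\<close> is a unit vector carrying the common sign there.
  Its product with a slim vector is the modulus of the entry at \<open>k\<close>, which is 1 exactly
  at the prescribed neighbours.\<close>

lemma rep_ext: "rep3 ext n \<psi>"
  unfolding rep3_def
proof (intro conjI ballI allI impI)
  fix x assume "x \<in> slim ext"
  then show "inner_int n (\<psi> x) (\<psi> x) = 3"
    using rep verts_simps by (auto simp: ext_simps \<psi>_old rep3_def)
next
  fix x assume "x \<in> fat ext"
  moreover have "inner_int n (\<psi> (\<nu> k)) (\<psi> (\<nu> k)) = 1" if "k \<in> K" for k
    using that K_less unfolding \<psi>_new[OF that] inner_int_def
    by (auto simp: sgn_at_def if_distrib[of "\<lambda>a. a * _"] sum.delta cong: if_cong)
  ultimately show "inner_int n (\<psi> x) (\<psi> x) = 1"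
    using rep verts_simps by (auto simp: ext_simps \<psi>_old rep3_def)
next
  have new: "inner_int n (\<psi> x) (\<psi> (\<nu> k)) = of_bool (adj ext x (\<nu> k))"
    "inner_int n (\<psi> (\<nu> k)) (\<psi> x) = of_bool (adj ext x (\<nu> k))"
    if k: "k \<in> K" and x: "x \<in> hverts ext" "x \<noteq> \<nu> k" for x k
  proof -
    have nadj: "\<not> adj t x (\<nu> k)" using adj_verts fresh k by blast
    have "inner_int n (\<psi> x) (\<psi> (\<nu> k)) = \<psi> x k * sgn_at k"
      using K_less[OF k] unfolding \<psi>_new[OF k] inner_int_def
      by (simp add: if_distrib[of "\<lambda>a. _ * a"] sum.delta cong: if_cong)
    also have "\<dots> = of_bool (adj ext x (\<nu> k))"
    proof -
      consider "x \<in> slim t" | "x \<in> fat t" | k' where "k' \<in> K" "x = \<nu> k'"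
        using x verts_simps by (auto simp: ext_simps)
      then show ?thesis
      proof cases
        case 1
        then have "adj ext x (\<nu> k) \<longleftrightarrow> \<phi> x k \<noteq> 0"
          using nadj k inj fresh verts_simps unfolding ext_simps by (auto dest: inj_onD)
        then show ?thesis using sgn_at_prod[OF k 1] 1 verts_simps by (simp add: \<psi>_old)
      next
        case 2
        then have "\<phi> x k = 0" using not_fat k by (auto simp: fat_coords_def supp_def)
        moreover have "\<not> adj ext x (\<nu> k)"
          using 2 nadj verts_simps fresh k unfolding ext_simps by blast
        ultimately show ?thesis using 2 verts_simps by (simp add: \<psi>_old)
      next
        case 3
        then have "\<not> adj ext x (\<nu> k)"
          using nadj verts_simps fresh k unfolding ext_simps by blast
        moreover have "k' \<noteq> k" using 3 x by auto
        ultimately show ?thesis using 3 by (simp add: \<psi>_new)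
      qed
    qed
    finally show "inner_int n (\<psi> x) (\<psi> (\<nu> k)) = of_bool (adj ext x (\<nu> k))" .
    then show "inner_int n (\<psi> (\<nu> k)) (\<psi> x) = of_bool (adj ext x (\<nu> k))"
      by (simp add: inner_int_def mult.commute)
  qed
  fix x y assume xy: "x \<in> hverts ext" "y \<in> hverts ext" "x \<noteq> y"
  have sym: "adj ext y x = adj ext x y" using hoffman_ext unfolding hoffman_graph_iff by blast
  consider k where "k \<in> K" "y = \<nu> k" | k where "k \<in> K" "x = \<nu> k" | "x \<in> hverts t" "y \<in> hverts t"
    using xy by (auto simp: ext_simps)
  then show "inner_int n (\<psi> x) (\<psi> y) = (if adj ext x y then 1 else 0)"
  proof cases
    case 1
    then show ?thesis using new(1)[of k x] xy by auto
  next
    case 2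
    then show ?thesis using new(2)[of k y] xy sym by auto
  next
    case 3
    then have "adj ext x y = adj t x y" using fresh by (auto simp: ext_simps)
    then show ?thesis using 3 xy rep by (auto simp: \<psi>_old rep3_def)
  qed
next
  fix x i assume "n \<le> i"
  then have "\<phi> x i = 0" "i \<notin> K" using supp_less[of x i] K_less[of i] by auto
  then show "\<psi> x i = 0"
    by (cases "x \<in> \<nu> ` K") (auto simp: \<psi>_new, auto simp: \<psi>_def)
qed

sublocale ext: hrep ext n \<psi>
  by unfold_locales (rule hoffman_ext rep_ext)+

lemma fat_coords_ext: "fat_coords ext \<psi> = fat_coords t \<phi> \<union> K"
proof -
  have "supp \<psi> (\<nu> k) = {k}" if "k \<in> K" for k
    using that by (auto simp: supp_def \<psi>_new sgn_at_def)
  moreover have "supp \<psi> f = supp \<phi> f" if "f \<in> fat t" for f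
    using that verts_simps by (simp add: supp_def \<psi>_old)
  ultimately show ?thesis by (auto simp: fat_coords_def ext_simps)
qed

end

lemma exists_fresh_inj:
  fixes V :: "'a::infinite set"
  assumes "finite V"
  shows "\<exists>\<nu> :: nat \<Rightarrow> 'a. inj \<nu> \<and> range \<nu> \<inter> V = {}"
proof -
  have "infinite (- V)" using assms infinite_UNIV by (metis finite_compl)
  then obtain \<nu> :: "nat \<Rightarrow> 'a" where "inj \<nu>" "range \<nu> \<subseteq> - V"
    using infinite_countable_subset by blast
  then show ?thesis by blast
qed

text \<open>Fat vertices attached at \<open>K\<close> remove \<open>K\<close> from the special
  matrix. What remains vanishes between \<open>S1\<close> and the other slim vertices, so the
  extension is decomposable, contrary to condition (ii).\<close>

lemma separated_False:
  fixes t :: "'a::infinite hoffman"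
  assumes T: "in_class_T t" and rep: "rep3 t n \<phi>"
    and hit: "\<And>k. k \<in> K \<Longrightarrow> \<exists>x\<in>slim t. \<phi> x k \<noteq> 0"
    and nonneg: "\<And>k x y. k \<in> K \<Longrightarrow> x \<in> slim t \<Longrightarrow> y \<in> slim t \<Longrightarrow> 0 \<le> \<phi> x k * \<phi> y k"
    and S1: "S1 \<subset> slim t" "S1 \<noteq> {}"
    and sep: "\<And>x z. x \<in> S1 \<Longrightarrow> z \<in> slim t - S1 \<Longrightarrow>
      (\<Sum>i\<in>{..<n} - (fat_coords t \<phi> \<union> K). \<phi> x i * \<phi> z i) = 0"
  shows False
proof -
  have ht: "hoffman_graph t" using T by (simp add: in_class_T_def)
  then interpret hrep t n \<phi> using rep by unfold_locales
  obtain \<nu> :: "nat \<Rightarrow> 'a" where \<nu>: "inj \<nu>" "range \<nu> \<inter> hverts t = {}"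
    using exists_fresh_inj[OF finite_hverts] by blast
  \<comment> \<open>Coordinates of old fat vertices are deleted from the special matrix already; a
    second fat vertex there would not be orthogonal to the first.\<close>
  define K' where "K' = K - fat_coords t \<phi>"
  interpret fattening t n \<phi> K' \<nu>
    by unfold_locales (use \<nu> hit nonneg in \<open>auto simp: K'_def intro: inj_on_subset\<close>)
  have fc: "fat_coords ext \<psi> = fat_coords t \<phi> \<union> K"
    using fat_coords_ext Un_Diff_cancel[of "fat_coords t \<phi>" K] unfolding K'_def by simp
  have "decomposable ext"
  proof (rule decomposableI[OF hoffman_ext])
    fix x y assume xy: "x \<in> S1" "y \<in> slim ext - S1"
    then have "special_matrix ext x y = (\<Sum>i\<in>{..<n} - fat_coords ext \<psi>. \<psi> x i * \<psi> y i)"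
      by (intro ext.special_matrix_eq) (use S1 in \<open>auto simp: ext_simps\<close>)
    also have "\<dots> = (\<Sum>i\<in>{..<n} - (fat_coords t \<phi> \<union> K). \<phi> x i * \<phi> y i)"
      unfolding fc using xy S1 verts_simps by (intro sum.cong) (auto simp: \<psi>_old ext_simps)
    finally show "special_matrix ext x y = 0" using sep xy by (simp add: ext_simps)
  qed (use S1 in \<open>auto simp: ext_simps\<close>)
  moreover have "integrally_representable 3 ext"
    using rep_ext integrally_representable_iff_rep3 by blast
  ultimately show False
    using T hoffman_ext induced_ext ext_simps(3) unfolding in_class_T_def by blast
qed

section \<open>Maximality and pendant fat vertices\<close>

lemma hoffman_iso_embeds:
  assumes "induced_hoffman_subgraph t h" "hoffman_iso h k" "hoffman_graph k"
  shows "embeds_as_induced t k"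
proof -
  note ind = induced_hoffman_subgraphD[OF assms(1)]
  obtain \<pi> where \<pi>: "bij_betw \<pi> (hverts h) (hverts k)"
    "\<forall>x\<in>hverts h. \<forall>y\<in>hverts h. adj h x y \<longleftrightarrow> adj k (\<pi> x) (\<pi> y)"
    "\<forall>x\<in>hverts h. x \<in> fat h \<longleftrightarrow> \<pi> x \<in> fat k"
    using assms(2) unfolding hoffman_iso_def by blast
  define W where "W = \<pi> ` hverts t"
  define r where "r = \<lparr>hgraph = \<lparr>pverts = W, parcs = parcs (hgraph k) \<inter> W \<times> W\<rparr>,
    fat = fat k \<inter> W\<rparr>"
  have r: "hverts r = W" "fat r = fat k \<inter> W" "adj r x y \<longleftrightarrow> adj k x y \<and> x \<in> W \<and> y \<in> W" for x y
    by (auto simp: r_def hverts_def adj_def)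
  have "W \<subseteq> hverts k" using \<pi>(1) ind(1) by (auto simp: W_def bij_betw_def)
  then have "induced_hoffman_subgraph r k"
    using assms(3) by (subst induced_hoffman_subgraph_iff) (auto simp: r)
  moreover have "bij_betw \<pi> (hverts t) (hverts r)"
    using \<pi>(1) ind(1) by (auto simp: r W_def bij_betw_def intro: inj_on_subset)
  then have "hoffman_iso t r"
    unfolding hoffman_iso_def
    using \<pi>(2,3) ind by (intro exI[of _ \<pi>]) (auto simp: r W_def subset_iff)
  ultimately show ?thesis unfolding embeds_as_induced_def by blast
qed

text \<open>If \<open>x\<close> alone uses \<open>k\<close>, the sign condition at \<open>k\<close>
  is automatic and a fat vertex attached there is a leaf. The extension is then a member of the
  class, and its representative in \<open>TT\<close> contains a copy of \<open>t\<close> but has one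
  vertex more, contrary to maximality.\<close>

lemma maximal_coordinate_shared:
  fixes t :: "'a::infinite hoffman"
  assumes TT: "iso_representatives in_class_T TT" and max: "maximal_member TT t"
    and rep: "rep3 t n \<phi>" and x: "x \<in> slim t" and k: "\<phi> x k \<noteq> 0"
  shows "\<exists>y\<in>hverts t. y \<noteq> x \<and> \<phi> y k \<noteq> 0"
proof (rule ccontr)
  assume only: "\<not> ?thesis"
  have T: "in_class_T t" using TT max by (auto simp: iso_representatives_def maximal_member_def)
  then have ht: "hoffman_graph t" by (simp add: in_class_T_def)
  then interpret hrep t n \<phi> using rep by unfold_locales
  obtain \<nu> :: "nat \<Rightarrow> 'a" where \<nu>: "inj \<nu>" "range \<nu> \<inter> hverts t = {}"
    using exists_fresh_inj[OF finite_hverts] by blast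
  interpret fattening t n \<phi> "{k}" \<nu>
  proof unfold_locales
    fix j y z assume "j \<in> {k}" "y \<in> slim t" "z \<in> slim t"
    then show "0 \<le> \<phi> y j * \<phi> z j"
      using only verts_simps by (cases "y = x"; cases "z = x") auto
  next
    show "{k} \<inter> fat_coords t \<phi> = {}"
      using only x verts_simps by (fastforce simp: fat_coords_def supp_def)
  qed (use \<nu> x k in auto)
  define v where "v = \<nu> k"
  have v: "v \<notin> hverts t" using fresh by (auto simp: v_def)
  have xv: "x \<in> hverts t" "x \<noteq> v" using x v verts_simps by auto
  have adj: "adj ext y z \<longleftrightarrow> adj t y z \<or> (y = x \<and> z = v) \<or> (y = v \<and> z = x)" for y z
    using only x k verts_simps unfolding ext_simps v_def by auto
  have tr: "tree_like t" using T by (simp add: in_class_T_def)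
  note tr' = tr[unfolded tree_like_iff[OF ht]]
  have "tree_like ext"
    unfolding tree_like_iff[OF hoffman_ext]
  proof (intro conjI ballI)
    show "hverts ext \<noteq> {}" using xv by (auto simp: ext_simps)
  next
    have mono: "(adj ext)\<^sup>*\<^sup>* y z" if "(adj t)\<^sup>*\<^sup>* y z" for y z
      using that by (rule rtranclp_mono[THEN predicate2D, rotated]) (auto simp: adj)
    have to: "(adj ext)\<^sup>*\<^sup>* u x" "(adj ext)\<^sup>*\<^sup>* x u" if "u \<in> hverts ext" for u
    proof -
      have "u = v \<or> u \<in> hverts t" using that by (auto simp: ext_simps v_def)
      then show "(adj ext)\<^sup>*\<^sup>* u x" "(adj ext)\<^sup>*\<^sup>* x u"
        using mono tr' xv adj by (auto intro: r_into_rtranclp)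
    qed
    fix u w assume "u \<in> hverts ext" "w \<in> hverts ext"
    then show "(adj ext)\<^sup>*\<^sup>* u w" using to by (meson rtranclp_trans)
  next
    show "\<nexists>vs. vertex_cycle (adj ext) vs"
    proof
      assume "\<exists>vs. vertex_cycle (adj ext) vs"
      then obtain vs where vs: "vertex_cycle (adj ext) vs" by blast
      have "symp (adj ext)" using hoffman_ext unfolding hoffman_graph_iff symp_def by blast
      \<comment> \<open>The attached vertex has a single neighbour, whereas a vertex on a cycle has
        two.\<close>
      have nv: "z = x" if "adj ext v z" for z
        using that adj v adj_verts[of v z] xv by blast
      have "v \<notin> set vs"
      proof
        assume "v \<in> set vs"
        then obtain a b where "a \<noteq> b" "adj ext v a" "adj ext v b"
          using vertex_cycle_two_nbrs[OF vs _ \<open>symp (adj ext)\<close>] by blast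
        then show False using nv[of a] nv[of b] by simp
      qed
      have "successively (adj t) vs"
        by (rule successively_mono[where P = "adj ext"])
           (use vs \<open>v \<notin> set vs\<close> in \<open>auto simp: vertex_cycle_def adj\<close>)
      moreover have "adj t (last vs) (hd vs)"
      proof -
        have "vs \<noteq> []" using vs by (auto simp: vertex_cycle_def)
        then have "last vs \<noteq> v" "hd vs \<noteq> v" using \<open>v \<notin> set vs\<close> by (auto dest: last_in_set hd_in_set)
        then show ?thesis using vs by (auto simp: vertex_cycle_def adj)
      qed
      ultimately have "vertex_cycle (adj t) vs" using vs by (auto simp: vertex_cycle_def)
      then show False using tr' by blast
    qed
  qed
  moreover have "integrally_representable 3 ext"
    using rep_ext integrally_representable_iff_rep3 by blast
  \<comment> \<open>Condition (ii) is inherited, because every admissible extension of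
    \<open>ext\<close> is also one of \<open>t\<close>.\<close>
  moreover have "indecomposable h"
    if "hoffman_graph h" "integrally_representable 3 h" "induced_hoffman_subgraph ext h"
      "slim h = slim ext" for h :: "'a hoffman"
    using T that induced_hoffman_subgraph_trans[OF that(1) induced_ext that(3)]
    unfolding in_class_T_def ext_simps(3) by blast
  ultimately have "in_class_T ext"
    using hoffman_ext unfolding in_class_T_def by blast
  then obtain t' where t': "t' \<in> TT" "hoffman_iso ext t'"
    using TT unfolding iso_representatives_def by blast
  then have "hoffman_graph t'" using TT by (auto simp: iso_representatives_def in_class_T_def)
  then have "embeds_as_induced t t'" using hoffman_iso_embeds induced_ext t' by blast
  then have "t' = t" using max t' by (auto simp: maximal_member_def)
  then have "card (hverts ext) = card (hverts t)"
    using t' bij_betw_same_card by (auto simp: hoffman_iso_def)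
  moreover have "card (hverts ext) = Suc (card (hverts t))"
    using v by (simp add: ext_simps v_def)
  ultimately show False by simp
qed

section \<open>Hubs\<close>

locale maximal_rep =
  fixes TT :: "'a::infinite hoffman set" and t :: "'a hoffman" and n :: nat
    and \<phi> :: "'a \<Rightarrow> nat \<Rightarrow> int"
  assumes reps: "iso_representatives in_class_T TT"
    and max: "maximal_member TT t"
    and rep: "rep3 t n \<phi>"
begin

lemma in_class: "in_class_T t"
  using reps max by (auto simp: iso_representatives_def maximal_member_def)

sublocale hrep t n \<phi>
  using in_class rep by unfold_locales (auto simp: in_class_T_def)

lemmas acyclic = tree_like_iff[OF hoffman, THEN iffD1, THEN conjunct2, THEN conjunct2]

lemma no_cycle: "\<not> vertex_cycle (adj t) vs"
  using in_class acyclic by (auto simp: in_class_T_def)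

lemma connected: "u \<in> hverts t \<Longrightarrow> v \<in> hverts t \<Longrightarrow> (adj t)\<^sup>*\<^sup>* u v"
  using in_class tree_like_iff[OF hoffman] by (auto simp: in_class_T_def)

lemma symp_adj: "symp (adj t)"
  using adj_sym by (auto simp: symp_def)

lemma no_triangle: "adj t x y \<Longrightarrow> adj t x z \<Longrightarrow> \<not> adj t y z"
  using no_cycle[of "[y, x, z]"] adj_verts[of x y] adj_verts[of x z] adj_verts[of y z]
    adj_sym[of x y] adj_sym[of y z]
  by (auto simp: vertex_cycle_def)

lemma grown_nbr:
  "grown (adj t) D \<Longrightarrow> z \<notin> D \<Longrightarrow> u \<in> D \<Longrightarrow> v \<in> D \<Longrightarrow> adj t z u \<Longrightarrow> adj t z v \<Longrightarrow> u = v"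
  using grown_nbr_unique[OF _ symp_adj] no_cycle by blast

lemma closed_subset:
  assumes "D \<subseteq> hverts t" "u \<in> D" "\<And>x y. x \<in> D \<Longrightarrow> adj t x y \<Longrightarrow> y \<in> D"
  shows "D = hverts t"
proof -
  have "v \<in> D" if "v \<in> hverts t" for v
  proof -
    have "(adj t)\<^sup>*\<^sup>* u v" using connected that assms(1,2) by blast
    then show "v \<in> D" by induction (use assms in auto)
  qed
  then show ?thesis using assms(1) by blast
qed

lemma in_supp: "i \<in> supp \<phi> x \<longleftrightarrow> \<phi> x i \<noteq> 0"
  by (simp add: supp_def)

lemma square: "x \<in> hverts t \<Longrightarrow> \<phi> x i \<noteq> 0 \<Longrightarrow> \<phi> x i * \<phi> x i = 1"
  using val[of x i] by auto

lemma prod_val: "x \<in> hverts t \<Longrightarrow> y \<in> hverts t \<Longrightarrow> \<phi> x i * \<phi> y i \<in> {-1, 0, 1}"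
  using val[of x i] val[of y i] by auto

lemma supp3:
  assumes "x \<in> slim t" "\<phi> x i \<noteq> 0"
  obtains j k where "distinct [i, j, k]" "supp \<phi> x = {i, j, k}"
proof -
  have "card (supp \<phi> x - {i}) = 2"
    using card_supp[OF assms(1)] assms(2) by (simp add: in_supp)
  then obtain j k where "supp \<phi> x - {i} = {j, k}" "j \<noteq> k" by (auto simp: card_2_iff)
  moreover from this have "j \<noteq> i" "k \<noteq> i" by blast+
  moreover have "i \<in> supp \<phi> x" using assms(2) by (simp add: in_supp)
  ultimately have "distinct [i, j, k]" "supp \<phi> x = {i, j, k}" by auto
  then show ?thesis by (rule that)
qed

lemma supp3':
  assumes "x \<in> slim t" "\<phi> x i \<noteq> 0" "\<phi> x j \<noteq> 0" "i \<noteq> j"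
  obtains k where "distinct [i, j, k]" "supp \<phi> x = {i, j, k}"
proof -
  obtain a b where "distinct [i, a, b]" "supp \<phi> x = {i, a, b}" using supp3 assms by metis
  moreover from this have "j = a \<or> j = b" using assms by (metis in_supp insertE singletonD)
  ultimately show ?thesis using that[of a] that[of b] by (metis distinct_length_2_or_more insert_commute)
qed

lemma supp_eq3:
  assumes "x \<in> slim t" "\<phi> x i \<noteq> 0" "\<phi> x j \<noteq> 0" "\<phi> x k \<noteq> 0" "distinct [i, j, k]"
  shows "supp \<phi> x = {i, j, k}"
proof -
  have "{i, j, k} \<subseteq> supp \<phi> x" using assms by (auto simp: in_supp)
  moreover have "card {i, j, k} = card (supp \<phi> x)" using assms card_supp by simp
  ultimately show ?thesis by (metis card_subset_eq finite_supp)
qed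

lemma ip3:
  assumes "z \<in> hverts t" "x \<in> hverts t" "z \<noteq> x" "supp \<phi> x = {i, j, k}" "distinct [i, j, k]"
  shows "\<phi> z i * \<phi> x i + \<phi> z j * \<phi> x j + \<phi> z k * \<phi> x k = of_bool (adj t z x)"
  using ip_supp[OF assms(1-3)] assms(4,5) by simp

lemma nonslim: "x \<in> hverts t \<Longrightarrow> x \<notin> slim t \<Longrightarrow> x \<in> fat t"
  using verts_simps(1) by blast

lemma fat_coordinate:
  assumes "f \<in> fat t" "\<phi> f k \<noteq> 0"
  shows "supp \<phi> f = {k}"
  using fat_supp[OF assms(1)] assms(2) by (metis in_supp singletonD)

lemma two_supp_slim:
  assumes "x \<in> hverts t" "\<phi> x i \<noteq> 0" "\<phi> x j \<noteq> 0" "i \<noteq> j"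
  shows "x \<in> slim t"
proof (rule ccontr)
  assume "x \<notin> slim t"
  then have "supp \<phi> x = {i}" using nonslim assms fat_coordinate by blast
  then show False using assms by (auto simp: supp_def)
qed

lemma ip_fat:
  assumes "f \<in> fat t" "\<phi> f k \<noteq> 0" "x \<in> hverts t" "x \<noteq> f"
  shows "adj t x f \<longleftrightarrow> \<phi> x k \<noteq> 0" "\<phi> x k \<noteq> 0 \<Longrightarrow> \<phi> x k = \<phi> f k"
proof -
  have 1: "\<phi> x k * \<phi> f k = of_bool (adj t x f)"
    using fat_adj_iff fat_coordinate assms by blast
  then show "adj t x f \<longleftrightarrow> \<phi> x k \<noteq> 0" using assms(2) by (cases "adj t x f") auto
  show "\<phi> x k \<noteq> 0 \<Longrightarrow> \<phi> x k = \<phi> f k"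
    using 1 val[of x k] val[of f k] assms verts_simps(4) by (cases "adj t x f") auto
qed

lemma fats_distinct_coords:
  assumes "f \<in> fat t" "f' \<in> fat t" "\<phi> f k \<noteq> 0" "\<phi> f' k \<noteq> 0"
  shows "f = f'"
proof (rule ccontr)
  assume "f \<noteq> f'"
  then have "adj t f' f" using ip_fat(1)[of f k f'] assms verts_simps(4) by auto
  then show False using assms hoffman unfolding hoffman_graph_iff by blast
qed

text \<open>All slim vertices using the coordinate of a fat vertex share its sign there, so opposite
  signs rule out a fat vertex.\<close>

lemma not_fat_coord:
  assumes "p \<in> slim t" "q \<in> slim t" "\<phi> p k * \<phi> q k < 0"
  shows "k \<notin> fat_coords t \<phi>"
proof
  assume "k \<in> fat_coords t \<phi>"
  then obtain f where f: "f \<in> fat t" "\<phi> f k \<noteq> 0" by (auto simp: fat_coords_def in_supp)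
  have ne: "p \<noteq> f" "q \<noteq> f" "p \<in> hverts t" "q \<in> hverts t" using f assms verts_simps by auto
  have "\<phi> p k \<noteq> 0" "\<phi> q k \<noteq> 0" using assms(3) by auto
  then have "\<phi> p k = \<phi> f k" "\<phi> q k = \<phi> f k" using ip_fat(2)[OF f, of p] ip_fat(2)[OF f, of q] ne by blast+
  then show False using assms(3) by (simp add: mult_less_0_iff)
qed

text \<open>This covers two situations at once: a fat vertex with its only coordinate, and a slim
  vertex with one of its three coordinates.\<close>

definition hub :: "'a \<Rightarrow> nat \<Rightarrow> bool" where
  "hub f g \<longleftrightarrow> f \<in> hverts t \<and> \<phi> f g \<noteq> 0 \<and>
     (\<forall>z\<in>hverts t. z \<noteq> f \<longrightarrow> \<phi> z g \<noteq> 0 \<longrightarrow> adj t f z \<and> supp \<phi> z \<inter> supp \<phi> f = {g})"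

definition members :: "'a \<Rightarrow> nat \<Rightarrow> 'a set" where
  "members f g = {z \<in> hverts t. z \<noteq> f \<and> \<phi> z g \<noteq> 0}"

lemma hub_memberD:
  assumes "hub f g" "z \<in> members f g"
  shows "z \<in> hverts t" "z \<noteq> f" "adj t f z" "supp \<phi> z \<inter> supp \<phi> f = {g}" "\<phi> z g = \<phi> f g"
    "\<phi> z g \<noteq> 0"
proof -
  show z: "z \<in> hverts t" "z \<noteq> f" "adj t f z" "supp \<phi> z \<inter> supp \<phi> f = {g}" "\<phi> z g \<noteq> 0"
    using assms by (auto simp: hub_def members_def)
  have f: "f \<in> hverts t" using assms by (auto simp: hub_def)
  have "\<phi> z i * \<phi> f i = 0" if "i \<in> supp \<phi> f - {g}" for i
  proof -
    have "i \<notin> supp \<phi> z" using that z(4) by blast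
    then show ?thesis by (simp add: in_supp)
  qed
  moreover have "{g} \<subseteq> supp \<phi> f" using z(4) by blast
  ultimately have "(\<Sum>i\<in>supp \<phi> f. \<phi> z i * \<phi> f i) = (\<Sum>i\<in>{g}. \<phi> z i * \<phi> f i)"
    by (intro sum.mono_neutral_right) auto
  then have "\<phi> z g * \<phi> f g = 1"
    using ip_supp[of z f] z f adj_sym[of f z] by simp
  then show "\<phi> z g = \<phi> f g" using val[of z g] val[of f g] z f by auto
qed

text \<open>The product 1 at \<open>g\<close> has to be cancelled by the two other coordinates of
  \<open>p\<close>, whose products lie in {-1, 0, 1}. Hence one product is -1 and the other 0. A fat
  vertex is excluded, as it would be adjacent to every other vertex using \<open>g\<close>.\<close>

lemma common_coordinate:
  assumes V: "p \<in> hverts t" "q \<in> hverts t" "p \<noteq> q" and nadj: "\<not> adj t p q"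
    and eq: "\<phi> p g = \<phi> q g" and nz: "\<phi> p g \<noteq> 0"
  obtains a b c where "distinct [g, a, b, c]" "supp \<phi> p = {g, a, b}" "supp \<phi> q = {g, a, c}"
    "\<phi> q a = - \<phi> p a" "p \<in> slim t" "q \<in> slim t"
proof -
  note result = that
  have nadj': "\<not> adj t q p" using nadj adj_sym by blast
  have slim: "p \<in> slim t" "q \<in> slim t"
    using ip_fat(1)[of p g q] ip_fat(1)[of q g p] nonslim V eq nz nadj nadj' by auto
  obtain a b where ab: "distinct [g, a, b]" "supp \<phi> p = {g, a, b}" using supp3 slim nz by metis
  have sum: "\<phi> q g * \<phi> p g + \<phi> q a * \<phi> p a + \<phi> q b * \<phi> p b = 0"
    using ip3[of q p g a b] V ab nadj' by simp
  have 1: "\<phi> q g * \<phi> p g = 1" using square[of p g] V eq nz by simp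
  have main: ?thesis if ab: "distinct [g, a, b]" "supp \<phi> p = {g, a, b}"
    and qa: "\<phi> q a * \<phi> p a = -1" and qb: "\<phi> q b = 0" for a b
  proof -
    have "\<phi> q a \<noteq> 0" using qa by auto
    then obtain c where c: "distinct [g, a, c]" "supp \<phi> q = {g, a, c}"
      using supp3'[OF slim(2), of g a] eq nz ab by auto
    moreover have "c \<noteq> b" using qb c(2) by (auto simp: supp_def)
    moreover have "\<phi> q a = - \<phi> p a"
      using qa val[of p a] val[of q a] V by auto
    ultimately show ?thesis using result[of a b c] ab slim by auto
  qed
  have nz: "\<phi> p a \<noteq> 0" "\<phi> p b \<noteq> 0" using ab by (auto simp: supp_def set_eq_iff)
  show ?thesis
  proof (cases "\<phi> q b = 0")
    case True
    then show ?thesis using main[of a b] ab sum 1 by auto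
  next
    case False
    have "\<phi> q a * \<phi> p a + \<phi> q b * \<phi> p b = -1" using sum 1 by simp
    then have "\<phi> q a = 0" "\<phi> q b * \<phi> p b = -1"
      using False nz val[of q a] val[of q b] val[of p a] val[of p b] V by auto
    then show ?thesis using main[of b a] ab by (auto simp: insert_commute)
  qed
qed

lemma hub_pair:
  assumes "hub f g" "p \<in> members f g" "q \<in> members f g" "p \<noteq> q"
  obtains a b c where "distinct [g, a, b, c]" "supp \<phi> p = {g, a, b}" "supp \<phi> q = {g, a, c}"
    "\<phi> q a = - \<phi> p a" "p \<in> slim t" "q \<in> slim t"
proof -
  note p = hub_memberD[OF assms(1,2)] and q = hub_memberD[OF assms(1,3)]
  have "\<not> adj t p q" using no_triangle[of f] p q by blast
  then show ?thesis using common_coordinate[OF p(1) q(1) assms(4), of g] that p q by metis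
qed

text \<open>From here on condition (ii) is applied only in this form: a set of slim vertices that is
  cut off once \<open>K\<close> and the fat coordinates are deleted must contain all of
  them.\<close>

lemma separated:
  assumes "\<And>k. k \<in> K \<Longrightarrow> \<exists>x\<in>slim t. \<phi> x k \<noteq> 0"
    and "\<And>k x y. k \<in> K \<Longrightarrow> x \<in> slim t \<Longrightarrow> y \<in> slim t \<Longrightarrow> 0 \<le> \<phi> x k * \<phi> y k"
    and "S1 \<subseteq> slim t" "S1 \<noteq> {}"
    and "\<And>x z. x \<in> S1 \<Longrightarrow> z \<in> slim t - S1 \<Longrightarrow>
      (\<Sum>i\<in>{..<n} - (fat_coords t \<phi> \<union> K). \<phi> x i * \<phi> z i) = 0"
  shows "slim t = S1"
  using separated_False[OF in_class rep assms(1,2) _ assms(4,5)] assms(3) by blast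

text \<open>Stated for any representation of \<open>t\<close>, because \<open>\<phi>\<close> will be
  exchanged for one in which an unshared coordinate is visible.\<close>

lemma pendant:
  "rep3 t n' \<phi>' \<Longrightarrow> x \<in> slim t \<Longrightarrow> \<phi>' x k \<noteq> 0 \<Longrightarrow> \<exists>y\<in>hverts t. y \<noteq> x \<and> \<phi>' y k \<noteq> 0"
  using maximal_coordinate_shared[OF reps max] .

end

lemma mk_hoffman_simps:
  "hverts (mk_hoffman Vs Vf E) = Vs \<union> Vf" "fat (mk_hoffman Vs Vf E) = Vf"
  "adj (mk_hoffman Vs Vf E) x y \<longleftrightarrow> (x, y) \<in> E \<or> (y, x) \<in> E"
  by (auto simp: mk_hoffman_def hverts_def adj_def)

text \<open>A map defined on the labels of a family member can be given by cases on constructors;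
  the required map on \<open>t\<close> is its inverse.\<close>

lemma hoffman_iso_from_labels:
  assumes "bij_betw \<sigma> (hverts k) (hverts t)"
    and "\<And>x y. x \<in> hverts k \<Longrightarrow> y \<in> hverts k \<Longrightarrow> adj t (\<sigma> x) (\<sigma> y) \<longleftrightarrow> adj k x y"
    and "\<And>x. x \<in> hverts k \<Longrightarrow> \<sigma> x \<in> fat t \<longleftrightarrow> x \<in> fat k"
  shows "hoffman_iso t k"
  unfolding hoffman_iso_def
proof (intro exI conjI ballI)
  let ?\<pi> = "the_inv_into (hverts k) \<sigma>"
  show bij: "bij_betw ?\<pi> (hverts t) (hverts k)" by (rule bij_betw_the_inv_into[OF assms(1)])
  have inv: "\<sigma> (?\<pi> x) = x" "?\<pi> x \<in> hverts k" if "x \<in> hverts t" for x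
    using that assms(1) bij by (auto simp: bij_betw_def f_the_inv_into_f)
  fix x assume x: "x \<in> hverts t"
  show "x \<in> fat t \<longleftrightarrow> ?\<pi> x \<in> fat k" using assms(3)[of "?\<pi> x"] inv[OF x] by simp
  fix y assume y: "y \<in> hverts t"
  show "adj t x y \<longleftrightarrow> adj k (?\<pi> x) (?\<pi> y)"
    using assms(2)[of "?\<pi> x" "?\<pi> y"] inv[OF x] inv[OF y] by simp
qed

section \<open>Hubs with at least three members\<close>

context maximal_rep
begin

lemma restricted_ip:
  "(\<Sum>i\<in>{..<n} - X. \<phi> x i * \<phi> z i) = (\<Sum>i\<in>supp \<phi> x - X. \<phi> z i * \<phi> x i)"
proof -
  have "(\<Sum>i\<in>supp \<phi> x - X. \<phi> z i * \<phi> x i) = (\<Sum>i\<in>{..<n} - X. \<phi> z i * \<phi> x i)"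
    by (rule sum.mono_neutral_left) (use supp_bound in \<open>auto simp: in_supp\<close>)
  then show ?thesis by (simp add: mult.commute)
qed

lemma nonneg_at:
  assumes "\<And>x. x \<in> slim t \<Longrightarrow> \<phi> x k \<noteq> 0 \<Longrightarrow> \<phi> x k = e"
    and "x \<in> slim t" "y \<in> slim t"
  shows "0 \<le> \<phi> x k * \<phi> y k"
  using assms(1)[of x] assms(1)[of y] assms(2,3)
  by (cases "\<phi> x k = 0"; cases "\<phi> y k = 0") auto

lemma eq_of_prod:
  assumes "x \<in> hverts t" "y \<in> hverts t"
  shows "\<phi> x i * \<phi> y i = 1 \<Longrightarrow> \<phi> x i = \<phi> y i" "\<phi> x i * \<phi> y i = -1 \<Longrightarrow> \<phi> x i = - \<phi> y i"
  using val[OF assms(1), of i] val[OF assms(2), of i] by auto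

lemma hub_g: "hub f g \<Longrightarrow> x \<in> hverts t \<Longrightarrow> \<phi> x g \<noteq> 0 \<Longrightarrow> \<phi> x g = \<phi> f g"
  using hub_memberD(5)[of f g x] by (cases "x = f") (auto simp: members_def)

lemma hub_disjoint: "hub f g \<Longrightarrow> z \<in> members f g \<Longrightarrow> i \<in> supp \<phi> z \<Longrightarrow> i \<noteq> g \<Longrightarrow> \<phi> f i = 0"
  using hub_memberD(4)[of f g z] in_supp by blast

text \<open>Pairwise cancellation forces, up to signs of the coordinates, the members
  \<open>g + a + b\<close>, \<open>g - a + c\<close> and \<open>g - b - c\<close>. Their parts
  outside \<open>g\<close> add up to 0, and this rigidity keeps every further vertex except
  \<open>f\<close> away from them.\<close>

lemma hub_three_members:
  assumes hub: "hub f g" and mem: "p \<in> members f g" "q \<in> members f g" "r \<in> members f g"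
    and ne: "p \<noteq> q" "p \<noteq> r" "q \<noteq> r"
  shows "hoffman_iso t three_slim"
proof -
  note p = hub_memberD[OF hub mem(1)] and q = hub_memberD[OF hub mem(2)]
    and r = hub_memberD[OF hub mem(3)]
  obtain a b c where abc: "distinct [g, a, b, c]" and pq: "supp \<phi> p = {g, a, b}"
    "supp \<phi> q = {g, a, c}" "\<phi> q a = - \<phi> p a" "p \<in> slim t" "q \<in> slim t"
    using hub_pair[OF hub mem(1,2) ne(1)] by metis
  have rs: "r \<in> slim t" using hub_pair[OF hub mem(1,3) ne(2)] by metis
  have nadj: "\<not> adj t r p" "\<not> adj t r q" using no_triangle[of f] p q r by blast+
  have "\<phi> f g * \<phi> f g = 1" using square[of f g] hub by (auto simp: hub_def)
  then have gg: "\<phi> r g * \<phi> p g = 1" "\<phi> r g * \<phi> q g = 1" using p q r by auto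
  have 1: "1 + \<phi> r a * \<phi> p a + \<phi> r b * \<phi> p b = 0"
    using ip3[of r p g a b] p r pq abc nadj ne gg by simp
  have 2: "1 - \<phi> r a * \<phi> p a + \<phi> r c * \<phi> q c = 0"
    using ip3[of r q g a c] q r pq abc nadj ne gg by simp
  have vals: "\<phi> r a * \<phi> p a \<in> {-1, 0, 1}" "\<phi> r b * \<phi> p b \<in> {-1, 0, 1}"
    "\<phi> r c * \<phi> q c \<in> {-1, 0, 1}"
    using prod_val p(1) q(1) r(1) by blast+
  then have rb: "\<phi> r b * \<phi> p b = -1" and rc: "\<phi> r c * \<phi> q c = -1" using 1 2 by auto
  have rsupp: "supp \<phi> r = {g, b, c}"
    by (rule supp_eq3[OF rs]) (use rb rc r abc in auto)
  have rbc: "\<phi> r b = - \<phi> p b" "\<phi> r c = - \<phi> q c"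
    using eq_of_prod(2)[OF r(1) p(1) rb] eq_of_prod(2)[OF r(1) q(1) rc] by auto
  have pa: "\<phi> p a \<noteq> 0" using pq(1) in_supp by blast
  have outside: "\<phi> z g = 0 \<and> \<not> adj t z p \<and> \<not> adj t z q \<and> \<not> adj t z r"
    if z: "z \<in> hverts t" "z \<noteq> p" "z \<noteq> q" "z \<noteq> r" "z \<noteq> f" for z
  proof -
    have s: "\<phi> z g * \<phi> p g + \<phi> z a * \<phi> p a + \<phi> z b * \<phi> p b = of_bool (adj t z p)"
      "\<phi> z g * \<phi> q g - \<phi> z a * \<phi> p a + \<phi> z c * \<phi> q c = of_bool (adj t z q)"
      "\<phi> z g * \<phi> r g - \<phi> z b * \<phi> p b - \<phi> z c * \<phi> q c = of_bool (adj t z r)"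
      using ip3[of z p g a b] ip3[of z q g a c] ip3[of z r g b c] z p(1) q(1) r(1) pq rsupp abc rbc
      by simp_all
    have "\<phi> z g = 0"
    proof (rule ccontr)
      assume "\<phi> z g \<noteq> 0"
      then have zm: "z \<in> members f g" using z by (simp add: members_def)
      then have "adj t f z" using hub_memberD[OF hub] by blast
      then have "\<not> adj t z p" "\<not> adj t z q" "\<not> adj t z r"
        using no_triangle[of f] p q r by blast+
      moreover have "\<phi> z g * \<phi> f g = 1"
        using hub_memberD(5)[OF hub zm] \<open>\<phi> f g * \<phi> f g = 1\<close> by simp
      ultimately show False using s p q r by simp
    qed
    \<comment> \<open>Adding the three equations of \<open>s\<close> cancels \<open>a\<close>,
      \<open>b\<close> and \<open>c\<close>, so the three adjacencies, all nonnegative, sum to 0. A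
      fourth member would have made the same sum equal to 3.\<close>
    then have sum: "of_bool (adj t z p) + of_bool (adj t z q) + of_bool (adj t z r) = (0::int)"
      using s by (simp add: algebra_simps)
    show ?thesis
      using sum \<open>\<phi> z g = 0\<close> by (cases "adj t z p"; cases "adj t z q"; cases "adj t z r") auto
  qed
  have "f \<in> hverts t" using hub by (simp add: hub_def)
  have f0: "\<phi> f a = 0" "\<phi> f b = 0" "\<phi> f c = 0"
    using hub_disjoint[OF hub mem(1)] hub_disjoint[OF hub mem(2)] pq abc in_supp by auto
  have nfat: "a \<notin> fat_coords t \<phi>" "b \<notin> fat_coords t \<phi>" "c \<notin> fat_coords t \<phi>"
  proof -
    show "a \<notin> fat_coords t \<phi>"
      by (rule not_fat_coord[OF pq(4,5)]) (use pq(3) square[OF p(1) pa] in simp)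
    show "b \<notin> fat_coords t \<phi>" by (rule not_fat_coord[OF rs pq(4)]) (use rb in simp)
    show "c \<notin> fat_coords t \<phi>" by (rule not_fat_coord[OF rs pq(5)]) (use rc in simp)
  qed
  have slim: "slim t = {p, q, r}"
  proof (rule separated[of "{g}"])
    show "\<exists>x\<in>slim t. \<phi> x k \<noteq> 0" if "k \<in> {g}" for k
      using that p(6) pq(4) by blast
    show "0 \<le> \<phi> x k * \<phi> y k" if "k \<in> {g}" "x \<in> slim t" "y \<in> slim t" for k x y
      using that nonneg_at[of g "\<phi> f g" x y] hub_g[OF hub] verts_simps(3) by auto
    show "{p, q, r} \<subseteq> slim t" "{p, q, r} \<noteq> {}" using pq rs by auto
    fix x z assume x: "x \<in> {p, q, r}" and z: "z \<in> slim t - {p, q, r}"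
    have "supp \<phi> p - (fat_coords t \<phi> \<union> {g}) = {a, b}" "supp \<phi> q - (fat_coords t \<phi> \<union> {g}) = {a, c}"
      "supp \<phi> r - (fat_coords t \<phi> \<union> {g}) = {b, c}"
      using pq rsupp abc nfat by auto
    then have sums: "(\<Sum>i\<in>{..<n} - (fat_coords t \<phi> \<union> {g}). \<phi> p i * \<phi> z i) = \<phi> z a * \<phi> p a + \<phi> z b * \<phi> p b"
      "(\<Sum>i\<in>{..<n} - (fat_coords t \<phi> \<union> {g}). \<phi> q i * \<phi> z i) = \<phi> z a * \<phi> q a + \<phi> z c * \<phi> q c"
      "(\<Sum>i\<in>{..<n} - (fat_coords t \<phi> \<union> {g}). \<phi> r i * \<phi> z i) = \<phi> z b * \<phi> r b + \<phi> z c * \<phi> r c"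
      unfolding restricted_ip using abc by simp_all
    show "(\<Sum>i\<in>{..<n} - (fat_coords t \<phi> \<union> {g}). \<phi> x i * \<phi> z i) = 0"
    proof (cases "z = f")
      case True
      then show ?thesis using x sums f0 by auto
    next
      case False
      have zV: "z \<in> hverts t" "z \<noteq> p" "z \<noteq> q" "z \<noteq> r" using z verts_simps(3) by auto
      have "\<phi> z a * \<phi> p a + \<phi> z b * \<phi> p b = 0" "\<phi> z a * \<phi> q a + \<phi> z c * \<phi> q c = 0"
        "\<phi> z b * \<phi> r b + \<phi> z c * \<phi> r c = 0"
        using outside[OF zV False] ip3[OF zV(1) p(1) zV(2) pq(1)] ip3[OF zV(1) q(1) zV(3) pq(2)]
          ip3[OF zV(1) r(1) zV(4) rsupp] abc by simp_all
      then show ?thesis using x unfolding sums[symmetric] by blast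
    qed
  qed
  \<comment> \<open>Up to this point the hub may have been slim; it is fat since the three members
    exhaust the slim vertices.\<close>
  have ff: "f \<in> fat t" using nonslim[OF \<open>f \<in> hverts t\<close>] slim p q r by auto
  have V: "hverts t = {f, p, q, r}"
  proof (rule ccontr)
    assume "hverts t \<noteq> {f, p, q, r}"
    then obtain z where z: "z \<in> hverts t" "z \<notin> {f, p, q, r}"
      using \<open>f \<in> hverts t\<close> p q r by blast
    then have "z \<in> fat t" using nonslim[of z] slim by auto
    then obtain x where x: "x \<in> slim t" "adj t z x" using hoffman unfolding hoffman_graph_iff by blast
    then have "x \<in> {p, q, r}" by (simp add: slim)
    then show False using outside[of z] z x(2) by auto
  qed
  have adjs: "adj t f p" "adj t p f" "adj t f q" "adj t q f" "adj t f r" "adj t r f"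
    using p(3) q(3) r(3) adj_sym by blast+
  have nadjs: "\<not> adj t p q" "\<not> adj t q p" "\<not> adj t p r" "\<not> adj t r p" "\<not> adj t q r" "\<not> adj t r q"
    using no_triangle[of f] adjs by blast+
  have irr: "\<not> adj t x x" for x using adj_verts[of x x] by blast
  have nf: "p \<notin> fat t" "q \<notin> fat t" "r \<notin> fat t" using pq rs verts_simps(2) by blast+
  define \<sigma> where "\<sigma> l = (case l of F i \<Rightarrow> f | S i \<Rightarrow> if i = 1 then p else if i = 2 then q else r)" for l
  show ?thesis
  proof (rule hoffman_iso_from_labels[of \<sigma>])
    show "bij_betw \<sigma> (hverts three_slim) (hverts t)"
      using p(2) q(2) r(2) ne
      by (auto simp: bij_betw_def inj_on_def three_slim_def mk_hoffman_simps V \<sigma>_def)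
    show "adj t (\<sigma> x) (\<sigma> y) \<longleftrightarrow> adj three_slim x y"
      if "x \<in> hverts three_slim" "y \<in> hverts three_slim" for x y
      using that adjs nadjs irr by (auto simp: three_slim_def mk_hoffman_simps \<sigma>_def)
    show "\<sigma> x \<in> fat t \<longleftrightarrow> x \<in> fat three_slim" if "x \<in> hverts three_slim" for x
      using that ff nf by (auto simp: three_slim_def mk_hoffman_simps \<sigma>_def)
  qed
qed

end

section \<open>Hubs with exactly two members\<close>

locale two_member_hub = maximal_rep TT t n \<phi>
  for TT :: "'a::infinite hoffman set" and t n \<phi> +
  fixes f :: 'a and g :: nat and p q :: 'a and a b c :: nat
  assumes hub: "hub f g" and members: "members f g = {p, q}" and pq: "p \<noteq> q"
    and abc: "distinct [g, a, b, c]"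
    and psupp: "supp \<phi> p = {g, a, b}" and qsupp: "supp \<phi> q = {g, a, c}"
    and opp: "\<phi> q a = - \<phi> p a" and pslim: "p \<in> slim t" and qslim: "q \<in> slim t"
begin

text \<open>The configuration is symmetric under exchanging \<open>p\<close> with \<open>q\<close>
  and \<open>b\<close> with \<open>c\<close>, so every result about outside vertices with
  \<open>al z = 1\<close> has a mirror image for \<open>al z = -1\<close>.\<close>

lemma swap: "two_member_hub TT t n \<phi> f g q p a c b"
  by unfold_locales (use hub members pq abc psupp qsupp opp pslim qslim in auto)

lemma p_mem: "p \<in> members f g" and q_mem: "q \<in> members f g"
  using members by auto

lemmas pD = hub_memberD[OF hub p_mem] and qD = hub_memberD[OF hub q_mem]

lemma f_vert: "f \<in> hverts t" and f_g: "\<phi> f g \<noteq> 0"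
  using hub by (auto simp: hub_def)

lemma adj_pf: "adj t p f" "adj t q f" "adj t f p" "adj t f q"
  using pD(3) qD(3) adj_sym by blast+

lemma nadj_pq: "\<not> adj t p q" "\<not> adj t q p"
  using no_triangle[of f] pD(3) qD(3) by blast+

lemma f_zero: "\<phi> f a = 0" "\<phi> f b = 0" "\<phi> f c = 0"
  using hub_disjoint[OF hub p_mem] hub_disjoint[OF hub q_mem] psupp qsupp abc by auto

lemma nonzero: "\<phi> p g \<noteq> 0" "\<phi> p a \<noteq> 0" "\<phi> p b \<noteq> 0" "\<phi> q g \<noteq> 0" "\<phi> q a \<noteq> 0" "\<phi> q c \<noteq> 0"
  using psupp qsupp in_supp by auto

lemma zero: "\<phi> p c = 0" "\<phi> q b = 0"
proof -
  have "c \<notin> supp \<phi> p" "b \<notin> supp \<phi> q" using psupp qsupp abc by auto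
  then show "\<phi> p c = 0" "\<phi> q b = 0" by (auto simp: in_supp)
qed

definition outside :: "'a set" where
  "outside = hverts t - {f, p, q}"

text \<open>The contributions of the coordinates \<open>a, b, c\<close> to the inner products with \<open>p\<close> and \<open>q\<close>; since
  \<open>\<phi> q a = - \<phi> p a\<close>, the coordinate \<open>a\<close> contributes \<open>- al z\<close> to the one with \<open>q\<close>.\<close>

definition al :: "'a \<Rightarrow> int" where "al z = \<phi> z a * \<phi> p a"
definition be :: "'a \<Rightarrow> int" where "be z = \<phi> z b * \<phi> p b"
definition ga :: "'a \<Rightarrow> int" where "ga z = \<phi> z c * \<phi> q c"

lemma zero_iff: "al z = 0 \<longleftrightarrow> \<phi> z a = 0" "be z = 0 \<longleftrightarrow> \<phi> z b = 0" "ga z = 0 \<longleftrightarrow> \<phi> z c = 0"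
  using nonzero by (auto simp: al_def be_def ga_def)

lemma eq_iff:
  assumes "z \<in> hverts t"
  shows "al z = 1 \<Longrightarrow> \<phi> z a = \<phi> p a" "al z = -1 \<Longrightarrow> \<phi> z a = - \<phi> p a"
    "be z = 1 \<Longrightarrow> \<phi> z b = \<phi> p b" "be z = -1 \<Longrightarrow> \<phi> z b = - \<phi> p b"
    "ga z = 1 \<Longrightarrow> \<phi> z c = \<phi> q c" "ga z = -1 \<Longrightarrow> \<phi> z c = - \<phi> q c"
  using eq_of_prod[OF assms pD(1)] eq_of_prod[OF assms qD(1)] by (auto simp: al_def be_def ga_def)

lemma outside_g: "z \<in> outside \<Longrightarrow> \<phi> z g = 0"
  using members by (auto simp: outside_def members_def)

lemma outsideD: "z \<in> outside \<Longrightarrow> z \<in> hverts t \<and> z \<noteq> f \<and> z \<noteq> p \<and> z \<noteq> q"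
  by (auto simp: outside_def)

lemma outside_ip:
  assumes z: "z \<in> outside"
  shows "al z + be z = of_bool (adj t z p)" "ga z - al z = of_bool (adj t z q)"
  using ip3[of z p g a b] ip3[of z q g a c] outsideD[OF z] outside_g[OF z] pD(1) qD(1) psupp qsupp abc
  by (simp_all add: al_def be_def ga_def opp)

lemma grown_fpq: "grown (adj t) {f, p, q}"
proof -
  have "grown (adj t) (insert p {f})"
    by (rule grown.intros(2)[OF grown.intros(1), of f]) (use adj_pf in auto)
  then have "grown (adj t) (insert q (insert p {f}))"
    by (rule grown.intros(2)[of _ _ f]) (use adj_pf in auto)
  then show ?thesis by (simp add: insert_commute)
qed

text \<open>The sums \<open>al z + be z\<close> and \<open>ga z - al z\<close> are the adjacencies
  to \<open>p\<close> and \<open>q\<close>, and they cannot both be 1, as \<open>p\<close> and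
  \<open>q\<close> are already joined through \<open>f\<close>. Seven sign patterns survive.\<close>

lemma outside_types:
  assumes z: "z \<in> outside"
  shows "(al z, be z, ga z) \<in>
    {(0, 0, 0), (0, 1, 0), (0, 0, 1), (1, -1, 1), (1, 0, 1), (-1, 1, -1), (-1, 1, 0)}"
proof -
  have v: "al z \<in> {-1, 0, 1}" "be z \<in> {-1, 0, 1}" "ga z \<in> {-1, 0, 1}"
    using prod_val outsideD[OF z] pD(1) qD(1) unfolding al_def be_def ga_def by blast+
  have "\<not> (adj t z p \<and> adj t z q)"
    using grown_nbr[OF grown_fpq, of z p q] outsideD[OF z] pq by blast
  then have "(al z + be z, ga z - al z) \<in> {(0, 0), (1, 0), (0, 1)}"
    unfolding outside_ip[OF z] by (cases "adj t z p"; cases "adj t z q") simp_all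
  then have w: "al z + be z = 0 \<and> ga z - al z = 0 \<or> al z + be z = 1 \<and> ga z - al z = 0 \<or>
      al z + be z = 0 \<and> ga z - al z = 1" by simp
  have "al z = -1 \<or> al z = 0 \<or> al z = 1" using v(1) by simp
  then show ?thesis using v(2,3) w by (elim disjE) simp_all
qed

lemma hverts_eq: "hverts t = insert f (insert p (insert q outside))"
  using f_vert pD(1) qD(1) by (auto simp: outside_def)

lemma nonneg_g: "x \<in> slim t \<Longrightarrow> y \<in> slim t \<Longrightarrow> 0 \<le> \<phi> x g * \<phi> y g"
  using nonneg_at[of g "\<phi> f g" x y] hub_g[OF hub] verts_simps(3) by auto

text \<open>The coordinate \<open>g\<close> always has constant sign and joins \<open>K\<close>.
  Instead of orthogonality, the stronger disjointness of supports outside \<open>g\<close> and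
  \<open>K\<close> is asked for.\<close>

lemma slim_eqI:
  assumes "W \<subseteq> slim t" "p \<in> W"
    and "\<And>k. k \<in> K \<Longrightarrow> \<exists>x\<in>slim t. \<phi> x k \<noteq> 0"
    and "\<And>k x y. k \<in> K \<Longrightarrow> x \<in> slim t \<Longrightarrow> y \<in> slim t \<Longrightarrow> 0 \<le> \<phi> x k * \<phi> y k"
    and "\<And>x z i. x \<in> W \<Longrightarrow> z \<in> slim t - W \<Longrightarrow> i \<noteq> g \<Longrightarrow> i \<notin> K \<Longrightarrow> \<phi> x i = 0 \<or> \<phi> z i = 0"
  shows "slim t = W"
proof (rule separated[of "insert g K"])
  show "\<exists>x\<in>slim t. \<phi> x k \<noteq> 0" if "k \<in> insert g K" for k
    using that assms(3) nonzero(1) pslim by blast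
  show "0 \<le> \<phi> x k * \<phi> y k" if "k \<in> insert g K" "x \<in> slim t" "y \<in> slim t" for k x y
    using that assms(4) nonneg_g by blast
  show "W \<subseteq> slim t" "W \<noteq> {}" using assms by auto
  show "(\<Sum>i\<in>{..<n} - (fat_coords t \<phi> \<union> insert g K). \<phi> x i * \<phi> z i) = 0"
    if "x \<in> W" "z \<in> slim t - W" for x z
    using assms(5)[OF that] by (intro sum.neutral) auto
qed

text \<open>Relative to the signs of \<open>p\<close> and \<open>q\<close>, \<open>m\<close> is
  \<open>a - b + c\<close>. For any other outside vertex \<open>al z - be z + ga z\<close> must be 0
  or 1, which leaves only patterns that avoid \<open>a\<close> and \<open>b\<close> and use
  \<open>c\<close> with the sign of \<open>q\<close>. So \<open>c\<close> can be deleted and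
  \<open>p\<close>, \<open>q\<close>, \<open>m\<close> are all the slim vertices; \<open>f\<close>
  and a second fat vertex at \<open>c\<close> complete the path.\<close>

lemma slim_ended_path_of_alternating:
  assumes m: "m \<in> outside" and type: "al m = 1" "be m = -1"
  shows "hoffman_iso t slim_ended_path"
proof -
  have gm: "ga m = 1" using outside_types[OF m] type by auto
  have mD: "m \<in> hverts t" "m \<noteq> f" "m \<noteq> p" "m \<noteq> q" using outsideD[OF m] by auto
  have mv: "\<phi> m a = \<phi> p a" "\<phi> m b = - \<phi> p b" "\<phi> m c = \<phi> q c"
    using eq_iff[OF mD(1)] type gm by auto
  have mslim: "m \<in> slim t"
    by (rule two_supp_slim[of m a b]) (use mD mv nonzero abc in auto)
  have msupp: "supp \<phi> m = {a, b, c}"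
    by (rule supp_eq3[OF mslim]) (use mv nonzero abc in auto)
  have nadj_m: "\<not> adj t m p" "\<not> adj t m q"
    using outside_ip[OF m] type gm by auto
  have rest: "al z = 0 \<and> be z = 0 \<and> (ga z = 0 \<or> ga z = 1) \<and> \<not> adj t z p \<and>
      (adj t z q \<longleftrightarrow> ga z = 1) \<and> (adj t z m \<longleftrightarrow> ga z = 1)"
    if z: "z \<in> outside" "z \<noteq> m" for z
  proof -
    have "al z - be z + ga z = of_bool (adj t z m)"
      using ip3[of z m a b c] outsideD[OF z(1)] mD z(2) msupp abc mv
      by (simp add: al_def be_def ga_def)
    then have "al z - be z + ga z \<in> {0, 1}" "adj t z m \<longleftrightarrow> al z - be z + ga z = 1" by auto
    then show ?thesis using outside_types[OF z(1)] outside_ip[OF z(1)]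
      by (cases "adj t z p"; cases "adj t z q") auto
  qed
  have slim: "slim t = {p, q, m}"
  proof (rule slim_eqI[of _ "{c}"])
    show "{p, q, m} \<subseteq> slim t" "p \<in> {p, q, m}" using pslim qslim mslim by auto
    show "\<exists>x\<in>slim t. \<phi> x k \<noteq> 0" if "k \<in> {c}" for k
      using that nonzero qslim by auto
    have "\<phi> x c = \<phi> q c" if x: "x \<in> slim t" "\<phi> x c \<noteq> 0" for x
    proof -
      have "x \<in> hverts t" using x verts_simps by blast
      then consider "x = f" | "x = p" | "x = q" | "x \<in> outside" "x \<noteq> m" | "x = m"
        unfolding hverts_eq by blast
      then show ?thesis
        using rest[of x] eq_iff[OF \<open>x \<in> hverts t\<close>] zero zero_iff(3)[of x] f_zero mv x(2)
        by cases auto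
    qed
    then show "0 \<le> \<phi> x k * \<phi> y k" if "k \<in> {c}" "x \<in> slim t" "y \<in> slim t" for k x y
      using that nonneg_at[of c] by blast
    fix x z i assume x: "x \<in> {p, q, m}" and z: "z \<in> slim t - {p, q, m}" and i: "i \<noteq> g" "i \<notin> {c}"
    have "z \<in> hverts t" using z verts_simps(3) by auto
    then have "\<phi> z a = 0 \<and> \<phi> z b = 0"
      using rest[of z] zero_iff[of z] z f_zero unfolding hverts_eq by auto
    moreover have "\<phi> x i = 0 \<or> i = a \<or> i = b"
      using x i psupp qsupp msupp in_supp[of i x] by auto
    ultimately show "\<phi> x i = 0 \<or> \<phi> z i = 0" by auto
  qed
  have ff: "f \<in> fat t" using nonslim[OF f_vert] slim pD qD mD by auto
  have out_fat: "z \<in> fat t" if "z \<in> outside" "z \<noteq> m" for z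
    using that nonslim[of z] slim outsideD by auto
  have out_c: "\<phi> z c \<noteq> 0" if z: "z \<in> outside" "z \<noteq> m" for z
  proof -
    obtain x where "x \<in> slim t" "adj t z x"
      using out_fat[OF z] hoffman unfolding hoffman_graph_iff by blast
    then have "ga z = 1" using rest[OF z] by (auto simp: slim)
    then show ?thesis using zero_iff(3)[of z] by auto
  qed
  \<comment> \<open>Connectedness gives \<open>m\<close> a neighbour, and none of \<open>p\<close>,
    \<open>q\<close>, \<open>f\<close> is one.\<close>
  obtain f' where f': "f' \<in> outside" "f' \<noteq> m"
  proof -
    have "\<exists>x. adj t m x"
    proof (rule ccontr)
      assume "\<nexists>x. adj t m x"
      then have "{m} = hverts t" using closed_subset[of "{m}" m] mD by blast
      then have "f \<in> {m}" using f_vert by simp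
      then show False using mD by blast
    qed
    then obtain x where x: "adj t m x" by blast
    have "\<not> adj t m f" using ip_fat(1)[OF ff f_g mD(1,2)] outside_g[OF m] by simp
    then have "x \<noteq> f" "x \<noteq> p" "x \<noteq> q" "x \<noteq> m" "x \<in> hverts t"
      using x nadj_m adj_verts[OF x] by blast+
    then show ?thesis using that[of x] by (auto simp: outside_def)
  qed
  have "outside \<subseteq> {m, f'}"
    using fats_distinct_coords[OF out_fat out_fat out_c out_c] f' by blast
  then have V: "hverts t = {p, q, m, f, f'}" using f' m hverts_eq by blast
  have f'f: "f' \<in> fat t" "f' \<noteq> f" "f' \<noteq> p" "f' \<noteq> q"
    using out_fat[OF f'] outsideD[OF f'(1)] by auto
  have f'a: "adj t f' q" "adj t f' m" "\<not> adj t f' p"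
    using rest[OF f'] zero_iff(3)[of f'] out_c[OF f'] by auto
  have mf: "\<not> adj t m f" using ip_fat(1)[OF ff f_g mD(1,2)] outside_g[OF m] by simp
  have irr: "\<not> adj t x x" for x using adj_verts[of x x] by blast
  have nff: "\<not> adj t f f'" "\<not> adj t f' f"
    using ff f'f hoffman unfolding hoffman_graph_iff by blast+
  have nf: "p \<notin> fat t" "q \<notin> fat t" "m \<notin> fat t" using pslim qslim mslim verts_simps(2) by blast+
  note adjs = f'a f'a[unfolded adj_sym[of f']] mf mf[unfolded adj_sym[of m]] irr nff adj_pf nadj_pq
    nadj_m nadj_m[unfolded adj_sym[of m]]
  define \<sigma> where "\<sigma> l = (case l of F i \<Rightarrow> if i = 1 then f else f'
    | S i \<Rightarrow> if i = 1 then p else if i = 2 then q else m)" for l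
  show ?thesis
  proof (rule hoffman_iso_from_labels[of \<sigma>])
    show "bij_betw \<sigma> (hverts slim_ended_path) (hverts t)"
      using pD(2) qD(2) mD f'f f' pq
      by (auto simp: bij_betw_def inj_on_def slim_ended_path_def mk_hoffman_simps V \<sigma>_def)
    show "adj t (\<sigma> x) (\<sigma> y) \<longleftrightarrow> adj slim_ended_path x y"
      if "x \<in> hverts slim_ended_path" "y \<in> hverts slim_ended_path" for x y
    proof -
      have "x \<in> {S 1, S 2, S 3, F 1, F 2}" "y \<in> {S 1, S 2, S 3, F 1, F 2}"
        using that by (auto simp: slim_ended_path_def mk_hoffman_simps)
      then show ?thesis
        unfolding slim_ended_path_def mk_hoffman_simps
        by (elim insertE emptyE) (simp_all add: adjs \<sigma>_def)
    qed
    show "\<sigma> x \<in> fat t \<longleftrightarrow> x \<in> fat slim_ended_path" if "x \<in> hverts slim_ended_path" for x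
      using that ff f'f nf by (auto simp: slim_ended_path_def mk_hoffman_simps \<sigma>_def)
  qed
qed

end

section \<open>Outside vertices on both sides of the hub\<close>

context two_member_hub
begin

lemma adj_v:
  assumes "v \<in> outside" "al v = 1" "be v = 0" "ga v = 1"
  shows "adj t v p" "\<not> adj t v q" "\<not> adj t v f"
  using outside_ip[OF assms(1)] assms(2-) no_triangle[of p v f] adj_pf adj_sym[of v p] by auto

text \<open>Relative to the signs of \<open>p\<close> and \<open>q\<close>, \<open>v\<close> uses
  \<open>a + c\<close> and \<open>w\<close> uses \<open>- a + b\<close>. Their product -1 at
  \<open>a\<close> must be compensated, so the third coordinates coincide. Then \<open>v\<close>,
  \<open>p\<close>, \<open>f\<close>, \<open>q\<close>, \<open>w\<close> form the whole tree, a
  path, which another representation shows not to be maximal.\<close>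

lemma not_both_sides:
  assumes v: "v \<in> outside" "al v = 1" "be v = 0" "ga v = 1"
    and w: "w \<in> outside" "al w = -1" "be w = 1" "ga w = 0"
  shows False
proof -
  note vD = outsideD[OF v(1)] and wD = outsideD[OF w(1)]
  have vw: "v \<noteq> w" using v w by auto
  have vv: "\<phi> v a = \<phi> p a" "\<phi> v b = 0" "\<phi> v c = \<phi> q c"
    using eq_iff[of v] vD v zero_iff[of v] by auto
  have wv: "\<phi> w a = - \<phi> p a" "\<phi> w b = \<phi> p b" "\<phi> w c = 0"
    using eq_iff[of w] wD w zero_iff[of w] by auto
  have vs: "v \<in> slim t" by (rule two_supp_slim[of v a c]) (use vD vv nonzero abc in auto)
  have ws: "w \<in> slim t" by (rule two_supp_slim[of w a b]) (use wD wv nonzero abc in auto)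
  obtain d where d: "distinct [a, c, d]" "supp \<phi> v = {a, c, d}"
    using supp3'[OF vs, of a c] vv nonzero abc by auto
  obtain d' where d': "distinct [a, b, d']" "supp \<phi> w = {a, b, d'}"
    using supp3'[OF ws, of a b] wv nonzero abc by auto
  have ipvw: "-1 + \<phi> v d' * \<phi> w d' = of_bool (adj t v w)"
    using ip3[of v w a b d'] vD wD vw d' vv wv square[OF pD(1) nonzero(2)] by simp
  then have "\<phi> v d' \<noteq> 0" by (cases "adj t v w") auto
  moreover have "\<phi> w d' \<noteq> 0" using d' in_supp by blast
  ultimately have "d' = d" using d d' in_supp[of d' v] wv by auto
  have pvd: "\<phi> v d * \<phi> w d = 1" and nvw: "\<not> adj t v w"
    using ipvw prod_val[of v w d] vD wD \<open>d' = d\<close> by (cases "adj t v w"; auto)+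
  then have eqd: "\<phi> w d = \<phi> v d" using eq_of_prod(1)[of v w d] vD wD by simp
  have dne: "d \<noteq> g" "d \<noteq> b" using d(2) outside_g[OF v(1)] vv(2) in_supp[of _ v] by auto
  have av: "adj t v p" "\<not> adj t v q" "\<not> adj t v f" using adj_v[OF v] by auto
  have aw: "adj t w q" "\<not> adj t w p"
    using outside_ip[OF w(1)] w by auto
  have awf: "\<not> adj t w f" using no_triangle[of q w f] aw(1) adj_pf adj_sym[of w q] by blast
  have gr: "grown (adj t) (insert w (insert v {f, p, q}))"
    by (rule grown.intros(2)[of _ _ q], rule grown.intros(2)[OF grown_fpq, of p])
      (use av aw adj_sym in auto)
  have rest: "\<phi> z a = 0 \<and> \<phi> z b = 0 \<and> \<phi> z c = 0 \<and> \<phi> z d = 0 \<and>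
      \<not> adj t z p \<and> \<not> adj t z q \<and> \<not> adj t z v \<and> \<not> adj t z w"
    if z: "z \<in> outside" "z \<noteq> v" "z \<noteq> w" for z
  proof -
    note zD = outsideD[OF z(1)]
    define de where "de = \<phi> z d * \<phi> v d"
    have 1: "al z + ga z + de = of_bool (adj t z v)"
      using ip3[of z v a c d] vD zD z d vv by (simp add: al_def ga_def de_def)
    have 2: "- al z + be z + de = of_bool (adj t z w)"
      using ip3[of z w a b d] wD zD z d' \<open>d' = d\<close> wv eqd by (simp add: al_def be_def de_def)
    note 3 = outside_ip[OF z(1)]
    have uniq: "\<not> (adj t z x \<and> adj t z y)" if "x \<in> {p, q, v, w}" "y \<in> {p, q, v, w}" "x \<noteq> y" for x y
      using grown_nbr[OF gr, of z x y] that zD z by blast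
    have "\<not> (adj t z p \<and> adj t z q)" "\<not> (adj t z p \<and> adj t z v)" "\<not> (adj t z p \<and> adj t z w)"
      "\<not> (adj t z q \<and> adj t z v)" "\<not> (adj t z q \<and> adj t z w)" "\<not> (adj t z v \<and> adj t z w)"
      by (rule uniq; use pq vD wD vw in blast)+
    then have "of_bool (adj t z p) + of_bool (adj t z q) + of_bool (adj t z v) + of_bool (adj t z w) \<le> (1::int)"
      by (cases "adj t z p"; cases "adj t z q"; cases "adj t z v"; cases "adj t z w") simp_all
    \<comment> \<open>The contributions of \<open>a\<close> cancel and all others occur twice. An
      even sum that is at most 1 must vanish.\<close>
    moreover have "of_bool (adj t z p) + of_bool (adj t z q) + of_bool (adj t z v) + of_bool (adj t z w) =
        2 * (be z + ga z + de)"
      unfolding 1[symmetric] 2[symmetric] 3[symmetric] by simp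
    moreover have "of_bool (adj t z p) + of_bool (adj t z q) + of_bool (adj t z v) + of_bool (adj t z w) \<ge> (0::int)"
      by simp
    ultimately have "of_bool (adj t z p) + of_bool (adj t z q) + of_bool (adj t z v) + of_bool (adj t z w) = (0::int)"
      by presburger
    then have n: "\<not> adj t z p" "\<not> adj t z q" "\<not> adj t z v" "\<not> adj t z w"
      by (cases "adj t z p"; cases "adj t z q"; cases "adj t z v"; cases "adj t z w"; simp)+
    then have "al z = 0 \<and> be z = 0 \<and> ga z = 0 \<and> de = 0" using 1 2 3 by simp
    moreover have "\<phi> v d \<noteq> 0" using pvd by auto
    ultimately show ?thesis using zero_iff[of z] n by (auto simp: de_def)
  qed
  have "\<phi> f d = 0"
    using ip3[of f v a c d] vD f_vert d f_zero av adj_sym[of f v] pvd by auto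
  then have fz: "\<phi> f a = 0 \<and> \<phi> f b = 0 \<and> \<phi> f c = 0 \<and> \<phi> f d = 0" using f_zero by simp
  have slim: "slim t = {p, q, v, w}"
  proof (rule slim_eqI[of _ "{}"])
    show "{p, q, v, w} \<subseteq> slim t" "p \<in> {p, q, v, w}" using pslim qslim vs ws by auto
    fix x z i assume x: "x \<in> {p, q, v, w}" and z: "z \<in> slim t - {p, q, v, w}" and i: "i \<noteq> g"
    have "z \<in> hverts t" using z verts_simps(3) by auto
    then have "\<phi> z a = 0 \<and> \<phi> z b = 0 \<and> \<phi> z c = 0 \<and> \<phi> z d = 0"
      using rest[of z] fz z unfolding hverts_eq by auto
    moreover have "\<phi> x i = 0 \<or> i \<in> {a, b, c, d}"
      using x i psupp qsupp d(2) d'(2) \<open>d' = d\<close> in_supp[of i x] by auto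
    ultimately show "\<phi> x i = 0 \<or> \<phi> z i = 0" by auto
  qed auto
  have V: "hverts t = {f, p, q, v, w}"
  proof -
    have "z \<in> {v, w}" if z: "z \<in> outside" for z
    proof (rule ccontr)
      assume zn: "z \<notin> {v, w}"
      then have "z \<in> fat t" using nonslim[of z] slim outsideD[OF z] by auto
      then obtain x where x: "x \<in> slim t" "adj t z x"
        using hoffman unfolding hoffman_graph_iff by blast
      then have "x \<in> {p, q, v, w}" by (simp add: slim)
      then show False using rest[OF z] zn x(2) by auto
    qed
    then show ?thesis using hverts_eq v(1) w(1) by auto
  qed
  have fat: "fat t = {f}"
    using V slim verts_simps(1,2) vD wD pD(2) qD(2) by auto
  have irr: "\<not> adj t x x" for x using adj_verts[of x x] by blast
  note adjs = adj_pf nadj_pq av av[unfolded adj_sym[of v]] aw aw[unfolded adj_sym[of w]] awf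
    awf[unfolded adj_sym[of w]] nvw nvw[unfolded adj_sym[of v]] irr
  txt \<open>In the following representation of the path, coordinate 4 is hit by \<open>v\<close> only.\<close>
  define \<rho> :: "'a \<Rightarrow> int list" where
    "\<rho> x = (if x = f then [1, 0, 0, 0, 0, 0, 0, 0] else if x = p then [1, 1, 1, 0, 0, 0, 0, 0]
      else if x = q then [1, -1, 0, 1, 0, 0, 0, 0] else if x = v then [0, 0, 1, 0, 1, 1, 0, 0]
      else [0, 0, 0, 1, 0, 0, 1, 1])" for x
  define \<phi>' where "\<phi>' x i = (if i < 8 then \<rho> x ! i else 0)" for x i
  have len: "length (\<rho> x) = 8" for x by (simp add: \<rho>_def)
  have ip: "inner_int 8 (\<phi>' x) (\<phi>' y) = sum_list (map2 (*) (\<rho> x) (\<rho> y))" for x y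
  proof -
    have "inner_int 8 (\<phi>' x) (\<phi>' y) = (\<Sum>i<8. \<rho> x ! i * \<rho> y ! i)"
      by (simp add: inner_int_def \<phi>'_def)
    also have "\<dots> = sum_list (map2 (*) (\<rho> x) (\<rho> y))"
      by (simp add: sum_list_sum_nth atLeast0LessThan len)
    finally show ?thesis .
  qed
  have ne: "f \<noteq> p" "f \<noteq> q" "f \<noteq> v" "f \<noteq> w" "p \<noteq> v" "p \<noteq> w" "q \<noteq> v" "q \<noteq> w"
    using pD(2) qD(2) vD wD by auto
  note nes = ne ne[symmetric] pq pq[symmetric] vw vw[symmetric]
  have "rep3 t 8 \<phi>'"
    unfolding rep3_def
  proof (intro conjI ballI allI impI)
    show "inner_int 8 (\<phi>' x) (\<phi>' x) = 3" if "x \<in> slim t" for x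
      using that unfolding slim ip by (elim insertE emptyE) (simp_all add: \<rho>_def nes)
    show "inner_int 8 (\<phi>' x) (\<phi>' x) = 1" if "x \<in> fat t" for x
      using that unfolding fat ip by (elim insertE emptyE) (simp_all add: \<rho>_def nes)
    show "inner_int 8 (\<phi>' x) (\<phi>' y) = (if adj t x y then 1 else 0)"
      if "x \<in> hverts t" "y \<in> hverts t" "x \<noteq> y" for x y
      using that unfolding V ip by (elim insertE emptyE) (simp_all add: \<rho>_def nes adjs)
    show "\<phi>' x i = 0" if "8 \<le> i" for x i using that by (simp add: \<phi>'_def)
  qed
  moreover have "\<phi>' v 4 \<noteq> 0" by (simp add: \<phi>'_def \<rho>_def nes)
  ultimately obtain y where "y \<in> hverts t" "y \<noteq> v" "\<phi>' y 4 \<noteq> 0" using pendant vs by blast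
  then show False unfolding V by (auto simp: \<phi>'_def \<rho>_def nes)
qed

end

section \<open>Chains of slim vertices and their closure\<close>

context two_member_hub
begin

text \<open>The last clause says that a chain interacts with the remaining vertices only through its first
  and its last two coordinates.\<close>

definition chain :: "'a list \<Rightarrow> nat list \<Rightarrow> bool" where
  "chain ys ks \<longleftrightarrow>
     2 \<le> length ys \<and> length ks = length ys + 2 \<and> distinct ks \<and> distinct ys \<and>
     set ys \<subseteq> slim t - {f} \<and> ys ! 0 = p \<and> ks ! 1 = g \<and>
     (\<forall>i<length ys. supp \<phi> (ys ! i) = {ks ! i, ks ! (i + 1), ks ! (i + 2)}) \<and>
     (\<forall>i<length ys. \<forall>j<length ys. adj t (ys ! i) (ys ! j) \<longleftrightarrow> i = j + 2 \<or> j = i + 2) \<and>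
     (\<forall>i<length ys. adj t f (ys ! i) \<longleftrightarrow> i < 2) \<and>
     (\<forall>k\<in>set ks. k \<noteq> g \<longrightarrow> \<phi> f k = 0) \<and>
     grown (adj t) (insert f (set ys)) \<and>
     (\<forall>z\<in>hverts t - insert f (set ys). \<forall>i<length ks.
        \<phi> z (ks ! i) \<noteq> 0 \<longrightarrow> i = 0 \<or> i = length ys \<or> i = length ys + 1)"

lemma chainD:
  assumes "chain ys ks"
  shows "2 \<le> length ys" "length ks = length ys + 2" "distinct ks" "distinct ys"
    "set ys \<subseteq> slim t" "f \<notin> set ys" "ys ! 0 = p" "ks ! 1 = g"
    "\<And>i. i < length ys \<Longrightarrow> supp \<phi> (ys ! i) = {ks ! i, ks ! (i + 1), ks ! (i + 2)}"
    "\<And>i j. i < length ys \<Longrightarrow> j < length ys \<Longrightarrow>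
      adj t (ys ! i) (ys ! j) \<longleftrightarrow> i = j + 2 \<or> j = i + 2"
    "\<And>i. i < length ys \<Longrightarrow> adj t f (ys ! i) \<longleftrightarrow> i < 2"
    "\<And>k. k \<in> set ks \<Longrightarrow> k \<noteq> g \<Longrightarrow> \<phi> f k = 0"
    "grown (adj t) (insert f (set ys))"
    "\<And>z i. z \<in> hverts t \<Longrightarrow> z \<noteq> f \<Longrightarrow> z \<notin> set ys \<Longrightarrow> i < length ys + 2 \<Longrightarrow> i \<noteq> 0 \<Longrightarrow>
      i \<noteq> length ys \<Longrightarrow> i \<noteq> length ys + 1 \<Longrightarrow> \<phi> z (ks ! i) = 0"
proof -
  note A = assms[unfolded chain_def]
  show "2 \<le> length ys" "length ks = length ys + 2" "distinct ks" "distinct ys" "ys ! 0 = p"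
    "ks ! 1 = g" "grown (adj t) (insert f (set ys))"
    using A by simp_all
  show "set ys \<subseteq> slim t" "f \<notin> set ys" using A by blast+
  show "supp \<phi> (ys ! i) = {ks ! i, ks ! (i + 1), ks ! (i + 2)}" if "i < length ys" for i
    using A that by simp
  show "adj t (ys ! i) (ys ! j) \<longleftrightarrow> i = j + 2 \<or> j = i + 2" if "i < length ys" "j < length ys" for i j
    using A that by simp
  show "adj t f (ys ! i) \<longleftrightarrow> i < 2" if "i < length ys" for i using A that by simp
  show "\<phi> f k = 0" if "k \<in> set ks" "k \<noteq> g" for k using A that by simp
  have "\<forall>z\<in>hverts t - insert f (set ys). \<forall>i<length ks.
      \<phi> z (ks ! i) \<noteq> 0 \<longrightarrow> i = 0 \<or> i = length ys \<or> i = length ys + 1" "length ks = length ys + 2"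
    using A by simp_all
  then show "\<phi> z (ks ! i) = 0" if "z \<in> hverts t" "z \<noteq> f" "z \<notin> set ys" "i < length ys + 2"
    "i \<noteq> 0" "i \<noteq> length ys" "i \<noteq> length ys + 1" for z i
    using that by (metis DiffI insertE)
qed

lemma chain_ip:
  assumes ch: "chain ys ks" and i: "i < length ys" and z: "z \<in> hverts t" "z \<noteq> ys ! i"
  shows "\<phi> z (ks ! i) * \<phi> (ys ! i) (ks ! i) + \<phi> z (ks ! (i + 1)) * \<phi> (ys ! i) (ks ! (i + 1)) +
    \<phi> z (ks ! (i + 2)) * \<phi> (ys ! i) (ks ! (i + 2)) = of_bool (adj t z (ys ! i))"
proof (rule ip3[OF z(1) _ z(2)])
  show "supp \<phi> (ys ! i) = {ks ! i, ks ! (i + 1), ks ! (i + 2)}" by (rule chainD(9)[OF ch i])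
  show "ys ! i \<in> hverts t" using chainD(5)[OF ch] nth_mem[OF i] verts_simps(3) by blast
  show "distinct [ks ! i, ks ! (i + 1), ks ! (i + 2)]"
    using chainD(2,3)[OF ch] i by (simp add: nth_eq_iff_index_eq)
qed

lemma chain_nonzero:
  assumes "chain ys ks" "i < length ys"
  shows "\<phi> (ys ! i) (ks ! i) \<noteq> 0" "\<phi> (ys ! i) (ks ! (i + 1)) \<noteq> 0" "\<phi> (ys ! i) (ks ! (i + 2)) \<noteq> 0"
  using chainD(9)[OF assms] in_supp by blast+

lemma chain_nth_vert: "chain ys ks \<Longrightarrow> i < length ys \<Longrightarrow> ys ! i \<in> hverts t"
  using chainD(5) verts_simps(3) by (meson nth_mem subsetD)

text \<open>Outside vertices can now use only the first and the last coordinate of the chain. Their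
  signs there are dictated by the two end vertices, so both coordinates can be deleted, and the
  chain contains all slim vertices.\<close>

lemma closed_chain:
  assumes ch: "chain ys ks"
    and closed: "\<And>z. z \<in> hverts t \<Longrightarrow> z \<noteq> f \<Longrightarrow> z \<notin> set ys \<Longrightarrow> \<phi> z (ks ! length ys) = 0"
  shows "hoffman_iso t (c_graph (length ys))"
proof -
  note chD = chainD[OF ch]
  define m where "m = length ys"
  define u where "u = ks ! 0"
  define w where "w = ks ! (m + 1)"
  have m: "2 \<le> m" "length ys = m" "length ks = m + 2" using chD by (auto simp: m_def)
  have inj: "ks ! i = ks ! j \<longleftrightarrow> i = j" if "i < m + 2" "j < m + 2" for i j
    using that chD(3) m by (simp add: nth_eq_iff_index_eq)
  have uwg: "u \<noteq> g" "w \<noteq> g" "u \<noteq> w"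
    using inj[of 0 1] inj[of "m + 1" 1] inj[of 0 "m + 1"] m chD(8) unfolding u_def w_def by auto
  have fz: "\<phi> f u = 0" "\<phi> f w = 0"
    using chD(12) uwg m nth_mem[of 0 ks] nth_mem[of "m + 1" ks] unfolding u_def w_def by auto
  have out0: "\<phi> z (ks ! i) = 0"
    if "z \<in> hverts t" "z \<noteq> f" "z \<notin> set ys" "0 < i" "i \<le> m" for z i
    using that closed[of z] chD(14)[of z i] m by (cases "i = m") auto
  \<comment> \<open>The first coordinate lies in the support of the first chain vertex only, the
    last one in that of the last vertex only, so interior chain vertices have no outside
    neighbours.\<close>
  have out_ip: "of_bool (adj t z (ys ! i)) =
      (if i = 0 then \<phi> z u * \<phi> p u else if i = m - 1 then \<phi> z w * \<phi> (ys ! (m - 1)) w else 0)"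
    if z: "z \<in> hverts t" "z \<noteq> f" "z \<notin> set ys" and i: "i < m" for z i
  proof -
    have "z \<noteq> ys ! i" using z i m by auto
    note ip = chain_ip[OF ch _ z(1) this, symmetric]
    consider "i = 0" | "i = m - 1" "i \<noteq> 0" | "0 < i" "i + 2 \<le> m" using i m by linarith
    then show ?thesis
    proof cases
      case 1
      have "\<phi> z (ks ! 1) = 0" "\<phi> z (ks ! 2) = 0" using out0[OF z] m by auto
      then show ?thesis using ip 1 i m chD(7) by (simp add: u_def numeral_2_eq_2)
    next
      case 2
      have "\<phi> z (ks ! i) = 0" "\<phi> z (ks ! (i + 1)) = 0" using out0[OF z] m 2 by auto
      moreover have "i + 2 = m + 1" using 2 m by simp
      ultimately show ?thesis using ip 2 i m by (simp add: w_def)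
    next
      case 3
      have "\<phi> z (ks ! i) = 0" "\<phi> z (ks ! (i + 1)) = 0" "\<phi> z (ks ! (i + 2)) = 0"
        using out0[OF z] 3 by auto
      moreover have "i \<noteq> 0" "i \<noteq> m - 1" using 3 by auto
      ultimately show ?thesis using ip i m by simp
    qed
  qed
  have nz: "\<phi> p u \<noteq> 0" "\<phi> (ys ! (m - 1)) w \<noteq> 0"
    using chain_nonzero(1)[OF ch, of 0] chain_nonzero(3)[OF ch, of "m - 1"] m chD(7)
    by (auto simp: u_def w_def Suc_diff_Suc numeral_2_eq_2)
  have last_vert: "ys ! (m - 1) \<in> set ys" "ys ! (m - 1) \<in> hverts t" "p \<in> set ys"
    using m chD(7) nth_mem[of 0 ys] nth_mem[of "m - 1" ys] chain_nth_vert[OF ch, of "m - 1"] by auto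
  have cases: "x = f \<or> (\<exists>i<m. x = ys ! i) \<or> x \<noteq> f \<and> x \<notin> set ys" for x
    using m by (auto simp: in_set_conv_nth)
  have y_u: "\<phi> (ys ! i) u = 0" if "i < m" "i \<noteq> 0" for i
  proof -
    have "u \<notin> supp \<phi> (ys ! i)" using chD(9)[of i] that m inj[of 0] by (auto simp: u_def)
    then show ?thesis by (simp add: in_supp)
  qed
  have y_w: "\<phi> (ys ! i) w = 0" if "i < m" "i \<noteq> m - 1" for i
  proof -
    have "w \<notin> supp \<phi> (ys ! i)" using chD(9)[of i] that m inj[of "m + 1"] by (auto simp: w_def)
    then show ?thesis by (simp add: in_supp)
  qed
  have at_u: "\<phi> x u = \<phi> p u" if x: "x \<in> hverts t" "\<phi> x u \<noteq> 0" for x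
  proof -
    consider "x = f" | i where "i < m" "x = ys ! i" | "x \<noteq> f" "x \<notin> set ys" using cases by blast
    then show ?thesis
    proof cases
      case 2
      then show ?thesis using y_u x(2) chD(7) by (cases "i = 0") auto
    next
      case 3
      then have "\<phi> x u * \<phi> p u = of_bool (adj t x p)" using out_ip[OF x(1) 3, of 0] m chD(7) by simp
      moreover have "\<phi> x u * \<phi> p u \<noteq> 0" using x nz by simp
      ultimately have "\<phi> x u * \<phi> p u = 1" by (cases "adj t x p") auto
      then show ?thesis using eq_of_prod(1)[OF x(1) pD(1)] by blast
    qed (use fz x in simp)
  qed
  have at_w: "\<phi> x w = \<phi> (ys ! (m - 1)) w" if x: "x \<in> hverts t" "\<phi> x w \<noteq> 0" for x
  proof -
    consider "x = f" | i where "i < m" "x = ys ! i" | "x \<noteq> f" "x \<notin> set ys" using cases by blast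
    then show ?thesis
    proof cases
      case 2
      then show ?thesis using y_w x(2) by (cases "i = m - 1") auto
    next
      case 3
      then have e: "\<phi> x w * \<phi> (ys ! (m - 1)) w = of_bool (adj t x (ys ! (m - 1)))"
        using out_ip[OF x(1) 3, of "m - 1"] m by simp
      have "\<phi> x w * \<phi> (ys ! (m - 1)) w \<noteq> 0" using x nz by simp
      then have "\<phi> x w * \<phi> (ys ! (m - 1)) w = 1" using e by (cases "adj t x (ys ! (m - 1))") auto
      then show ?thesis using eq_of_prod(1)[OF x(1) last_vert(2)] by blast
    qed (use fz x in simp)
  qed
  have slim: "slim t = set ys"
  proof (rule slim_eqI[of _ "{u, w}"])
    show "set ys \<subseteq> slim t" "p \<in> set ys" using chD(5) last_vert by auto
    then show "\<exists>x\<in>slim t. \<phi> x k \<noteq> 0" if "k \<in> {u, w}" for k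
      using that nz last_vert by blast
    show "0 \<le> \<phi> x k * \<phi> y k" if "k \<in> {u, w}" "x \<in> slim t" "y \<in> slim t" for k x y
    proof -
      have "0 \<le> \<phi> x u * \<phi> y u"
        by (rule nonneg_at[OF _ that(2,3)]) (use at_u verts_simps(3) in blast)
      moreover have "0 \<le> \<phi> x w * \<phi> y w"
        by (rule nonneg_at[OF _ that(2,3)]) (use at_w verts_simps(3) in blast)
      ultimately show ?thesis using that(1) by blast
    qed
    fix x z k assume x: "x \<in> set ys" and z: "z \<in> slim t - set ys" and k: "k \<noteq> g" "k \<notin> {u, w}"
    obtain i where i: "i < m" "x = ys ! i" using x m by (auto simp: in_set_conv_nth)
    have zV: "z \<in> hverts t" "z \<notin> set ys" using z verts_simps(3) by auto
    have "\<phi> z k = 0" if "k \<in> supp \<phi> x"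
    proof -
      have "k \<in> (!) ks ` {i, i + 1, i + 2}" using that chD(9)[of i] i m by simp
      then obtain j where "j \<in> {i, i + 1, i + 2}" and kj: "k = ks ! j" by blast
      then have j: "j < m + 2" "k = ks ! j" using i by auto
      show ?thesis
      proof (cases "z = f")
        case True
        then show ?thesis using chD(12)[of k] j k m by simp
      next
        case False
        have "j \<noteq> 0" "j \<noteq> m + 1" using j k by (metis insertCI u_def, metis insertCI w_def)
        then show ?thesis using out0[OF zV(1) False zV(2), of j] j by simp
      qed
    qed
    then show "\<phi> x k = 0 \<or> \<phi> z k = 0" by (auto simp: in_supp)
  qed
  have ff: "f \<in> fat t" using nonslim[OF f_vert] slim chD(6) by auto
  have out_fat: "z \<in> fat t" if "z \<in> hverts t" "z \<notin> set ys" for z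
    using nonslim[of z] that slim by auto
  \<comment> \<open>Maximality forces a second vertex onto \<open>u\<close>. It is neither
    \<open>f\<close> nor on the chain, hence fat; the same happens at \<open>w\<close>.\<close>
  obtain f1 where f1: "f1 \<in> hverts t" "f1 \<noteq> p" "\<phi> f1 u \<noteq> 0"
    using pendant[OF rep pslim nz(1)] by blast
  have f1o: "f1 \<noteq> f" "f1 \<notin> set ys"
  proof -
    show "f1 \<noteq> f" using f1 fz by auto
    show "f1 \<notin> set ys"
    proof
      assume "f1 \<in> set ys"
      then obtain i where "i < m" "f1 = ys ! i" using m by (auto simp: in_set_conv_nth)
      then show False using y_u[of i] f1 chD(7) by (cases "i = 0") auto
    qed
  qed
  have last_slim: "ys ! (m - 1) \<in> slim t" using last_vert(1) slim by simp
  obtain f3 where f3: "f3 \<in> hverts t" "f3 \<noteq> ys ! (m - 1)" "\<phi> f3 w \<noteq> 0"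
    using pendant[OF rep last_slim nz(2)] by blast
  have f3o: "f3 \<noteq> f" "f3 \<notin> set ys"
  proof -
    show "f3 \<noteq> f" using f3 fz by auto
    show "f3 \<notin> set ys"
    proof
      assume "f3 \<in> set ys"
      then obtain i where "i < m" "f3 = ys ! i" using m by (auto simp: in_set_conv_nth)
      then show False using y_w[of i] f3 by (cases "i = m - 1") auto
    qed
  qed
  have fats: "f1 \<in> fat t" "f3 \<in> fat t" using out_fat f1 f1o f3 f3o by auto
  have s1: "supp \<phi> f1 = {u}" "supp \<phi> f3 = {w}" using fat_coordinate fats f1 f3 by auto
  then have f13: "f1 \<noteq> f3" using uwg by auto
  have f1w: "\<phi> f1 w = 0" "\<phi> f3 u = 0"
    using s1 uwg in_supp[of w f1] in_supp[of u f3] by auto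
  have V: "hverts t = insert f (insert f1 (insert f3 (set ys)))"
  proof -
    have "z \<in> {f, f1, f3}" if z: "z \<in> hverts t" "z \<notin> set ys" for z
    proof (rule ccontr)
      assume zn: "z \<notin> {f, f1, f3}"
      have zf: "z \<in> fat t" by (rule out_fat[OF z])
      then obtain x where x: "x \<in> slim t" "adj t z x"
        using hoffman unfolding hoffman_graph_iff by blast
      then obtain i where i: "i < m" "x = ys ! i" using slim m by (auto simp: in_set_conv_nth)
      have "\<phi> z u \<noteq> 0 \<or> \<phi> z w \<noteq> 0"
        using out_ip[of z i] z zn i x(2) by (auto split: if_splits)
      then show False
        using fats_distinct_coords[OF zf fats(1)] fats_distinct_coords[OF zf fats(2)] f1(3) f3(3) zn
        by blast
    qed
    then show ?thesis using f1(1) f3(1) f_vert slim verts_simps(3) by auto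
  qed
  have a1: "adj t f1 (ys ! i) \<longleftrightarrow> i = 0" if "i < m" for i
  proof -
    have "f1 \<noteq> ys ! i" using that m f1o by auto
    then have "adj t f1 (ys ! i) \<longleftrightarrow> \<phi> (ys ! i) u \<noteq> 0"
      using ip_fat(1)[OF fats(1) f1(3), of "ys ! i"] chain_nth_vert[OF ch] that m adj_sym by auto
    then show ?thesis using y_u[OF that] nz chD(7) by (cases "i = 0") auto
  qed
  have a3: "adj t f3 (ys ! i) \<longleftrightarrow> i = m - 1" if "i < m" for i
  proof -
    have "f3 \<noteq> ys ! i" using that m f3o by auto
    then have "adj t f3 (ys ! i) \<longleftrightarrow> \<phi> (ys ! i) w \<noteq> 0"
      using ip_fat(1)[OF fats(2) f3(3), of "ys ! i"] chain_nth_vert[OF ch] that m adj_sym by auto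
    then show ?thesis using y_w[OF that] nz by (cases "i = m - 1") auto
  qed
  have ay: "adj t (ys ! i) (ys ! j) \<longleftrightarrow> i = j + 2 \<or> j = i + 2" if "i < m" "j < m" for i j
    using chD(10) that m by simp
  have af: "adj t f (ys ! i) \<longleftrightarrow> i < 2" if "i < m" for i using chD(11) that m by simp
  have nff: "\<not> adj t x y" if "x \<in> fat t" "y \<in> fat t" for x y
    using that hoffman unfolding hoffman_graph_iff by blast
  define \<sigma> where "\<sigma> l = (case l of F i \<Rightarrow> if i = 1 then f1 else if i = 2 then f else f3
    | S i \<Rightarrow> ys ! (i - 1))" for l
  have cv: "hverts (c_graph m) = S ` {1..m} \<union> {F 1, F 2, F 3}" "fat (c_graph m) = {F 1, F 2, F 3}"
    by (simp_all add: c_graph_def mk_hoffman_simps)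
  have ca: "adj (c_graph m) (S i) (S j) \<longleftrightarrow> j = i + 2 \<or> i = j + 2"
    "adj (c_graph m) (F k) (S i) \<longleftrightarrow> (k = 1 \<and> i = 1) \<or> (k = 2 \<and> (i = 1 \<or> i = 2)) \<or> (k = 3 \<and> i = m)"
    "adj (c_graph m) (S i) (F k) \<longleftrightarrow> (k = 1 \<and> i = 1) \<or> (k = 2 \<and> (i = 1 \<or> i = 2)) \<or> (k = 3 \<and> i = m)"
    "\<not> adj (c_graph m) (F k) (F k')"
    if "1 \<le> i" "i \<le> m" "1 \<le> j" "j \<le> m" for i j k k'
    using that unfolding c_graph_def mk_hoffman_simps by auto
  have sS: "\<sigma> (S i) = ys ! (i - 1)" for i by (simp add: \<sigma>_def)
  have sF: "\<sigma> (F 1) = f1" "\<sigma> (F 2) = f" "\<sigma> (F 3) = f3" by (simp_all add: \<sigma>_def)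
  have "hoffman_iso t (c_graph m)"
  proof (rule hoffman_iso_from_labels[of \<sigma>])
    have img: "(\<lambda>i. ys ! (i - 1)) ` {1..m} = set ys"
    proof -
      have "(\<lambda>i. ys ! (i - 1)) ` {1..m} = (!) ys ` ((\<lambda>i. i - 1) ` {1..m})" by (simp add: image_image)
      also have "(\<lambda>i. i - 1) ` {1..m} = {0..<m}"
        by (auto simp: image_iff intro!: bexI[of _ "Suc _"])
      also have "(!) ys ` {0..<m} = set ys" using m by (auto simp: set_conv_nth)
      finally show ?thesis .
    qed
    have "inj_on \<sigma> (hverts (c_graph m))"
    proof (rule inj_onI)
      have ne: "ys ! (i - 1) \<noteq> f" "ys ! (i - 1) \<noteq> f1" "ys ! (i - 1) \<noteq> f3" if "1 \<le> i" "i \<le> m" for i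
        using that m chD(6) f1o f3o nth_mem[of "i - 1" ys] by auto
      have dy: "ys ! (i - 1) = ys ! (j - 1) \<longleftrightarrow> i = j" if "1 \<le> i" "i \<le> m" "1 \<le> j" "j \<le> m" for i j
        using that m chD(4) by (auto simp: nth_eq_iff_index_eq)
      have neF: "\<sigma> (S i) \<noteq> \<sigma> (F k)" if "1 \<le> i" "i \<le> m" for i k
        using ne[OF that] by (simp add: \<sigma>_def)
      have dF: "\<sigma> (F k) = \<sigma> (F k') \<Longrightarrow> k \<in> {1, 2, 3} \<Longrightarrow> k' \<in> {1, 2, 3} \<Longrightarrow> k = k'" for k k'
        using f1o(1) f3o(1) f13 by (auto simp: \<sigma>_def split: if_splits)
      fix x y assume xy: "x \<in> hverts (c_graph m)" "y \<in> hverts (c_graph m)" "\<sigma> x = \<sigma> y"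
      then have "(\<exists>i. x = S i \<and> 1 \<le> i \<and> i \<le> m) \<or> (\<exists>k. x = F k \<and> k \<in> {1, 2, 3})"
        "(\<exists>i. y = S i \<and> 1 \<le> i \<and> i \<le> m) \<or> (\<exists>k. y = F k \<and> k \<in> {1, 2, 3})"
        unfolding cv by auto
      then show "x = y"
        using xy(3) dy neF dF by (elim disjE exE conjE) (metis sS, metis, metis, metis)
    qed
    moreover have "\<sigma> ` hverts (c_graph m) = hverts t"
      unfolding cv V image_Un image_insert image_empty image_image sS sF img by blast
    ultimately show "bij_betw \<sigma> (hverts (c_graph m)) (hverts t)" by (simp add: bij_betw_def)
    show "adj t (\<sigma> x) (\<sigma> y) \<longleftrightarrow> adj (c_graph m) x y"
      if "x \<in> hverts (c_graph m)" "y \<in> hverts (c_graph m)" for x y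
    proof -
      have "(\<exists>i. x = S i \<and> 1 \<le> i \<and> i \<le> m) \<or> (\<exists>k. x = F k \<and> k \<in> {1, 2, 3})"
        "(\<exists>i. y = S i \<and> 1 \<le> i \<and> i \<le> m) \<or> (\<exists>k. y = F k \<and> k \<in> {1, 2, 3})"
        using that unfolding cv by auto
      then consider i j where "x = S i" "y = S j" "1 \<le> i" "i \<le> m" "1 \<le> j" "j \<le> m"
        | i k where "x = S i" "y = F k" "1 \<le> i" "i \<le> m" "k \<in> {1, 2, 3}"
        | i k where "y = S i" "x = F k" "1 \<le> i" "i \<le> m" "k \<in> {1, 2, 3}"
        | k k' where "x = F k" "y = F k'" "k \<in> {1, 2, 3}" "k' \<in> {1, 2, 3}"
        by blast
      then show ?thesis
      proof cases
        case 1
        then show ?thesis using ay[of "i - 1" "j - 1"] ca(1)[of i j] by (auto simp: sS)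
      next
        case 2
        have "adj t (\<sigma> (F k)) (\<sigma> (S i)) \<longleftrightarrow> adj (c_graph m) (F k) (S i)"
          unfolding ca(2)[OF 2(3,4,3,4)] sS using 2(3-5) a1[of "i - 1"] a3[of "i - 1"] af[of "i - 1"]
          by (elim insertE emptyE) (auto simp: sF sF(1)[simplified])
        then show ?thesis unfolding 2 ca(2,3)[OF 2(3,4,3,4)] adj_sym[of "\<sigma> (S i)"] .
      next
        case 3
        show ?thesis
          unfolding 3(1,2) ca(2)[OF 3(3,4,3,4)] sS using 3(3-5) a1[of "i - 1"] a3[of "i - 1"] af[of "i - 1"]
          by (elim insertE emptyE) (auto simp: sF sF(1)[simplified])
      next
        case 4
        have "1 \<le> m" using m by simp
        have "\<sigma> x \<in> fat t" "\<sigma> y \<in> fat t" using 4 ff fats by (auto simp: \<sigma>_def)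
        then show ?thesis using nff 4(1,2) ca(4)[of 1 1, OF _ \<open>1 \<le> m\<close> _ \<open>1 \<le> m\<close>] by simp
      qed
    qed
    have nf: "ys ! (i - 1) \<notin> fat t" if "1 \<le> i" "i \<le> m" for i
      using that m slim verts_simps(2) nth_mem[of "i - 1" ys] by auto
    show "\<sigma> x \<in> fat t \<longleftrightarrow> x \<in> fat (c_graph m)" if "x \<in> hverts (c_graph m)" for x
      using that nf ff fats unfolding cv
      by (elim UnE imageE insertE emptyE) (simp_all add: sS sF sF(1)[simplified] image_iff)
  qed
  then show ?thesis by (simp add: m_def)
qed

end

section \<open>Growing a chain\<close>

context two_member_hub
begin

text \<open>With length at least 3, an outside vertex vanishes at the first two coordinates of the
  last but one chain vertex \<open>y'\<close>. Using \<open>h1\<close> thus makes it a neighbour of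
  \<open>y'\<close>, hence not of \<open>y\<close>, and the product with \<open>y\<close> has to be
  cancelled at \<open>h2\<close>. This fixes two of the three coordinates of
  \<open>v\<close>.\<close>

lemma chain_extend:
  assumes ch: "chain ys ks" and len: "3 \<le> length ys"
    and v: "v \<in> hverts t" "v \<noteq> f" "v \<notin> set ys" "\<phi> v (ks ! length ys) \<noteq> 0"
  shows "\<exists>h. chain (ys @ [v]) (ks @ [h])"
proof -
  note chD = chainD[OF ch]
  define m where "m = length ys"
  have m: "3 \<le> m" "length ys = m" "length ks = m + 2" using len chD by (auto simp: m_def)
  have inj: "ks ! i = ks ! j \<longleftrightarrow> i = j" if "i < m + 2" "j < m + 2" for i j
    using that chD(3) m by (simp add: nth_eq_iff_index_eq)
  define y y' where "y = ys ! (m - 1)" and "y' = ys ! (m - 2)"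
  have yV: "y \<in> hverts t" "y' \<in> hverts t" "y \<in> set ys" "y' \<in> set ys"
    using chain_nth_vert[OF ch] m by (auto simp: y_def y'_def)
  have yy': "y \<noteq> y'" using chD(4) m by (simp add: y_def y'_def nth_eq_iff_index_eq)
  define h1 h2 where "h1 = ks ! m" and "h2 = ks ! (m + 1)"
  have h12: "h1 \<noteq> h2" using inj[of m "m + 1"] by (simp add: h1_def h2_def)
  have nzy: "\<phi> y h1 \<noteq> 0" "\<phi> y h2 \<noteq> 0" "\<phi> y' h1 \<noteq> 0"
  proof -
    have e: "m - 1 + 1 = m" "m - 1 + 2 = m + 1" "m - 2 + 2 = m" using m by auto
    show "\<phi> y h1 \<noteq> 0" "\<phi> y h2 \<noteq> 0" "\<phi> y' h1 \<noteq> 0"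
      using chain_nonzero(2,3)[OF ch, of "m - 1"] chain_nonzero(3)[OF ch, of "m - 2"] m e
      by (auto simp: y_def y'_def h1_def h2_def)
  qed
  have common: "adj t z y' \<and> \<phi> z h1 = \<phi> y' h1 \<and> \<phi> z h2 * \<phi> y h2 = - (\<phi> y' h1 * \<phi> y h1)"
    if z: "z \<in> hverts t" "z \<noteq> f" "z \<notin> set ys" "\<phi> z h1 \<noteq> 0" for z
  proof -
    have zy: "z \<noteq> y" "z \<noteq> y'" using z yV by auto
    have "\<phi> z (ks ! (m - 2)) = 0" "\<phi> z (ks ! (m - 1)) = 0"
      using chD(14)[OF z(1-3), of "m - 2"] chD(14)[OF z(1-3), of "m - 1"] m by auto
    moreover have e: "m - 2 + 1 = m - 1" "m - 2 + 2 = m" "m - 1 + 1 = m" "m - 1 + 2 = m + 1"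
      using m by auto
    ultimately have ip: "\<phi> z h1 * \<phi> y' h1 = of_bool (adj t z y')"
      "\<phi> z h1 * \<phi> y h1 + \<phi> z h2 * \<phi> y h2 = of_bool (adj t z y)"
      using chain_ip[OF ch, of "m - 2" z] chain_ip[OF ch, of "m - 1" z] z(1) zy m
      unfolding y_def y'_def h1_def h2_def by simp_all
    then have a: "adj t z y'" using z(4) nzy(3) by (cases "adj t z y'") auto
    then have "\<phi> z h1 = \<phi> y' h1" using ip(1) eq_of_prod(1)[OF z(1) yV(2)] by simp
    moreover have "\<not> adj t z y"
      using grown_nbr[OF chD(13), of z y y'] a z yV yy' by blast
    ultimately show ?thesis using a ip(2) by simp
  qed
  have vh1: "\<phi> v h1 \<noteq> 0" using v(4) m by (simp add: h1_def)
  note cv = common[OF v(1-3) vh1]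
  have "\<phi> v h2 * \<phi> y h2 \<noteq> 0" using cv nzy by simp
  then have vh2: "\<phi> v h2 \<noteq> 0" by auto
  have vs: "v \<in> slim t" by (rule two_supp_slim[OF v(1) vh1 vh2 h12])
  obtain h where h: "distinct [h1, h2, h]" "supp \<phi> v = {h1, h2, h}"
    using supp3'[OF vs vh1 vh2 h12] by blast
  have vh: "\<phi> v h \<noteq> 0" using h in_supp by blast
  have nbr: "adj t v x \<longleftrightarrow> x = y'" if "x \<in> insert f (set ys)" for x
    using grown_nbr[OF chD(13), of v x y'] cv that v yV by blast
  \<comment> \<open>Only the first coordinate is left as an old candidate; it would make
    \<open>v\<close> adjacent to the first chain vertex besides \<open>y'\<close>.\<close>
  have "h \<notin> set ks"
  proof
    assume "h \<in> set ks"
    then obtain i where i: "i < m + 2" "h = ks ! i" using m by (auto simp: in_set_conv_nth)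
    have "i \<noteq> m" "i \<noteq> m + 1" using h i by (auto simp: h1_def h2_def)
    then have i0: "i = 0" using chD(14)[OF v(1-3), of i] i m vh by auto
    have z12: "\<phi> v (ks ! 1) = 0" "\<phi> v (ks ! 2) = 0" using chD(14)[OF v(1-3)] m by auto
    have y0: "ys ! 0 \<in> set ys" using m nth_mem[of 0 ys] by simp
    then have "v \<noteq> ys ! 0" using v by metis
    then have "\<phi> v h * \<phi> (ys ! 0) h = of_bool (adj t v (ys ! 0))"
      using chain_ip[OF ch, of 0 v] z12 m v i i0 by (simp add: numeral_2_eq_2)
    moreover have "\<phi> (ys ! 0) h \<noteq> 0" using chain_nonzero(1)[OF ch, of 0] m i i0 by simp
    ultimately have "adj t v (ys ! 0)" using vh by (cases "adj t v (ys ! 0)") auto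
    then have "ys ! 0 = ys ! (m - 2)" using nbr[of "ys ! 0"] y0 by (simp add: y'_def)
    moreover have "m - 2 < length ys" "0 < length ys" using m by auto
    ultimately have "m - 2 = 0" using nth_eq_iff_index_eq[OF chD(4), of 0 "m - 2"] by simp
    then show False using m by simp
  qed
  have gks: "g \<in> set ks" using chD(8) m nth_mem[of 1 ks] by simp
  then have hg: "h \<noteq> g" using \<open>h \<notin> set ks\<close> by blast
  have h12g: "h1 \<noteq> g" "h2 \<noteq> g" using inj[of m 1] inj[of "m + 1" 1] m chD(8) by (auto simp: h1_def h2_def)
  have "\<phi> f h1 = 0" "\<phi> f h2 = 0"
    using chD(12)[of h1] chD(12)[of h2] h12g m by (auto simp: h1_def h2_def)
  moreover have nvf: "\<not> adj t f v" using nbr[of f] adj_sym[of f v] chD(6) yV by auto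
  ultimately have fh: "\<phi> f h = 0"
    using ip3[OF f_vert v(1) v(2)[symmetric] h(2,1)] vh by simp
  \<comment> \<open>A second such vertex agrees with \<open>v\<close> at \<open>h1\<close> and
    \<open>h2\<close>. The sum 2 is only reduced to 1, so the two are adjacent and form a triangle
    with \<open>y'\<close>.\<close>
  have unique: "\<phi> z h1 = 0" if z: "z \<in> hverts t" "z \<noteq> f" "z \<notin> set ys" "z \<noteq> v" for z
  proof (rule ccontr)
    assume z1: "\<phi> z h1 \<noteq> 0"
    note cz = common[OF z(1-3) z1]
    have "\<phi> z h2 * \<phi> y h2 = \<phi> v h2 * \<phi> y h2" using cz cv by simp
    then have "\<phi> z h2 = \<phi> v h2" using nzy by simp
    moreover have "\<phi> z h1 = \<phi> v h1" using cz cv by simp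
    ultimately have "2 + \<phi> z h * \<phi> v h = of_bool (adj t z v)"
      using ip3[OF z(1) v(1) z(4) h(2,1)] square[OF v(1) vh1] square[OF v(1) vh2] by simp
    then have "adj t z v" using prod_val[OF z(1) v(1), of h] by (cases "adj t z v") auto
    then show False using no_triangle[of y' z v] cz cv adj_sym[of y'] by blast
  qed
  have nth: "(ys @ [v]) ! i = (if i = m then v else ys ! i)" if "i < m + 1" for i
    using that m by (auto simp: nth_append)
  have nthk: "(ks @ [h]) ! i = (if i = m + 2 then h else ks ! i)" if "i < m + 3" for i
    using that m by (auto simp: nth_append)
  have "chain (ys @ [v]) (ks @ [h])"
    unfolding chain_def
  proof (intro conjI ballI allI impI)
    show "2 \<le> length (ys @ [v])" "length (ks @ [h]) = length (ys @ [v]) + 2" using m by auto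
    show "distinct (ks @ [h])" using chD(3) \<open>h \<notin> set ks\<close> by simp
    show "distinct (ys @ [v])" using chD(4) v by simp
    show "set (ys @ [v]) \<subseteq> slim t - {f}" using chD(5,6) vs v by auto
    show "(ys @ [v]) ! 0 = p" "(ks @ [h]) ! 1 = g" using chD(7,8) m by (simp_all add: nth_append)
    show "\<phi> f k = 0" if "k \<in> set (ks @ [h])" "k \<noteq> g" for k using that chD(12) fh by auto
    have "grown (adj t) (insert v (insert f (set ys)))"
      by (rule grown.intros(2)[OF chD(13), of y']) (use yV cv adj_sym[of v y'] in auto)
    then show "grown (adj t) (insert f (set (ys @ [v])))" by (simp add: insert_commute)
  next
    fix i assume i: "i < length (ys @ [v])"
    show "supp \<phi> ((ys @ [v]) ! i) = {(ks @ [h]) ! i, (ks @ [h]) ! (i + 1), (ks @ [h]) ! (i + 2)}"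
      using i m chD(9)[of i] h(2) nth[of i] nthk[of i] nthk[of "i + 1"] nthk[of "i + 2"]
      by (cases "i = m") (simp_all add: h1_def h2_def)
    show "adj t f ((ys @ [v]) ! i) \<longleftrightarrow> i < 2"
      using i m chD(11)[of i] nth[of i] nvf by (cases "i = m") simp_all
    have vy: "adj t v (ys ! j) \<longleftrightarrow> j = m - 2" if "j < m" for j
    proof -
      have "m - 2 < m" using m by simp
      then show ?thesis
        using nbr[of "ys ! j"] that m nth_eq_iff_index_eq[OF chD(4), of j "m - 2"] by (simp add: y'_def)
    qed
    have irr: "\<not> adj t v v" using adj_verts[of v v] by blast
    fix j assume j: "j < length (ys @ [v])"
    show "adj t ((ys @ [v]) ! i) ((ys @ [v]) ! j) \<longleftrightarrow> i = j + 2 \<or> j = i + 2"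
    proof (cases "i = m")
      case True
      then show ?thesis using nth[of i] nth[of j] i j m vy[of j] irr by (cases "j = m") auto
    next
      case False
      show ?thesis
      proof (cases "j = m")
        case True
        have "adj t (ys ! i) v \<longleftrightarrow> i = m - 2" using vy[of i] adj_sym[of v "ys ! i"] i m False by simp
        then show ?thesis using True False nth[of i] nth[of j] i j m by auto
      next
        case False
        then show ?thesis using \<open>i \<noteq> m\<close> nth[of i] nth[of j] i j m chD(10)[of i j] by simp
      qed
    qed
  next
    fix z i assume z: "z \<in> hverts t - insert f (set (ys @ [v]))" and i: "i < length (ks @ [h])"
      and nz: "\<phi> z ((ks @ [h]) ! i) \<noteq> 0"
    have zD: "z \<in> hverts t" "z \<noteq> f" "z \<notin> set ys" "z \<noteq> v" using z by auto
    show "i = 0 \<or> i = length (ys @ [v]) \<or> i = length (ys @ [v]) + 1"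
    proof (cases "i = m + 2")
      case False
      then have "\<phi> z (ks ! i) \<noteq> 0" "i < m + 2" using nz nthk[of i] i m by auto
      moreover have "i \<noteq> m" using unique[OF zD] \<open>\<phi> z (ks ! i) \<noteq> 0\<close> by (auto simp: h1_def)
      ultimately show ?thesis using chD(14)[OF zD(1-3), of i] m by auto
    qed (use m in simp)
  qed
  then show ?thesis by blast
qed

text \<open>Each extension consumes a vertex, so the number of vertices off the chain decreases
  until the closing condition holds.\<close>

lemma chain_closes:
  assumes "chain ys ks" "3 \<le> length ys"
  shows "\<exists>m\<ge>2. hoffman_iso t (c_graph m)"
  using assms
proof (induction "card (hverts t) - length ys" arbitrary: ys ks rule: less_induct)
  case less
  show ?case
  proof (cases "\<exists>v\<in>hverts t. v \<noteq> f \<and> v \<notin> set ys \<and> \<phi> v (ks ! length ys) \<noteq> 0")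
    case True
    then obtain v h where vh: "v \<in> hverts t" "v \<notin> set ys" "chain (ys @ [v]) (ks @ [h])"
      using chain_extend[OF less.prems] by blast
    have "card (set ys) < card (hverts t)"
      by (rule psubset_card_mono) (use vh chainD(5)[OF less.prems(1)] verts_simps(3) in auto)
    then have "length ys < card (hverts t)"
      using distinct_card[OF chainD(4)[OF less.prems(1)]] by simp
    then show ?thesis using less.hyps[OF _ vh(3)] less.prems(2) by simp
  next
    case False
    then show ?thesis using closed_chain[OF less.prems(1)] chainD(1)[OF less.prems(1)] by blast
  qed
qed

lemma chain_two: "chain [p, q] [b, g, a, c]"
proof -
  have irr: "\<not> adj t x x" for x using adj_verts[of x x] by blast
  note adjs = adj_pf nadj_pq irr
  show ?thesis
    unfolding chain_def
  proof (intro conjI)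
    show "distinct [b, g, a, c]" "distinct [p, q]" using abc pq by auto
    show "set [p, q] \<subseteq> slim t - {f}" using pslim qslim pD(2) qD(2) by auto
    show "\<forall>i<length [p, q]. supp \<phi> ([p, q] ! i) =
      {[b, g, a, c] ! i, [b, g, a, c] ! (i + 1), [b, g, a, c] ! (i + 2)}"
      using psupp qsupp by (auto simp: less_Suc_eq)
    show "\<forall>i<length [p, q]. \<forall>j<length [p, q].
      adj t ([p, q] ! i) ([p, q] ! j) \<longleftrightarrow> i = j + 2 \<or> j = i + 2"
      by (simp add: less_Suc_eq all_conj_distrib adjs)
    show "\<forall>i<length [p, q]. adj t f ([p, q] ! i) \<longleftrightarrow> i < 2"
      by (simp add: less_Suc_eq all_conj_distrib adjs)
    show "\<forall>k\<in>set [b, g, a, c]. k \<noteq> g \<longrightarrow> \<phi> f k = 0" using f_zero by simp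
    show "grown (adj t) (insert f (set [p, q]))" using grown_fpq by simp
    show "\<forall>z\<in>hverts t - insert f (set [p, q]). \<forall>i<length [b, g, a, c].
      \<phi> z ([b, g, a, c] ! i) \<noteq> 0 \<longrightarrow> i = 0 \<or> i = length [p, q] \<or> i = length [p, q] + 1"
    proof (intro ballI allI impI)
      fix z i assume z: "z \<in> hverts t - insert f (set [p, q])"
        and i: "i < length [b, g, a, c]" and nz: "\<phi> z ([b, g, a, c] ! i) \<noteq> 0"
      have "z \<in> outside" using z by (auto simp: outside_def)
      then have "\<phi> z g = 0" using outside_g by auto
      then show "i = 0 \<or> i = length [p, q] \<or> i = length [p, q] + 1"
        using i nz by (auto simp: less_Suc_eq)
    qed
  qed simp_all
qed

text \<open>The general extension starts at length 3, because outside vertices may use the first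
  coordinate \<open>b\<close> of \<open>p\<close>. For the third chain vertex this is excluded by
  the hypotheses on the types; a second vertex using \<open>a\<close> would form a triangle with
  \<open>p\<close> and \<open>v\<close>.\<close>

lemma chain_three:
  assumes no: "\<And>z. z \<in> outside \<Longrightarrow> al z \<noteq> -1" "\<And>z. z \<in> outside \<Longrightarrow> al z = 1 \<Longrightarrow> be z = 0"
    and v: "v \<in> outside" "al v = 1"
  shows "\<exists>d. chain [p, q, v] [b, g, a, c, d]"
proof -
  note vD = outsideD[OF v(1)]
  have bv: "be v = 0" "ga v = 1" using no(2)[OF v] outside_types[OF v(1)] v(2) by auto
  have vv: "\<phi> v a = \<phi> p a" "\<phi> v b = 0" "\<phi> v c = \<phi> q c"
    using eq_iff[of v] vD v bv zero_iff[of v] by auto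
  have vs: "v \<in> slim t" by (rule two_supp_slim[of v a c]) (use vD vv nonzero abc in auto)
  obtain d where d: "distinct [a, c, d]" "supp \<phi> v = {a, c, d}"
    using supp3'[OF vs, of a c] vv nonzero abc by auto
  have vd: "\<phi> v d \<noteq> 0" using d in_supp by blast
  have dne: "d \<noteq> g" "d \<noteq> b" using vd outside_g[OF v(1)] vv(2) by auto
  note av = adj_v[OF v bv]
  have "\<phi> f d = 0"
    using ip3[of f v a c d] vD f_vert d f_zero av adj_sym[of f v] vd by auto
  then have fz: "\<phi> f k = 0" if "k \<in> {b, a, c, d}" for k using f_zero that by auto
  have za: "\<phi> z a = 0" if z: "z \<in> outside" "z \<noteq> v" for z
  proof (rule ccontr)
    assume "\<phi> z a \<noteq> 0"
    then have "al z = 1" using zero_iff(1)[of z] outside_types[OF z(1)] no(1)[OF z(1)] by auto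
    then have t: "al z = 1" "be z = 0" "ga z = 1" using no(2)[OF z(1)] outside_types[OF z(1)] by auto
    have "2 + \<phi> z d * \<phi> v d = of_bool (adj t z v)"
      using ip3[of z v a c d] outsideD[OF z(1)] vD z(2) d vv t by (simp add: al_def ga_def)
    then have "adj t z v" using prod_val[of z v d] outsideD[OF z(1)] vD by (cases "adj t z v") auto
    then show False using no_triangle[of p z v] av(1) adj_v(1)[OF z(1) t] adj_sym[of p] by blast
  qed
  have gr: "grown (adj t) (insert v {f, p, q})"
    by (rule grown.intros(2)[OF grown_fpq, of p]) (use av adj_sym in auto)
  have irr: "\<not> adj t x x" for x using adj_verts[of x x] by blast
  note adjs = adj_pf nadj_pq av av[unfolded adj_sym[of v]] irr
  have "chain [p, q, v] [b, g, a, c, d]"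
    unfolding chain_def
  proof (intro conjI)
    show "distinct [b, g, a, c, d]" using abc d dne by auto
    show "distinct [p, q, v]" using pq vD by auto
    show "set [p, q, v] \<subseteq> slim t - {f}" using pslim qslim vs vD pD(2) qD(2) by auto
    show "\<forall>i<length [p, q, v]. supp \<phi> ([p, q, v] ! i) =
      {[b, g, a, c, d] ! i, [b, g, a, c, d] ! (i + 1), [b, g, a, c, d] ! (i + 2)}"
      using psupp qsupp d(2) by (auto simp: less_Suc_eq)
    show "\<forall>i<length [p, q, v]. \<forall>j<length [p, q, v].
      adj t ([p, q, v] ! i) ([p, q, v] ! j) \<longleftrightarrow> i = j + 2 \<or> j = i + 2"
      by (simp add: less_Suc_eq all_conj_distrib adjs)
    show "\<forall>i<length [p, q, v]. adj t f ([p, q, v] ! i) \<longleftrightarrow> i < 2"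
      by (simp add: less_Suc_eq all_conj_distrib adjs)
    show "\<forall>k\<in>set [b, g, a, c, d]. k \<noteq> g \<longrightarrow> \<phi> f k = 0" using fz by simp
    show "grown (adj t) (insert f (set [p, q, v]))" using gr by (simp add: insert_commute)
    show "\<forall>z\<in>hverts t - insert f (set [p, q, v]). \<forall>i<length [b, g, a, c, d].
      \<phi> z ([b, g, a, c, d] ! i) \<noteq> 0 \<longrightarrow> i = 0 \<or> i = length [p, q, v] \<or> i = length [p, q, v] + 1"
    proof (intro ballI allI impI)
      fix z i assume z: "z \<in> hverts t - insert f (set [p, q, v])"
        and i: "i < length [b, g, a, c, d]" and nz: "\<phi> z ([b, g, a, c, d] ! i) \<noteq> 0"
      have "z \<in> outside" "z \<noteq> v" using z by (auto simp: outside_def)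
      then have "\<phi> z g = 0" "\<phi> z a = 0" using za outside_g by auto
      then show "i = 0 \<or> i = length [p, q, v] \<or> i = length [p, q, v] + 1"
        using i nz by (auto simp: less_Suc_eq)
    qed
  qed simp_all
  then show ?thesis by blast
qed

text \<open>If no outside vertex uses \<open>a\<close>, the chain of \<open>p\<close> and
  \<open>q\<close> is closed already and yields the smallest case \<open>c_graph 2\<close>.\<close>

lemma one_sided:
  assumes no: "\<And>z. z \<in> outside \<Longrightarrow> al z \<noteq> -1" "\<And>z. z \<in> outside \<Longrightarrow> al z = 1 \<Longrightarrow> be z = 0"
  shows "\<exists>m\<ge>2. hoffman_iso t (c_graph m)"
proof (cases "\<exists>v\<in>outside. al v = 1")
  case True
  then obtain v d where "chain [p, q, v] [b, g, a, c, d]" using chain_three[OF no] by blast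
  then show ?thesis using chain_closes by fastforce
next
  case False
  then have al0: "al z = 0" if "z \<in> outside" for z using outside_types[OF that] no that by auto
  have "hoffman_iso t (c_graph (length [p, q]))"
    by (rule closed_chain[OF chain_two]) (use al0 zero_iff(1) in \<open>auto simp: outside_def numeral_2_eq_2\<close>)
  then show ?thesis by (intro exI[of _ "length [p, q]"]) simp
qed

end

text \<open>Passing to the mirrored hub negates \<open>al\<close> and exchanges \<open>be\<close>
  with \<open>ga\<close>. Without alternating patterns, \<open>al = 1\<close> leaves only (1, 0, 1)
  and \<open>al = -1\<close> only (-1, 1, 0). These exclude each other, so after a reflection only
  the first one occurs.\<close>

lemma (in maximal_rep) two_members:
  assumes "two_member_hub TT t n \<phi> f g p q a b c"
  shows "hoffman_iso t slim_ended_path \<or> (\<exists>m\<ge>2. hoffman_iso t (c_graph m))"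
proof -
  interpret A: two_member_hub TT t n \<phi> f g p q a b c by (rule assms)
  interpret B: two_member_hub TT t n \<phi> f g q p a c b by (rule A.swap)
  have BA: "B.al z = - A.al z" "B.be z = A.ga z" "B.ga z = A.be z" "B.outside = A.outside" for z
    by (auto simp: A.al_def B.al_def A.be_def B.be_def A.ga_def B.ga_def A.opp A.outside_def B.outside_def)
  show ?thesis
  proof (cases "\<exists>m\<in>A.outside. A.al m = 1 \<and> A.be m = -1 \<or> A.al m = -1 \<and> A.ga m = -1")
    case True
    then show ?thesis
      using A.slim_ended_path_of_alternating B.slim_ended_path_of_alternating unfolding BA by force
  next
    case False
    then have no: "A.al z = 1 \<Longrightarrow> A.be z = 0 \<and> A.ga z = 1" "A.al z = -1 \<Longrightarrow> A.be z = 1 \<and> A.ga z = 0"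
      if "z \<in> A.outside" for z
      using A.outside_types[OF that] that by auto
    show ?thesis
    proof (cases "\<exists>v\<in>A.outside. A.al v = 1")
      case True
      then have "A.al z \<noteq> -1" if "z \<in> A.outside" for z
        using A.not_both_sides no that by blast
      then show ?thesis using A.one_sided no by blast
    next
      case False
      then show ?thesis using B.one_sided no unfolding BA by force
    qed
  qed
qed

section \<open>Vertices of large degree\<close>

context maximal_rep
begin

lemma hub_in_family:
  assumes hub: "hub f g" and p: "p \<in> members f g" and q: "q \<in> members f g" and pq: "p \<noteq> q"
  shows "\<exists>\<ff>\<in>family_F. hoffman_iso t \<ff>"
proof (cases "members f g = {p, q}")
  case True
  obtain a b c where "distinct [g, a, b, c]" "supp \<phi> p = {g, a, b}"
    "supp \<phi> q = {g, a, c}" "\<phi> q a = - \<phi> p a" "p \<in> slim t" "q \<in> slim t"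
    using hub_pair[OF hub p q pq] by metis
  then have "two_member_hub TT t n \<phi> f g p q a b c"
    using hub True pq by unfold_locales auto
  then show ?thesis using two_members unfolding family_F_def by blast
next
  case False
  then obtain r where "r \<in> members f g" "r \<noteq> p" "r \<noteq> q" using p q by blast
  then have "hoffman_iso t three_slim" using hub_three_members[OF hub p q] pq by metis
  then show ?thesis unfolding family_F_def by blast
qed

text \<open>The vertices using the coordinate of a fat vertex are exactly its neighbours, so nothing
  can spoil this hub.\<close>

lemma fat_hub:
  assumes "f \<in> fat t" "adj t f x" "adj t f y" "x \<noteq> y"
  shows "\<exists>\<ff>\<in>family_F. hoffman_iso t \<ff>"
proof -
  obtain g where g: "supp \<phi> f = {g}" using fat_supp[OF assms(1)] by blast
  have fg: "\<phi> f g \<noteq> 0" using g in_supp by blast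
  have f: "f \<in> hverts t" using assms verts_simps(4) by blast
  have iff: "adj t f z \<longleftrightarrow> \<phi> z g \<noteq> 0" if "z \<in> hverts t" "z \<noteq> f" for z
    using ip_fat(1)[OF assms(1) fg that] adj_sym by blast
  have "hub f g" unfolding hub_def g using f fg iff by (auto simp: in_supp)
  moreover have "x \<in> members f g" "y \<in> members f g"
    using assms(2,3) adj_verts[of f] iff by (auto simp: members_def)
  ultimately show ?thesis using hub_in_family assms(4) by blast
qed

text \<open>The neighbours of \<open>y\<close> that the hub condition at \<open>i\<close> asks for.
  Once \<open>y\<close> has two neighbours, the sets for its three coordinates cover the
  neighbourhood, which prepares the pigeonhole argument.\<close>

definition nbr_at :: "'a \<Rightarrow> nat \<Rightarrow> 'a set" where
  "nbr_at y i = {z. adj t y z \<and> \<phi> z i = \<phi> y i \<and> (\<forall>j\<in>supp \<phi> y. j \<noteq> i \<longrightarrow> \<phi> z j = 0)}"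

text \<open>A neighbour \<open>x\<close> of \<open>y\<close> with the same support as \<open>y\<close> has the same inner products as \<open>y\<close>
  modulo 2, so it would be adjacent to every further neighbour of \<open>y\<close>.\<close>

lemma nbr_at_exists:
  assumes y: "y \<in> slim t" and xz: "adj t y x" "adj t y z" "x \<noteq> z"
  shows "\<exists>i\<in>supp \<phi> y. x \<in> nbr_at y i"
proof -
  have V: "y \<in> hverts t" "x \<in> hverts t" "z \<in> hverts t" "x \<noteq> y" "z \<noteq> y"
    using adj_verts xz by blast+
  have "supp \<phi> y \<noteq> {}" using card_supp[OF y] by auto
  then obtain i where "\<phi> y i \<noteq> 0" using in_supp by auto
  then obtain j k where ijk: "distinct [i, j, k]" "supp \<phi> y = {i, j, k}" using supp3[OF y] by blast
  have nzy: "\<phi> y l \<noteq> 0" if "l \<in> {i, j, k}" for l using ijk(2) in_supp that by blast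
  have xy: "\<phi> x i * \<phi> y i + \<phi> x j * \<phi> y j + \<phi> x k * \<phi> y k = 1"
    using ip3[OF V(2,1,4) ijk(2,1)] xz(1) adj_sym by simp
  have zy: "\<phi> z i * \<phi> y i + \<phi> z j * \<phi> y j + \<phi> z k * \<phi> y k = 1"
    using ip3[OF V(3,1,5) ijk(2,1)] xz(2) adj_sym by simp
  have pv: "\<phi> x l * \<phi> y l = 0 \<or> \<phi> x l * \<phi> y l = 1 \<or> \<phi> x l * \<phi> y l = -1" for l
    using prod_val[OF V(2,1), of l] by auto
  have one: "\<phi> x l * \<phi> y l = 1 \<Longrightarrow> \<phi> x l = \<phi> y l" for l
    using eq_of_prod(1)[OF V(2,1)] by blast
  have nall: "\<not> (\<phi> x i \<noteq> 0 \<and> \<phi> x j \<noteq> 0 \<and> \<phi> x k \<noteq> 0)"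
  proof
    assume nz: "\<phi> x i \<noteq> 0 \<and> \<phi> x j \<noteq> 0 \<and> \<phi> x k \<noteq> 0"
    have xs: "x \<in> slim t" by (rule two_supp_slim[of x i j]) (use nz ijk V in auto)
    have xsupp: "supp \<phi> x = {i, j, k}" by (rule supp_eq3[OF xs]) (use nz ijk in auto)
    have "\<not> adj t z x" using no_triangle[OF xz(2,1)] .
    then have zx: "\<phi> z i * \<phi> x i + \<phi> z j * \<phi> x j + \<phi> z k * \<phi> x k = 0"
      using ip3[OF V(3,2) xz(3)[symmetric] xsupp ijk(1)] by simp
    have par: "even (\<phi> z l * \<phi> y l - \<phi> z l * \<phi> x l)" if "l \<in> {i, j, k}" for l
    proof -
      have "odd (\<phi> y l)" "odd (\<phi> x l)"
        using nzy[OF that] nz that val[OF V(1), of l] val[OF V(2), of l] by auto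
      then show ?thesis by (simp add: right_diff_distrib[symmetric])
    qed
    have "even ((\<phi> z i * \<phi> y i - \<phi> z i * \<phi> x i) + (\<phi> z j * \<phi> y j - \<phi> z j * \<phi> x j) +
        (\<phi> z k * \<phi> y k - \<phi> z k * \<phi> x k))"
      using par[of i] par[of j] par[of k] by (intro dvd_add) auto
    also have "(\<phi> z i * \<phi> y i - \<phi> z i * \<phi> x i) + (\<phi> z j * \<phi> y j - \<phi> z j * \<phi> x j) +
        (\<phi> z k * \<phi> y k - \<phi> z k * \<phi> x k) = 1" using zy zx by linarith
    finally show False by simp
  qed
  have zero: "\<phi> x l * \<phi> y l = 0 \<longleftrightarrow> \<phi> x l = 0" if "l \<in> {i, j, k}" for l using nzy[OF that] by simp
  have gen: "X = 1 \<and> Y = 0 \<and> Z = 0 \<or> Y = 1 \<and> X = 0 \<and> Z = 0 \<or> Z = 1 \<and> X = 0 \<and> Y = 0"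
    if "X = 0 \<or> X = 1 \<or> X = -1" "Y = 0 \<or> Y = 1 \<or> Y = -1" "Z = 0 \<or> Z = 1 \<or> Z = -1"
      "X + Y + Z = 1" "X = 0 \<or> Y = 0 \<or> Z = 0" for X Y Z :: int
    using that by auto
  have "\<phi> x i * \<phi> y i = 0 \<or> \<phi> x j * \<phi> y j = 0 \<or> \<phi> x k * \<phi> y k = 0" using nall by auto
  note gen[OF pv pv pv xy this]
  then have "(\<phi> x i = \<phi> y i \<and> \<phi> x j = 0 \<and> \<phi> x k = 0) \<or> (\<phi> x j = \<phi> y j \<and> \<phi> x i = 0 \<and> \<phi> x k = 0) \<or>
    (\<phi> x k = \<phi> y k \<and> \<phi> x i = 0 \<and> \<phi> x j = 0)"
    using one[of i] one[of j] one[of k] zero[of i] zero[of j] zero[of k] by blast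
  then show ?thesis unfolding nbr_at_def ijk(2) using xz(1) ijk(1) by auto
qed

lemma nbr_atD:
  assumes "z \<in> nbr_at y i"
  shows "adj t y z" "adj t z y" "z \<in> hverts t" "z \<noteq> y" "\<phi> z i = \<phi> y i"
    "\<And>j. j \<in> supp \<phi> y \<Longrightarrow> j \<noteq> i \<Longrightarrow> \<phi> z j = 0"
  using assms adj_sym[of y z] adj_verts[of y z] by (auto simp: nbr_at_def)

text \<open>\<open>r\<close> prevents \<open>y\<close> from being a hub at \<open>a\<close>; up to exchanging \<open>p\<close> and \<open>q\<close> this is the only way in
  which a non-neighbour of \<open>y\<close> can do so.\<close>

definition blocked :: "'a \<Rightarrow> nat \<Rightarrow> nat \<Rightarrow> 'a \<Rightarrow> 'a \<Rightarrow> 'a \<Rightarrow> nat \<Rightarrow> nat \<Rightarrow> nat \<Rightarrow> bool" where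
  "blocked y a b p q r u v w \<longleftrightarrow> p \<in> nbr_at y a \<and> q \<in> nbr_at y a \<and> p \<noteq> q \<and>
     distinct [a, b, u, v, w] \<and> supp \<phi> p = {a, u, v} \<and> supp \<phi> q = {a, u, w} \<and>
     \<phi> q u = - \<phi> p u \<and> r \<in> hverts t \<and> r \<noteq> y \<and> \<not> adj t y r \<and> supp \<phi> r = {a, b, w} \<and>
     \<phi> r a = \<phi> y a \<and> \<phi> r b = - \<phi> y b \<and> \<phi> r w = - \<phi> q w \<and> adj t r p"

text \<open>A vertex \<open>r\<close> adjacent to both \<open>p\<close> and \<open>q\<close> would
  close a 4-cycle with \<open>y\<close>. So its product at \<open>a\<close> must be cancelled for
  one of them by its third coordinate \<open>d\<close>, which therefore is \<open>v\<close> or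
  \<open>w\<close>. The uncancelled product belongs to the other one and must be 1, which fixes the
  sign at \<open>a\<close> and the adjacency.\<close>

lemma blockedI:
  assumes y: "y \<in> slim t" "supp \<phi> y = {a, b, c}" "distinct [a, b, c]"
    and p: "p \<in> nbr_at y a" and q: "q \<in> nbr_at y a" and pq: "p \<noteq> q"
    and r: "r \<in> hverts t" "r \<noteq> y" "\<not> adj t y r" "\<phi> r a \<noteq> 0" "\<phi> r b \<noteq> 0"
  shows "\<exists>p q u v w. blocked y a b p q r u v w"
proof -
  note pD = nbr_atD[OF p] and qD = nbr_atD[OF q]
  have yV: "y \<in> hverts t" using y verts_simps by blast
  have nzy: "\<phi> y a \<noteq> 0" "\<phi> y b \<noteq> 0" "\<phi> y c \<noteq> 0" using y(2) in_supp by auto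
  have p0: "\<phi> p b = 0" "\<phi> p c = 0" "\<phi> q b = 0" "\<phi> q c = 0"
    using pD(6) qD(6) y(2,3) by auto
  have nadj: "\<not> adj t p q" using no_triangle[OF pD(1) qD(1)] .
  have pqa: "\<phi> p a = \<phi> q a" "\<phi> p a \<noteq> 0" using pD(5) qD(5) nzy by simp_all
  obtain u v w where d: "distinct [a, u, v, w]" and s: "supp \<phi> p = {a, u, v}" "supp \<phi> q = {a, u, w}"
    "\<phi> q u = - \<phi> p u"
    using common_coordinate[OF pD(3) qD(3) pq nadj pqa] by metis
  have bc: "b \<notin> {u, v, w}" "c \<notin> {u, v, w}"
  proof -
    have "b \<notin> supp \<phi> p" "c \<notin> supp \<phi> p" "b \<notin> supp \<phi> q" "c \<notin> supp \<phi> q" by (simp_all add: in_supp p0)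
    then show "b \<notin> {u, v, w}" "c \<notin> {u, v, w}" unfolding s by auto
  qed
  have nz: "\<phi> p u \<noteq> 0" "\<phi> p v \<noteq> 0" "\<phi> q w \<noteq> 0" using s in_supp by auto
  have rs: "r \<in> slim t" by (rule two_supp_slim[OF r(1,4,5)]) (use y in auto)
  obtain d where d': "distinct [a, b, d]" "supp \<phi> r = {a, b, d}"
    using supp3'[OF rs r(4,5)] y(3) by auto
  have rd: "\<phi> r d \<noteq> 0" using d' in_supp by blast
  have r0: "\<phi> r i = 0" if "i \<notin> {a, b, d}" for i using that d'(2) in_supp by blast
  have rpq: "r \<noteq> p" "r \<noteq> q" using r p0 by auto
  define e where "e = \<phi> r a * \<phi> y a"
  have e: "e = 1 \<or> e = -1"
    using prod_val[OF r(1) yV, of a] r(4) nzy by (auto simp: e_def)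
  have ea: "\<phi> r a * \<phi> p a = e" "\<phi> r a * \<phi> q a = e" using pD qD by (simp_all add: e_def)
  have ry: "e + \<phi> r b * \<phi> y b + \<phi> r c * \<phi> y c = 0"
    using ip3[OF r(1) yV r(2) y(2,3)] r(3) adj_sym by (simp add: e_def)
  have rb: "\<phi> r b * \<phi> y b = 1 \<or> \<phi> r b * \<phi> y b = -1"
    using prod_val[OF r(1) yV, of b] r(5) nzy by auto
  \<comment> \<open>By parity the product at \<open>c\<close> is 0, since those at \<open>a\<close>
    and \<open>b\<close> are both odd.\<close>
  have rby: "\<phi> r b * \<phi> y b = - e"
    using ry rb e prod_val[OF r(1) yV, of c] by auto
  have rp: "e + \<phi> r u * \<phi> p u + \<phi> r v * \<phi> p v = of_bool (adj t r p)"
    using ip3[OF r(1) pD(3) rpq(1) s(1)] d ea by simp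
  have rq: "e - \<phi> r u * \<phi> p u + \<phi> r w * \<phi> q w = of_bool (adj t r q)"
    using ip3[OF r(1) qD(3) rpq(2) s(2)] d ea s(3) by simp
  have nboth: "\<not> (adj t r p \<and> adj t r q)"
  proof
    assume "adj t r p \<and> adj t r q"
    then have "adj t r q" "adj t p r" using adj_sym[of r p] by auto
    then have "vertex_cycle (adj t) [y, p, r, q]"
      using pD(1,4) qD(2,4) pq rpq r(2) by (auto simp: vertex_cycle_def)
    then show False using no_cycle by blast
  qed
  have prd: "\<phi> r i * \<phi> x i = 1 \<or> \<phi> r i * \<phi> x i = -1" if "x \<in> hverts t" "i = d" "\<phi> x i \<noteq> 0" for i x
    using prod_val[OF r(1) that(1), of i] rd that by auto
  \<comment> \<open>With \<open>d = u\<close> one of \<open>e + x\<close> and \<open>e - x\<close>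
    would be 2 or -2; with \<open>d\<close> outside all three, both products would equal
    \<open>e\<close>.\<close>
  have dv: "d = v \<or> d = w"
  proof (rule ccontr)
    assume "\<not> ?thesis"
    then have z: "\<phi> r v = 0" "\<phi> r w = 0" using r0 d bc by auto
    show False
    proof (cases "d = u")
      case True
      have x: "\<phi> r u * \<phi> p u = 1 \<or> \<phi> r u * \<phi> p u = -1" using prd[OF pD(3)] True nz by simp
      have "e + \<phi> r u * \<phi> p u = 0 \<or> e + \<phi> r u * \<phi> p u = 1" "e - \<phi> r u * \<phi> p u = 0 \<or> e - \<phi> r u * \<phi> p u = 1"
        using rp rq z by (cases "adj t r p"; cases "adj t r q"; simp)+
      then show False using e x by (elim disjE) linarith+
    next
      case False
      then have "\<phi> r u = 0" using r0 d bc by auto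
      then show False using rp rq z e nboth by (cases "adj t r p"; cases "adj t r q") auto
    qed
  qed
  then have ru: "\<phi> r u = 0" using r0 d bc by auto
  have e1: "e = 1"
  proof -
    have "\<phi> r v = 0 \<or> \<phi> r w = 0" using dv r0 d bc by auto
    then show ?thesis using rp rq ru e by (cases "adj t r p"; cases "adj t r q") auto
  qed
  have rab: "\<phi> r a = \<phi> y a" "\<phi> r b = - \<phi> y b"
    using e1 rby eq_of_prod[OF r(1) yV] by (auto simp: e_def)
  show ?thesis
  proof (cases "d = w")
    case True
    then have "\<phi> r v = 0" using r0 d bc by auto
    then have "adj t r p" using rp ru e1 by (cases "adj t r p") auto
    moreover have "\<phi> r w * \<phi> q w = -1"
      using prd[OF qD(3), of w] True nz rq ru e1 by (cases "adj t r q") auto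
    then have "\<phi> r w = - \<phi> q w" using eq_of_prod(2)[OF r(1) qD(3)] by blast
    ultimately have "blocked y a b p q r u v w"
      unfolding blocked_def using p q pq d bc s r rab d'(2) True d'(1) by auto
    then show ?thesis by blast
  next
    case False
    then have dv: "d = v" using dv by blast
    then have "\<phi> r w = 0" using r0 d bc by auto
    then have "adj t r q" using rq ru e1 by (cases "adj t r q") auto
    moreover have "\<phi> r v * \<phi> p v = -1"
      using prd[OF pD(3), of v] dv nz rp ru e1 by (cases "adj t r p") auto
    then have "\<phi> r v = - \<phi> p v" using eq_of_prod(2)[OF r(1) pD(3)] by blast
    ultimately have "blocked y a b q p r u w v"
      unfolding blocked_def using p q pq d bc s r rab d'(2) dv d'(1) by auto
    then show ?thesis by blast
  qed
qed

lemma blockedD: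
  assumes "blocked y a b p q r u v w"
  shows "p \<in> nbr_at y a" "q \<in> nbr_at y a" "p \<noteq> q" "distinct [a, b, u, v, w]"
    "supp \<phi> p = {a, u, v}" "supp \<phi> q = {a, u, w}" "\<phi> q u = - \<phi> p u" "r \<in> hverts t" "r \<noteq> y"
    "\<not> adj t y r" "supp \<phi> r = {a, b, w}" "\<phi> r a = \<phi> y a" "\<phi> r b = - \<phi> y b" "\<phi> r w = - \<phi> q w"
    "adj t r p"
  using assms by (simp_all add: blocked_def)

end

section \<open>How a blocked coordinate limits the degree\<close>

context maximal_rep
begin

text \<open>A neighbour \<open>z\<close> at \<open>b\<close> has product -1 with \<open>r\<close>
  there and must compensate it at \<open>w\<close>. This creates -1 with \<open>q\<close>, to be
  compensated at \<open>u\<close>, which creates -1 with \<open>p\<close>; now the three coordinates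
  of \<open>z\<close> are used up.\<close>

lemma blocked_no_nbr:
  assumes bl: "blocked y a b p q r u v w" and y: "a \<in> supp \<phi> y" "b \<in> supp \<phi> y"
  shows "nbr_at y b = {}"
proof (rule ccontr)
  assume "nbr_at y b \<noteq> {}"
  then obtain z where z: "z \<in> nbr_at y b" by blast
  note B = blockedD[OF bl]
  note pD = nbr_atD[OF B(1)] and qD = nbr_atD[OF B(2)] and zD = nbr_atD[OF z]
  have yV: "y \<in> hverts t" using zD(1) adj_verts by blast
  have ne: "a \<noteq> b" and nzy: "\<phi> y a \<noteq> 0" "\<phi> y b \<noteq> 0" using B(4) y in_supp by auto
  have za: "\<phi> z a = 0" using zD(6)[OF y(1) ne] .
  have zne: "z \<noteq> p" "z \<noteq> q" "z \<noteq> r" using za pD(5) qD(5) B(12) nzy by auto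
  have nadj: "\<not> adj t z p" "\<not> adj t z q"
    using no_triangle[OF zD(1) pD(1)] no_triangle[OF zD(1) qD(1)] by auto
  have "- 1 + \<phi> z w * \<phi> r w = of_bool (adj t z r)"
    using ip3[OF zD(3) B(8) zne(3) B(11)] B(4,13) za zD(5) square[OF yV nzy(2)] by simp
  then have "\<phi> z w * \<phi> r w = 1"
    using prod_val[OF zD(3) B(8), of w] by (cases "adj t z r") auto
  then have zw: "\<phi> z w * \<phi> q w = -1" using B(14) by simp
  have "\<phi> z u * \<phi> q u = 1"
    using ip3[OF zD(3) qD(3) zne(2) B(6)] B(4) za zw nadj by simp
  then have zu: "\<phi> z u * \<phi> p u = -1" "\<phi> z u \<noteq> 0" using B(7) by auto
  have zs: "z \<in> slim t" by (rule two_supp_slim[OF zD(3), of w u]) (use zw zu B(4) in auto)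
  have "supp \<phi> z = {b, w, u}"
    by (rule supp_eq3[OF zs]) (use zw zu B(4) zD(5) nzy in auto)
  then have "v \<notin> supp \<phi> z" using B(4) by auto
  then have "\<phi> z v = 0" by (simp add: in_supp)
  then show False using ip3[OF zD(3) pD(3) zne(1) B(5)] B(4) za zu nadj by simp
qed

text \<open>A third neighbour at \<open>a\<close> would have to cancel against \<open>q\<close> at
  \<open>w\<close>, where \<open>r\<close> is opposite to \<open>q\<close>. Together with the
  coordinate \<open>a\<close>, its product with \<open>r\<close> would be 2.\<close>

lemma blocked_two_nbrs:
  assumes bl: "blocked y a b p q r u v w" and y: "a \<in> supp \<phi> y" "b \<in> supp \<phi> y"
  shows "nbr_at y a = {p, q}"
proof (rule ccontr)
  note B = blockedD[OF bl]
  assume "nbr_at y a \<noteq> {p, q}"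
  then obtain s where s: "s \<in> nbr_at y a" "s \<noteq> p" "s \<noteq> q" using B(1,2) by blast
  note pD = nbr_atD[OF B(1)] and qD = nbr_atD[OF B(2)] and sD = nbr_atD[OF s(1)]
  have yV: "y \<in> hverts t" using sD(1) adj_verts by blast
  have ne: "a \<noteq> b" and nzy: "\<phi> y a \<noteq> 0" using B(4) y in_supp by auto
  have sb: "\<phi> s b = 0" using sD(6)[OF y(2)] ne by simp
  have sr: "s \<noteq> r" using B(10) sD(1) by blast
  have nadj: "\<not> adj t s p" "\<not> adj t s q"
    using no_triangle[OF sD(1) pD(1)] no_triangle[OF sD(1) qD(1)] by auto
  note yy = square[OF yV nzy]
  have sp: "1 + \<phi> s u * \<phi> p u + \<phi> s v * \<phi> p v = 0"
    using ip3[OF sD(3) pD(3) s(2) B(5)] B(4) sD(5) pD(5) nadj yy by simp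
  have sq: "1 - \<phi> s u * \<phi> p u + \<phi> s w * \<phi> q w = 0"
    using ip3[OF sD(3) qD(3) s(3) B(6)] B(4,7) sD(5) qD(5) nadj yy by simp
  have "\<phi> s w * \<phi> q w = -1"
    using sp sq prod_val[OF sD(3) pD(3), of u] prod_val[OF sD(3) pD(3), of v]
      prod_val[OF sD(3) qD(3), of w] by auto
  then have "\<phi> s w * \<phi> r w = 1" using B(14) by simp
  then have "2 = (of_bool (adj t s r) :: int)"
    using ip3[OF sD(3) B(8) sr B(11)] B(4,12) sD(5) sb yy by simp
  then show False by (cases "adj t s r") auto
qed

text \<open>Both blocking vertices are opposite to \<open>y\<close> at \<open>b\<close>, so they
  have product 1 there. Adjacency of \<open>r\<close> and \<open>r'\<close> gives a 5-cycle through
  \<open>y\<close>, \<open>p\<close> and \<open>p'\<close>. Otherwise they cancel at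
  \<open>w' = w\<close>, whence \<open>r'\<close> is adjacent to \<open>q\<close>, which gives a
  4-cycle.\<close>

lemma not_blocked_twice:
  assumes b1: "blocked y a b p q r u v w" and b2: "blocked y c b p' q' r' u' v' w'"
    and y: "supp \<phi> y = {a, b, c}" "a \<noteq> c"
  shows False
proof -
  note B = blockedD[OF b1] and B' = blockedD[OF b2]
  note pD = nbr_atD[OF B(1)] and qD = nbr_atD[OF B(2)]
    and p'D = nbr_atD[OF B'(1)] and q'D = nbr_atD[OF B'(2)]
  have yV: "y \<in> hverts t" using pD(1) adj_verts by blast
  have nzy: "\<phi> y a \<noteq> 0" "\<phi> y b \<noteq> 0" "\<phi> y c \<noteq> 0" using y(1) in_supp by auto
  have c0: "\<phi> p c = 0" "\<phi> q c = 0" "\<phi> p' a = 0" "\<phi> q' a = 0"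
    using pD(6)[of c] qD(6)[of c] p'D(6)[of a] q'D(6)[of a] y by auto
  have cu: "c \<notin> {u, v, w}" "a \<notin> {u', v', w'}"
    using c0 B(5,6) B'(5,6) in_supp[of c p] in_supp[of c q] in_supp[of a p'] in_supp[of a q'] by auto
  have r0: "\<phi> r c = 0" "\<phi> r' a = 0"
  proof -
    have "c \<notin> supp \<phi> r" "a \<notin> supp \<phi> r'" using B(4,11) B'(4,11) cu y by auto
    then show "\<phi> r c = 0" "\<phi> r' a = 0" by (auto simp: in_supp)
  qed
  have ne: "r \<noteq> r'" "p \<noteq> p'" "q \<noteq> p'" "r \<noteq> p" "r' \<noteq> p'" "r \<noteq> p'" "r' \<noteq> p" "r' \<noteq> q"
    using r0 B'(12) nzy c0 p'D(5) B(10) B'(10) pD(1) qD(1) p'D(1) by auto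
  have rb: "\<phi> r b * \<phi> r' b = 1" using B(13) B'(13) square[OF yV nzy(2)] by simp
  have rr: "1 + \<phi> r w' * \<phi> r' w' = of_bool (adj t r r')"
    using ip3[OF B(8) B'(8) ne(1) B'(11)] B'(4) r0 rb by simp
  show False
  proof (cases "adj t r r'")
    case True
    have "vertex_cycle (adj t) [y, p, r, r', p']"
      using pD(1,4) p'D(1,2,4) B(9,15) B'(9,15) ne True adj_sym[of r p]
      by (auto simp: vertex_cycle_def)
    then show False using no_cycle by blast
  next
    case False
    then have rw: "\<phi> r w' * \<phi> r' w' = -1" using rr by simp
    then have "w' \<in> supp \<phi> r" by (auto simp: in_supp)
    then have "w' = w" using B(11) B'(4) cu by auto
    have "\<phi> r' w = \<phi> q w"
      using eq_of_prod(2)[OF B(8) B'(8) rw] B(14) \<open>w' = w\<close> by simp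
    moreover have "\<phi> q w \<noteq> 0" using B(6) in_supp by blast
    ultimately have qw: "\<phi> r' w * \<phi> q w = 1" using square[OF qD(3)] by simp
    have "u \<notin> supp \<phi> r'" using B'(11) B(4) cu \<open>w' = w\<close> by auto
    then have "\<phi> r' u = 0" by (simp add: in_supp)
    then have "(1::int) = of_bool (adj t r' q)"
      using ip3[OF B'(8) qD(3) ne(8) B(6)] B(4) r0 qw by simp
    then have "adj t r' q" by (cases "adj t r' q") auto
    then have "vertex_cycle (adj t) [y, q, r', p']"
      using qD(1,4) p'D(1,2,4) B'(9,15) ne adj_sym[of r' q] by (auto simp: vertex_cycle_def)
    then show False using no_cycle by blast
  qed
qed

text \<open>A vertex spoiling the hub cannot be a neighbour, since neighbours meet \<open>y\<close>
  in one coordinate. So it has inner product 0 with \<open>y\<close> and needs a second common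
  coordinate \<open>j\<close> for the cancellation.\<close>

lemma hub_or_blocked:
  assumes y: "y \<in> slim t" and i: "i \<in> supp \<phi> y"
    and pq: "p \<in> nbr_at y i" "q \<in> nbr_at y i" "p \<noteq> q"
    and not: "\<not> (\<exists>\<ff>\<in>family_F. hoffman_iso t \<ff>)"
  shows "\<exists>j\<in>supp \<phi> y. j \<noteq> i \<and> (\<exists>p q r u v w. blocked y i j p q r u v w)"
proof -
  have yV: "y \<in> hverts t" using y verts_simps by blast
  have nz: "\<phi> y i \<noteq> 0" using i in_supp by blast
  have mem: "p \<in> members y i" "q \<in> members y i"
    using nbr_atD[OF pq(1)] nbr_atD[OF pq(2)] nz by (auto simp: members_def)
  have "\<not> hub y i" using hub_in_family mem pq(3) not by blast
  then obtain r where r: "r \<in> hverts t" "r \<noteq> y" "\<phi> r i \<noteq> 0"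
    "\<not> (adj t y r \<and> supp \<phi> r \<inter> supp \<phi> y = {i})"
    using yV nz unfolding hub_def by blast
  obtain z where z: "adj t y z" "z \<noteq> r"
    using nbr_atD(1)[OF pq(1)] nbr_atD(1)[OF pq(2)] pq(3) by blast
  have nadj: "\<not> adj t y r"
  proof
    assume a: "adj t y r"
    obtain k where k: "k \<in> supp \<phi> y" "r \<in> nbr_at y k"
      using nbr_at_exists[OF y a z(1)] z(2) by blast
    have "supp \<phi> r \<inter> supp \<phi> y = {i}"
    proof -
      have "k = i" using nbr_atD(6)[OF k(2) i] r(3) by blast
      then have "\<phi> r j = 0" if "j \<in> supp \<phi> y" "j \<noteq> i" for j using nbr_atD(6)[OF k(2) that(1)] that by blast
      then show ?thesis using i r(3) in_supp by blast
    qed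
    then show False using r(4) a by blast
  qed
  have "\<exists>j\<in>supp \<phi> y. j \<noteq> i \<and> \<phi> r j \<noteq> 0"
  proof (rule ccontr)
    assume no: "\<not> ?thesis"
    have "(\<Sum>j\<in>supp \<phi> y. \<phi> r j * \<phi> y j) = (\<Sum>j\<in>{i}. \<phi> r j * \<phi> y j)"
      by (rule sum.mono_neutral_right) (use no i in auto)
    then have "\<phi> r i * \<phi> y i = of_bool (adj t r y)" using ip_supp[OF r(1) yV r(2)] by simp
    then show False using r(3) nz nadj adj_sym by simp
  qed
  then obtain j where j: "j \<in> supp \<phi> y" "j \<noteq> i" "\<phi> r j \<noteq> 0" by blast
  have "\<phi> y j \<noteq> 0" using j in_supp by blast
  then obtain k where k: "distinct [i, j, k]" "supp \<phi> y = {i, j, k}"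
    using supp3'[OF y nz _ j(2)[symmetric]] by blast
  show ?thesis using blockedI[OF y k(2,1) pq r(1,2) nadj r(3) j(3)] j by blast
qed

text \<open>Some coordinate \<open>a\<close> has two neighbours and is blocked through some
  \<open>b\<close>. Then \<open>b\<close> has none and \<open>a\<close> exactly two, so the third
  coordinate \<open>c\<close> also has two and is blocked. It cannot be blocked through
  \<open>a\<close>, which has neighbours, so it is blocked through \<open>b\<close> again.\<close>

lemma large_degree:
  assumes y: "y \<in> slim t" and deg: "4 \<le> card {z. adj t y z}"
  shows "\<exists>\<ff>\<in>family_F. hoffman_iso t \<ff>"
proof (rule ccontr)
  assume not: "\<not> ?thesis"
  define N where "N = {z. adj t y z}"
  have finN: "finite N"
    by (rule finite_subset[of _ "hverts t"]) (use adj_verts in \<open>auto simp: N_def\<close>)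
  have sub: "nbr_at y i \<subseteq> N" for i by (auto simp: nbr_at_def N_def)
  then have fin: "finite (nbr_at y i)" for i using finN finite_subset by blast
  have "\<exists>i\<in>supp \<phi> y. x \<in> nbr_at y i" if xN: "x \<in> N" for x
  proof -
    have "N \<noteq> {x}" using deg by (auto simp: N_def)
    then obtain z where "adj t y z" "x \<noteq> z" using xN by (auto simp: N_def)
    then show ?thesis using nbr_at_exists[OF y] xN by (auto simp: N_def)
  qed
  then have cover: "N \<subseteq> (\<Union>i\<in>supp \<phi> y. nbr_at y i)" by blast
  have two: "\<exists>p q. p \<in> nbr_at y i \<and> q \<in> nbr_at y i \<and> p \<noteq> q" if two: "2 \<le> card (nbr_at y i)" for i
  proof -
    obtain A where "A \<subseteq> nbr_at y i" "card A = 2" using obtain_subset_with_card_n[OF two] by metis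
    then show ?thesis unfolding card_2_iff by blast
  qed
  have "supp \<phi> y \<noteq> {}" using card_supp[OF y] by auto
  then obtain i0 where "\<phi> y i0 \<noteq> 0" using in_supp by auto
  then obtain j0 k0 where s0: "distinct [i0, j0, k0]" "supp \<phi> y = {i0, j0, k0}" using supp3[OF y] by blast
  have "card N \<le> card (nbr_at y i0 \<union> nbr_at y j0 \<union> nbr_at y k0)"
    by (rule card_mono) (use fin cover s0 in auto)
  also have "\<dots> \<le> card (nbr_at y i0) + card (nbr_at y j0) + card (nbr_at y k0)"
    using card_Un_le[of "nbr_at y i0 \<union> nbr_at y j0" "nbr_at y k0"] card_Un_le[of "nbr_at y i0" "nbr_at y j0"]
    by linarith
  finally have "\<exists>i\<in>supp \<phi> y. 2 \<le> card (nbr_at y i)" using deg s0 unfolding N_def[symmetric] by fastforce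
  then obtain a where a: "a \<in> supp \<phi> y" "2 \<le> card (nbr_at y a)" by blast
  obtain b p q r u v w where b: "b \<in> supp \<phi> y" "b \<noteq> a" "blocked y a b p q r u v w"
    using hub_or_blocked[OF y a(1) _ _ _ not] two[OF a(2)] by blast
  have "\<phi> y a \<noteq> 0" "\<phi> y b \<noteq> 0" using a b in_supp by auto
  then obtain c where c: "distinct [a, b, c]" "supp \<phi> y = {a, b, c}" using supp3'[OF y] b(2) by metis
  have Nb: "nbr_at y b = {}" by (rule blocked_no_nbr[OF b(3) a(1) b(1)])
  have Na: "nbr_at y a = {p, q}" by (rule blocked_two_nbrs[OF b(3) a(1) b(1)])
  have "card N \<le> card (nbr_at y a \<union> nbr_at y c)"
    by (rule card_mono) (use fin cover c Nb in auto)
  also have "\<dots> \<le> card (nbr_at y a) + card (nbr_at y c)" by (rule card_Un_le)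
  also have "card (nbr_at y a) \<le> 2" unfolding Na using card_insert_le_m1[of 2 "{q}" p] by simp
  finally have "2 \<le> card (nbr_at y c)" using deg unfolding N_def[symmetric] by linarith
  moreover have cs: "c \<in> supp \<phi> y" using c by simp
  ultimately obtain d p' q' r' u' v' w' where d: "d \<in> supp \<phi> y" "d \<noteq> c"
    "blocked y c d p' q' r' u' v' w'"
    using hub_or_blocked[OF y cs _ _ _ not] two[of c] by blast
  have "nbr_at y d = {}" by (rule blocked_no_nbr[OF d(3) cs d(1)])
  then have "d \<noteq> a" using Na by auto
  then have "d = b" using d c by auto
  then show False using not_blocked_twice[OF b(3) _ c(2)] d(3) c(1) by auto
qed

end

section \<open>Trees of small degree\<close>

text \<open>Indicator vectors turn inner products into sizes of intersections. The numbering
  \<open>e\<close> is returned so that a single set element can be traced to its coordinate.\<close>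

lemma rep3_of_sets:
  fixes C :: "'a \<Rightarrow> 'c set"
  assumes h: "hoffman_graph t"
    and fin: "\<And>x. x \<in> hverts t \<Longrightarrow> finite (C x)"
    and slim: "\<And>x. x \<in> slim t \<Longrightarrow> card (C x) = 3" and fat: "\<And>x. x \<in> fat t \<Longrightarrow> card (C x) = 1"
    and ip: "\<And>x y. x \<in> hverts t \<Longrightarrow> y \<in> hverts t \<Longrightarrow> x \<noteq> y \<Longrightarrow>
      card (C x \<inter> C y) = of_bool (adj t x y)"
  shows "\<exists>n \<phi> e. rep3 t n \<phi> \<and> (\<forall>x k. \<phi> x k \<in> {0, 1}) \<and>
    (\<forall>x\<in>hverts t. \<forall>u\<in>C x. \<forall>y\<in>hverts t. \<phi> y (e u) \<noteq> 0 \<longleftrightarrow> u \<in> C y)"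
proof -
  note hv = hverts_slim_fat[OF h]
  define U where "U = (\<Union>x\<in>hverts t. C x)"
  have "finite (hverts t)" using h unfolding hoffman_graph_iff by blast
  then have "finite U" using fin by (auto simp: U_def)
  then obtain e where e: "bij_betw e U {0..<card U}" using ex_bij_betw_finite_nat by blast
  define \<phi> :: "'a \<Rightarrow> nat \<Rightarrow> int" where "\<phi> x k = of_bool (x \<in> hverts t \<and> k \<in> e ` C x)" for x k
  have inj: "inj_on e U" using e by (simp add: bij_betw_def)
  have CU: "C x \<subseteq> U" if "x \<in> hverts t" for x using that by (auto simp: U_def)
  have less: "k < card U" if "x \<in> hverts t" "k \<in> e ` C x" for x k
  proof -
    have "k \<in> e ` U" using that CU by blast
    then show ?thesis using e by (simp add: bij_betw_def)
  qed
  have inner: "inner_int (card U) (\<phi> x) (\<phi> y) = int (card (C x \<inter> C y))"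
    if xy: "x \<in> hverts t" "y \<in> hverts t" for x y
  proof -
    have "inner_int (card U) (\<phi> x) (\<phi> y) = (\<Sum>k<card U. of_bool (k \<in> e ` C x \<inter> e ` C y))"
      unfolding inner_int_def \<phi>_def using xy by (intro sum.cong) auto
    also have "\<dots> = int (card ({..<card U} \<inter> (e ` C x \<inter> e ` C y)))"
      by (simp add: of_bool_def sum.If_cases Int_def)
    also have "{..<card U} \<inter> (e ` C x \<inter> e ` C y) = e ` (C x \<inter> C y)"
      using less xy inj_on_image_Int[OF inj CU CU] by auto
    also have "card \<dots> = card (C x \<inter> C y)"
      by (rule card_image) (use inj CU xy in \<open>meson inf.coboundedI1 inj_on_subset\<close>)
    finally show ?thesis .
  qed
  have "rep3 t (card U) \<phi>"
    unfolding rep3_def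
  proof (intro conjI ballI allI impI)
    show "inner_int (card U) (\<phi> x) (\<phi> x) = 3" if "x \<in> slim t" for x
      using inner[of x x] slim[OF that] hv(3)[OF that] by simp
    show "inner_int (card U) (\<phi> x) (\<phi> x) = 1" if "x \<in> fat t" for x
      using inner[of x x] fat[OF that] hv(4)[OF that] by simp
    show "inner_int (card U) (\<phi> x) (\<phi> y) = (if adj t x y then 1 else 0)"
      if "x \<in> hverts t" "y \<in> hverts t" "x \<noteq> y" for x y
      using inner[OF that(1,2)] ip[OF that] by simp
    show "\<phi> x k = 0" if "card U \<le> k" for x k
      using less[of x k] that by (auto simp: \<phi>_def)
  qed
  moreover have "\<phi> y (e u) \<noteq> 0 \<longleftrightarrow> u \<in> C y" if "x \<in> hverts t" "u \<in> C x" "y \<in> hverts t" for x u y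
    using inj_on_image_mem_iff[OF inj _ CU[OF that(3)], of u] CU[OF that(1)] that by (auto simp: \<phi>_def)
  moreover have "\<phi> x k \<in> {0, 1}" for x k by (simp add: \<phi>_def)
  ultimately show ?thesis by blast
qed

text \<open>One coordinate for each edge and private coordinates to make up the norm represent every tree
  in which slim vertices have degree at most 3 and fat vertices have degree 1.\<close>

lemma small_degree_rep:
  assumes h: "hoffman_graph t"
    and fat: "\<And>f. f \<in> fat t \<Longrightarrow> card {z. adj t f z} = 1"
    and slim: "\<And>x. x \<in> slim t \<Longrightarrow> card {z. adj t x z} \<le> 3"
  shows "\<exists>n \<phi>. rep3 t n \<phi> \<and> (\<forall>x k. \<phi> x k \<in> {0, 1}) \<and>
    (\<forall>x\<in>slim t. card {z. adj t x z} < 3 \<longrightarrow> (\<exists>k. \<phi> x k \<noteq> 0 \<and> (\<forall>y\<in>hverts t. \<phi> y k \<noteq> 0 \<longrightarrow> y = x)))"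
proof -
  note hv = hverts_slim_fat[OF h]
  define D where "D x = {z. adj t x z}" for x
  have A: "x \<in> hverts t \<and> y \<in> hverts t \<and> x \<noteq> y \<and> adj t y x" if "adj t x y" for x y
    using h that unfolding hoffman_graph_iff by blast
  have finV: "finite (hverts t)" using h unfolding hoffman_graph_iff by blast
  have finD: "finite (D x)" for x
    by (rule finite_subset[OF _ finV]) (use A in \<open>auto simp: D_def\<close>)
  \<comment> \<open>\<open>Inl\<close> holds the edges at \<open>x\<close>, \<open>Inr\<close> its
    private elements. The truncated difference is exact for slim vertices because their degree is at
    most 3; a fat vertex has norm 1 from its single edge alone.\<close>
  define C :: "'a \<Rightarrow> ('a set + 'a \<times> nat) set" where
    "C x = (\<lambda>z. Inl {x, z}) ` D x \<union> (\<lambda>j. Inr (x, j)) ` {..<(if x \<in> fat t then 0 else 3 - card (D x))}"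
    for x
  have finC: "finite (C x)" for x using finD by (simp add: C_def)
  have cardC: "card (C x) = card (D x) + (if x \<in> fat t then 0 else 3 - card (D x))" for x
  proof -
    have "card ((\<lambda>z. Inl {x, z} :: 'a set + 'a \<times> nat) ` D x) = card (D x)"
      by (rule card_image) (auto simp: inj_on_def doubleton_eq_iff)
    moreover have "card ((\<lambda>j. Inr (x, j) :: 'a set + 'a \<times> nat) ` {..<m}) = m" for m :: nat
      by (subst card_image) (auto simp: inj_on_def)
    moreover have "(\<lambda>z. Inl {x, z}) ` D x \<inter> (\<lambda>j. Inr (x, j)) ` B = {}" for B :: "nat set"
      by auto
    ultimately show ?thesis unfolding C_def using finD by (subst card_Un_disjoint) auto
  qed
  have inter: "C x \<inter> C y = (if adj t x y then {Inl {x, y}} else {})" if "x \<noteq> y" for x y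
  proof -
    have "Inl {x, y} \<in> C x \<and> Inl {x, y} \<in> C y" if "adj t x y"
      using that A[OF that] by (auto simp: C_def D_def insert_commute)
    moreover have "u = Inl {x, y} \<and> adj t x y" if "u \<in> C x" "u \<in> C y" for u
      using that \<open>x \<noteq> y\<close> by (auto simp: C_def D_def doubleton_eq_iff)
    ultimately show ?thesis by auto
  qed
  have "\<exists>n \<phi> e. rep3 t n \<phi> \<and> (\<forall>x k. \<phi> x k \<in> {0, 1}) \<and>
    (\<forall>x\<in>hverts t. \<forall>u\<in>C x. \<forall>y\<in>hverts t. \<phi> y (e u) \<noteq> 0 \<longleftrightarrow> u \<in> C y)"
  proof (rule rep3_of_sets[OF h finC])
    show "card (C x) = 3" if "x \<in> slim t" for x
      using cardC[of x] slim[OF that] that hv(2) by (auto simp: D_def)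
    show "card (C x) = 1" if "x \<in> fat t" for x
      using cardC[of x] fat[OF that] that by (simp add: D_def)
    show "card (C x \<inter> C y) = of_bool (adj t x y)" if "x \<noteq> y" for x y
      using inter[OF that] by simp
  qed
  then obtain n \<phi> e where \<phi>: "rep3 t n \<phi>" "\<forall>x k. \<phi> x k \<in> {0, 1}"
    and e: "\<forall>x\<in>hverts t. \<forall>u\<in>C x. \<forall>y\<in>hverts t. \<phi> y (e u) \<noteq> 0 \<longleftrightarrow> u \<in> C y"
    by blast
  have "\<exists>k. \<phi> x k \<noteq> 0 \<and> (\<forall>y\<in>hverts t. \<phi> y k \<noteq> 0 \<longrightarrow> y = x)"
    if x: "x \<in> slim t" and deg: "card {z. adj t x z} < 3" for x
  proof -
    have xV: "x \<in> hverts t" using x hv(3) by blast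
    have "x \<notin> fat t" using x hv(2) by blast
    then have mem: "Inr (x, 0) \<in> C x" using deg by (auto simp: C_def D_def)
    have "y = x" if "Inr (x, 0) \<in> C y" for y using that by (auto simp: C_def)
    then show ?thesis using e xV mem by (intro exI[of _ "e (Inr (x, 0))"]) blast
  qed
  then show ?thesis using \<phi> by blast
qed

text \<open>In a nonnegative representation every coordinate has constant sign, so all of them can
  be deleted and any single slim vertex is cut off from the rest. Fewer than three neighbours would
  leave it a private coordinate, against maximality.\<close>

lemma (in maximal_rep) small_degree:
  assumes fat: "\<And>f. f \<in> fat t \<Longrightarrow> card {z. adj t f z} = 1"
    and slim: "\<And>x. x \<in> slim t \<Longrightarrow> card {z. adj t x z} \<le> 3"
  shows "hoffman_iso t three_fat"
proof -
  obtain m \<psi> where \<psi>: "rep3 t m \<psi>" "\<And>x k. \<psi> x k \<in> {0, 1}" and priv: "\<And>x. x \<in> slim t \<Longrightarrow>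
      card {z. adj t x z} < 3 \<Longrightarrow> \<exists>k. \<psi> x k \<noteq> 0 \<and> (\<forall>y\<in>hverts t. \<psi> y k \<noteq> 0 \<longrightarrow> y = x)"
    using small_degree_rep[OF hoffman fat slim] by metis
  interpret E: maximal_rep TT t m \<psi> using reps max \<psi>(1) by unfold_locales
  have "\<exists>x. x \<in> slim t"
  proof -
    have "hverts t \<noteq> {}" using in_class tree_like_iff[OF hoffman] by (auto simp: in_class_T_def)
    then show ?thesis using verts_simps(1) hoffman unfolding hoffman_graph_iff by blast
  qed
  then obtain x where x: "x \<in> slim t" by blast
  have xV: "x \<in> hverts t" using x verts_simps(3) by blast
  have S: "slim t = {x}"
  \<comment> \<open>With every coordinate used by a slim vertex in \<open>K\<close>, the remaining
    sum has only zero terms.\<close>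
  proof (rule E.separated[of "{k. \<exists>z\<in>slim t. \<psi> z k \<noteq> 0}"])
    have nn: "0 \<le> \<psi> z k" for z k using \<psi>(2)[of z k] by auto
    show "0 \<le> \<psi> z k * \<psi> y k" for z y k using nn by simp
    show "(\<Sum>i\<in>{..<m} - (fat_coords t \<psi> \<union> {k. \<exists>z\<in>slim t. \<psi> z k \<noteq> 0}). \<psi> y i * \<psi> z i) = 0"
      if "y \<in> {x}" for y z
      by (rule sum.neutral) (use that x in auto)
  qed (use x in auto)
  define N where "N = {z. adj t x z}"
  have cN: "card N = 3"
  proof (rule ccontr)
    assume "card N \<noteq> 3"
    then have "card {z. adj t x z} < 3" using slim[OF x] by (simp add: N_def)
    then show False using priv[OF x] E.pendant[OF \<psi>(1) x] by blast
  qed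
  have fatN: "fat t = N"
  proof
    show "fat t \<subseteq> N"
    proof
      fix f assume "f \<in> fat t"
      then obtain y where "y \<in> slim t" "adj t f y" using hoffman unfolding hoffman_graph_iff by blast
      then show "f \<in> N" using S adj_sym by (auto simp: N_def)
    qed
    show "N \<subseteq> fat t" using nonslim adj_verts S by (auto simp: N_def)
  qed
  have V: "hverts t = insert x N" using verts_simps(1) S fatN by simp
  obtain f1 f2 f3 where f: "N = {f1, f2, f3}" "f1 \<noteq> f2" "f1 \<noteq> f3" "f2 \<noteq> f3"
    using cN by (auto simp: card_3_iff)
  have xN: "x \<notin> N" using adj_verts[of x x] by (auto simp: N_def)
  have a: "adj t x z" "adj t z x" if "z \<in> N" for z using that adj_sym[of x z] by (auto simp: N_def)
  have na: "\<not> adj t y z" if "y \<in> N" "z \<in> N" for y z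
    using that hoffman unfolding fatN[symmetric] hoffman_graph_iff by blast
  have irr: "\<not> adj t x x" using adj_verts[of x x] by blast
  define \<sigma> where "\<sigma> l = (case l of F i \<Rightarrow> if i = 1 then f1 else if i = 2 then f2 else f3 | S i \<Rightarrow> x)" for l
  have fN: "f1 \<in> N" "f2 \<in> N" "f3 \<in> N" using f by auto
  have xf: "x \<noteq> f1" "x \<noteq> f2" "x \<noteq> f3" using xN fN by auto
  have L: "hverts three_fat = {S 1, F 1, F 2, F 3}"
    by (auto simp: three_fat_def mk_hoffman_simps)
  show ?thesis
  proof (rule hoffman_iso_from_labels[of \<sigma>])
    show "bij_betw \<sigma> (hverts three_fat) (hverts t)"
      unfolding L V f(1) using f xf by (auto simp: bij_betw_def inj_on_def \<sigma>_def)
    show "adj t (\<sigma> y) (\<sigma> z) \<longleftrightarrow> adj three_fat y z"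
      if "y \<in> hverts three_fat" "z \<in> hverts three_fat" for y z
      using that unfolding L three_fat_def mk_hoffman_simps
      by (elim UnE insertE emptyE) (simp_all add: \<sigma>_def irr a[OF fN(1)] a[OF fN(2)] a[OF fN(3)] na fN)
    show "\<sigma> y \<in> fat t \<longleftrightarrow> y \<in> fat three_fat" if "y \<in> hverts three_fat" for y
      using that unfolding L three_fat_def mk_hoffman_simps fatN
      by (elim UnE insertE emptyE) (simp_all add: \<sigma>_def fN xN)
  qed
qed

theorem theorem4p2:
  fixes T :: "'a::infinite hoffman set" and t :: "'a hoffman"
  assumes "iso_representatives in_class_T T"
    and "maximal_member T t"
  shows "\<exists>\<ff>\<in>family_F. hoffman_iso t \<ff>"
proof -
  have cl: "in_class_T t" using assms by (auto simp: iso_representatives_def maximal_member_def)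
  then obtain n \<phi> where "rep3 t n \<phi>"
    unfolding in_class_T_def integrally_representable_iff_rep3 by blast
  then interpret maximal_rep T t n \<phi> using assms by unfold_locales
  show ?thesis
  proof (rule ccontr)
    assume not: "\<not> ?thesis"
    have "card {z. adj t f z} = 1" if f: "f \<in> fat t" for f
    proof -
      obtain x where x: "adj t f x" using f hoffman unfolding hoffman_graph_iff by blast
      have "{z. adj t f z} = {x}" using fat_hub[OF f x] x not by blast
      then show ?thesis by simp
    qed
    moreover have "card {z. adj t x z} \<le> 3" if "x \<in> slim t" for x
      using large_degree[OF that] not by force
    ultimately have "hoffman_iso t three_fat" using small_degree by blast
    then show False using not by (auto simp: family_F_def)
  qed
qed

end
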